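(* Let $X=(X_t)_{t\ge 0}$ be a real-valued Lévy process with Lévy symbol $\eta$. Suppose that (A) $\dfrac{1}{q-\eta(u)}\in L^1(\mathbb{R})$ (as a function of $u$) for all $q>0$, and (B) $\displaystyle\int_0^1\left|\mathrm{Im}\left(\frac{u}{\eta(u)}\right)\right|du<\infty$. Let $$h(x):=\frac1\pi\int_0^\infty\mathrm{Re}\left(\frac{e^{iux}-1}{\eta(u)}\right)du,\qquad x\in\mathbb{R}.$$ Then for all $t\ge0$ and $x\in\mathbb{R}$, $$\mathbb{E}^0_x[h(X_t)]=h(x),$$ where $\mathbb{E}^0_x$ is the expectation for $X$ started at $x$ and killed upon hitting zero.
   Context: $\mathbb{P}_x$, $\mathbb{E}_x$ denote the law of $X$ started at $x$ and its expectation. The Lévy symbol $\eta$ is defined by $\mathbb{E}_0[e^{iuX_t}]=e^{t\eta(u)}$, with $$\eta(u)=ibu-\tfrac12au^2+\int_{\mathbb{R}\setminus\{0\}}\left(e^{iuy}-1-iuy1_{|y|\le1}\right)\nu(dy),$$ where $b\in\mathbb{R}$, $a\ge0$ and $\nu$ is a measure on $\mathbb{R}\setminus\{0\}$ with $\int(|y|^2\wedge1)\,\nu(dy)<\infty$. Let $T_0:=\inf\{t>0:X_t=0\}$. The expectation for the killed process is $\mathbb{E}^0_x[f(X_t)]=\mathbb{E}_x[f(X_t);\,t<T_0]$ (functions are taken to vanish at the cemetery state). Note that $h(0)=0$. *)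

theory Defs
  imports "HOL-Probability.Probability"
begin

text \<open>Paths and processes are indexed by all reals; only times \<open>t \<ge> 0\<close> are ever looked at.\<close>

definition cadlag :: "(real \<Rightarrow> real) \<Rightarrow> bool" where
  "cadlag w \<longleftrightarrow>
     (\<forall>t\<ge>0. continuous (at_right t) w) \<and> (\<forall>t>0. \<exists>l. (w \<longlongrightarrow> l) (at_left t))"

text \<open>\<open>X\<close> is the process under the law \<open>P\<^sub>0\<close>; by spatial homogeneity the law \<open>P\<^sub>x\<close> is that of the
  process \<open>x + X\<close>.\<close>

definition levy_process :: "'a measure \<Rightarrow> (real \<Rightarrow> 'a \<Rightarrow> real) \<Rightarrow> bool" where
  "levy_process M X \<longleftrightarrow>
     prob_space M \<and>
     (\<forall>t\<ge>0. X t \<in> borel_measurable M) \<and>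
     (AE \<omega> in M. X 0 \<omega> = 0) \<and>
     (AE \<omega> in M. cadlag (\<lambda>t. X t \<omega>)) \<and>
     (\<forall>n (t :: nat \<Rightarrow> real). 0 \<le> t 0 \<longrightarrow> (\<forall>i<n. t i \<le> t (Suc i)) \<longrightarrow>
        prob_space.indep_vars M (\<lambda>_. borel) (\<lambda>i \<omega>. X (t (Suc i)) \<omega> - X (t i) \<omega>) {..<n}) \<and>
     (\<forall>s\<ge>0. \<forall>t\<ge>0. distr M borel (\<lambda>\<omega>. X (s + t) \<omega> - X s \<omega>) = distr M borel (X t))"

text \<open>A measure on \<open>\<real> - {0}\<close> is represented as a Borel measure on the line that gives no mass
  to \<open>0\<close>.\<close>

definition levy_measure :: "real measure \<Rightarrow> bool" where
  "levy_measure \<nu> \<longleftrightarrow>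
     sets \<nu> = sets borel \<and> emeasure \<nu> {0} = 0 \<and> integrable \<nu> (\<lambda>y. min (\<bar>y\<bar>\<^sup>2) 1)"

definition levy_khintchine :: "real \<Rightarrow> real \<Rightarrow> real measure \<Rightarrow> real \<Rightarrow> complex" where
  "levy_khintchine b a \<nu> u =
     \<i> * b * u - 1 / 2 * a * u\<^sup>2 +
     (CLINT y|\<nu>. iexp (u * y) - 1 - \<i> * u * y * of_bool (\<bar>y\<bar> \<le> 1))"

definition is_levy_symbol :: "'a measure \<Rightarrow> (real \<Rightarrow> 'a \<Rightarrow> real) \<Rightarrow> (real \<Rightarrow> complex) \<Rightarrow> bool" where
  "is_levy_symbol M X \<eta> \<longleftrightarrow>
     (\<forall>t\<ge>0. \<forall>u. (CLINT \<omega>|M. iexp (u * X t \<omega>)) = exp (of_real t * \<eta> u))"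

text \<open>The infimum is taken in the extended reals, so that it is \<open>\<infinity>\<close> for a path that never hits \<open>0\<close>.\<close>

definition hit_zero :: "(real \<Rightarrow> real) \<Rightarrow> ereal" where
  "hit_zero w = Inf {ereal t |t. t > 0 \<and> w t = 0}"

text \<open>\<open>killed_eval X x f t\<close> is \<open>f\<close> evaluated at time \<open>t\<close> along the process started at \<open>x\<close> and killed
  upon hitting zero, with value \<open>0\<close> at the cemetery.\<close>

definition killed_eval ::
    "(real \<Rightarrow> 'a \<Rightarrow> real) \<Rightarrow> real \<Rightarrow> (real \<Rightarrow> real) \<Rightarrow> real \<Rightarrow> 'a \<Rightarrow> real" where
  "killed_eval X x f t \<omega> =
     (if ereal t < hit_zero (\<lambda>s. x + X s \<omega>) then f (x + X t \<omega>) else 0)"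

text \<open>The event \<open>t < T\<^sub>0\<close> involves uncountably many times, so it need not belong to \<open>sets M\<close>;
  as usual, probabilities are taken in the completion.\<close>

definition killed_expectation ::
    "'a measure \<Rightarrow> (real \<Rightarrow> 'a \<Rightarrow> real) \<Rightarrow> real \<Rightarrow> (real \<Rightarrow> real) \<Rightarrow> real \<Rightarrow> real" where
  "killed_expectation M X x f t = (LINT \<omega>|completion M. killed_eval X x f t \<omega>)"

definition levy_h :: "(real \<Rightarrow> complex) \<Rightarrow> real \<Rightarrow> real" where
  "levy_h \<eta> x = 1 / pi * (LBINT u:{0<..}. Re ((iexp (u * x) - 1) / \<eta> u))"

end

theory Submission
  imports Defs
begin

text \<open>
  Let \<open>r\<^sub>q\<close> be the density of the \<open>q\<close>-resolvent and \<open>pot q y = r\<^sub>q (- y)\<close>, the Fourier integral of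
  \<open>1 / (q - \<eta>)\<close>, which is bounded and continuous by (A). The discounted time spent in \<open>(- e, e)\<close>, divided
  by \<open>2 e\<close>, has expectation \<open>pot_avg q e\<close>, which converges uniformly to \<open>pot q\<close>. Stopping at the first
  visit to \<open>(- e, e)\<close> along a finer and finer time grid and then letting \<open>e\<close> tend to \<open>0\<close> gives, with the
  ordinary Markov property only, that on the event \<open>G\<close> that the path stays away from zero up to time \<open>t\<close>
  the function \<open>h\<^sub>q = pot q 0 - pot q\<close> satisfies
  \<open>h\<^sub>q x - (e\<^sup>q\<^sup>t - 1) r\<^sub>q 0 \<le> E\<^sub>x [h\<^sub>q (X\<^sub>t); G] \<le> h\<^sub>q x\<close>.
  As \<open>q\<close> tends to \<open>0\<close>, \<open>q r\<^sub>q 0\<close> vanishes and \<open>h\<^sub>q\<close> tends to \<open>h\<close>, where (B) dominates the odd part of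
  the integrand. Convergence of the expectations is dominated because \<open>0 \<le> h\<^sub>q y \<le> h\<^sub>q y + h\<^sub>q (- y)\<close>, where
  the odd parts cancel, and \<open>E [1 - cos (u X\<^sub>t)] \<le> t \<bar>\<eta> u\<bar>\<close>.

  Finally \<open>G\<close> is almost surely the event that zero is not hit by time \<open>t\<close>: the path has no jump that starts
  at a left limit equal to zero, and zero is regular for itself.
\<close>

section \<open>Path regularity and independence\<close>

text \<open>Behind \<open>h_q\<close> stands the identity
  \<open>r_q (- x) = r_q 0 * E_x [exp (- q * T_0)]\<close>. A hit of zero before time
  \<open>t\<close> carries a discount known only to lie between \<open>exp (- q * t)\<close> and 1,
  so two inequalities take the place of an equality; their gap is of order \<open>q * r_q 0\<close>.
  The obstacle is that \<open>T_0\<close> involves uncountably many times and a single point. A grid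
  never sees a point, but by right continuity it sees every visit to an open ball once it is fine
  enough, and the first grid visit takes finitely many values, each decided by finitely many
  coordinates. The event \<open>G\<close> reached in the limit differs from \<open>t < T_0\<close>
  in two ways: a path may approach zero from the left and jump away, and \<open>T_0\<close> ignores
  time 0. The first is ruled out because, on fine grids, a jump larger than \<open>\<delta>\<close>
  out of \<open>(- e, e)\<close> has probability at most \<open>K * e\<close>; the second by
  immediate return to zero. (A) at \<open>q = 1\<close> also excludes a pure drift, so that
  \<open>- Re \<eta>\<close> is at least quadratic near 0, and it controls \<open>1 / \<eta>\<close>
  at infinity. Hence \<open>min (u^2) 1 / cmod (\<eta> u)\<close> is integrable, which is behind
  every domination as \<open>q\<close> tends to 0.\<close>

locale cadlag_levy = prob_space M for M :: "'a measure" +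
  fixes X :: "real \<Rightarrow> 'a \<Rightarrow> real"
  assumes X_measurable: "\<And>t. t \<ge> 0 \<Longrightarrow> X t \<in> borel_measurable M"
    and X_zero: "X 0 \<omega> = 0"
    and X_cadlag: "cadlag (\<lambda>t. X t \<omega>)"
    and X_indep: "\<And>t n. 0 \<le> t 0 \<Longrightarrow> (\<forall>i<n. t i \<le> t (Suc i)) \<Longrightarrow>
       indep_vars (\<lambda>_. borel) (\<lambda>i \<omega>. X (t (Suc i)) \<omega> - X (t i) \<omega>) {..<n}"
    and X_stationary: "\<And>s t. s \<ge> 0 \<Longrightarrow> t \<ge> 0 \<Longrightarrow>
       distr M borel (\<lambda>\<omega>. X (s + t) \<omega> - X s \<omega>) = distr M borel (X t)"

lemma grid_nonneg:
  fixes t :: "nat \<Rightarrow> real"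
  assumes "i \<le> n" "0 \<le> t 0" "\<And>i. i < n \<Longrightarrow> t i \<le> t (Suc i)"
  shows "0 \<le> t i"
  using assms(1)
proof (induction i)
  case (Suc i)
  then show ?case using assms(3)[of i] by simp
qed (use assms(2) in simp)

text \<open>The paths are set to zero on the exceptional null set and outside the space, so that
  later path arguments may quantify over all \<open>\<omega>\<close>. Independence survives because
  it is a property of joint laws, which an almost sure change leaves alone.\<close>

lemma levy_process_cadlag_version:
  assumes "levy_process M X"
  obtains Y N where "cadlag_levy M Y" "N \<in> null_sets M"
    "\<And>t \<omega>. \<omega> \<in> space M - N \<Longrightarrow> Y t \<omega> = X t \<omega>"
proof -
  interpret prob_space M using assms by (simp add: levy_process_def)
  have "AE \<omega> in M. X 0 \<omega> = 0 \<and> cadlag (\<lambda>t. X t \<omega>)"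
    using assms by (auto simp: levy_process_def)
  then obtain N where N: "N \<in> null_sets M" "\<And>\<omega>. \<omega> \<in> space M - N \<Longrightarrow> X 0 \<omega> = 0 \<and> cadlag (\<lambda>t. X t \<omega>)"
    by (elim AE_E3) auto
  define Y where "Y t \<omega> = (if \<omega> \<in> space M - N then X t \<omega> else 0)" for t \<omega>
  have eq: "\<omega> \<in> space M - N \<Longrightarrow> Y t \<omega> = X t \<omega>" for t \<omega>
    by (simp add: Y_def)
  have Xm: "X t \<in> borel_measurable M" if "t \<ge> 0" for t
    using assms that by (simp add: levy_process_def)
  have Ym: "Y t \<in> borel_measurable M" if "t \<ge> 0" for t
    unfolding Y_def using Xm[OF that] N(1) by (intro measurable_If_set) (auto)
  have ae: "AE \<omega> in M. Y t \<omega> = X t \<omega>" "AE \<omega> in M. Y t \<omega> - Y s \<omega> = X t \<omega> - X s \<omega>" for s t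
    using N(1) by (auto intro!: AE_I'[of N] simp: Y_def)
  have "cadlag_levy M Y"
  proof unfold_locales
    fix t :: real assume "t \<ge> 0" then show "Y t \<in> borel_measurable M" by (rule Ym)
  next
    fix \<omega> show "Y 0 \<omega> = 0" using N(2) by (simp add: Y_def)
  next
    fix \<omega>
    show "cadlag (\<lambda>t. Y t \<omega>)"
    proof (cases "\<omega> \<in> space M - N")
      case True then show ?thesis using N(2)[OF True] by (simp add: Y_def)
    next
      case False then show ?thesis unfolding Y_def cadlag_def
        by (auto simp del: not_gr_zero intro: exI[of _ "0::real", OF tendsto_const])
    qed
  next
    fix t :: "nat \<Rightarrow> real" and n :: nat
    assume t: "0 \<le> t 0" "\<forall>i<n. t i \<le> t (Suc i)"
    have pos: "0 \<le> t i" if "i \<le> n" for i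
      using that by (rule grid_nonneg[of _ n t]) (use t in auto)
    have "indep_vars (\<lambda>_. borel) (\<lambda>i \<omega>. X (t (Suc i)) \<omega> - X (t i) \<omega>) {..<n}"
      using assms t by (simp add: levy_process_def)
    moreover have "distr M borel (\<lambda>\<omega>. Y (t (Suc i)) \<omega> - Y (t i) \<omega>) = distr M borel (\<lambda>\<omega>. X (t (Suc i)) \<omega> - X (t i) \<omega>)" if "i < n" for i
      using that by (intro distr_cong_AE ae borel_measurable_diff Xm Ym pos refl) auto
    moreover have "distr M (PiM {..<n} (\<lambda>_. borel)) (\<lambda>\<omega>. \<lambda>i\<in>{..<n}. Y (t (Suc i)) \<omega> - Y (t i) \<omega>)
      = distr M (PiM {..<n} (\<lambda>_. borel)) (\<lambda>\<omega>. \<lambda>i\<in>{..<n}. X (t (Suc i)) \<omega> - X (t i) \<omega>)"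
    proof (intro distr_cong_AE refl)
      show "AE \<omega> in M. (\<lambda>i\<in>{..<n}. Y (t (Suc i)) \<omega> - Y (t i) \<omega>) = (\<lambda>i\<in>{..<n}. X (t (Suc i)) \<omega> - X (t i) \<omega>)"
        using N(1) by (intro AE_I'[of N]) (auto simp: Y_def)
    qed (use Xm Ym pos in \<open>auto intro!: measurable_restrict borel_measurable_diff\<close>)
    ultimately show "indep_vars (\<lambda>_. borel) (\<lambda>i \<omega>. Y (t (Suc i)) \<omega> - Y (t i) \<omega>) {..<n}"
    \<comment> \<open>Independence is transferred as equality of the joint law with the product of
      the marginals. That criterion concerns a nonempty family; the empty one is settled from the
      definition.\<close>
    proof (cases "n = 0")
      case True
      then show ?thesis by (simp add: indep_vars_def indep_sets_def)
    next
      case False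
      assume ind: "indep_vars (\<lambda>_. borel) (\<lambda>i \<omega>. X (t (Suc i)) \<omega> - X (t i) \<omega>) {..<n}"
        and m: "\<And>i. i < n \<Longrightarrow> distr M borel (\<lambda>\<omega>. Y (t (Suc i)) \<omega> - Y (t i) \<omega>) = distr M borel (\<lambda>\<omega>. X (t (Suc i)) \<omega> - X (t i) \<omega>)"
        and j: "distr M (PiM {..<n} (\<lambda>_. borel)) (\<lambda>\<omega>. \<lambda>i\<in>{..<n}. Y (t (Suc i)) \<omega> - Y (t i) \<omega>)
      = distr M (PiM {..<n} (\<lambda>_. borel)) (\<lambda>\<omega>. \<lambda>i\<in>{..<n}. X (t (Suc i)) \<omega> - X (t i) \<omega>)"
      have "(\<lambda>\<omega>. X (t (Suc i)) \<omega> - X (t i) \<omega>) \<in> borel_measurable M"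
        "(\<lambda>\<omega>. Y (t (Suc i)) \<omega> - Y (t i) \<omega>) \<in> borel_measurable M" if "i < n" for i
        using that by (auto intro!: borel_measurable_diff Xm Ym pos)
      then have "distr M (PiM {..<n} (\<lambda>_. borel)) (\<lambda>\<omega>. \<lambda>i\<in>{..<n}. X (t (Suc i)) \<omega> - X (t i) \<omega>)
        = PiM {..<n} (\<lambda>i. distr M borel (\<lambda>\<omega>. X (t (Suc i)) \<omega> - X (t i) \<omega>))"
        using ind False by (subst (asm) indep_vars_iff_distr_eq_PiM') auto
      also have "\<dots> = PiM {..<n} (\<lambda>i. distr M borel (\<lambda>\<omega>. Y (t (Suc i)) \<omega> - Y (t i) \<omega>))"
        by (intro PiM_cong refl) (simp add: m)
      finally have "distr M (PiM {..<n} (\<lambda>_. borel)) (\<lambda>\<omega>. \<lambda>i\<in>{..<n}. Y (t (Suc i)) \<omega> - Y (t i) \<omega>) = \<dots>"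
        by (simp only: j)
      then show ?thesis
        using False by (subst indep_vars_iff_distr_eq_PiM') (auto intro!: borel_measurable_diff Ym pos)
    qed
  next
    fix s t :: real assume st: "s \<ge> 0" "t \<ge> 0"
    have "distr M borel (\<lambda>\<omega>. Y (s + t) \<omega> - Y s \<omega>) = distr M borel (\<lambda>\<omega>. X (s + t) \<omega> - X s \<omega>)"
      using st by (intro distr_cong_AE ae borel_measurable_diff Xm Ym refl) auto
    also have "\<dots> = distr M borel (X t)" using assms st by (simp add: levy_process_def)
    also have "\<dots> = distr M borel (Y t)"
      using st by (intro distr_cong_AE[symmetric] ae Xm Ym refl) auto
    finally show "distr M borel (\<lambda>\<omega>. Y (s + t) \<omega> - Y s \<omega>) = distr M borel (Y t)" .
  qed
  then show ?thesis using that N(1) eq by blast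
qed

text \<open>Rounding strictly upwards (hence the \<open>Suc\<close>) keeps the approximation to the
  right of \<open>s\<close>, where a right-continuous path converges. It takes countably many
  values, which is what joint measurability is drawn from.\<close>

lemma grid_approx_right:
  fixes s :: real
  assumes "s \<ge> 0"
  shows "(\<lambda>n. real (Suc (nat \<lfloor>s * Suc n\<rfloor>)) / real (Suc n)) \<longlonglongrightarrow> s"
    "s < real (Suc (nat \<lfloor>s * Suc n\<rfloor>)) / real (Suc n)"
    "real (Suc (nat \<lfloor>s * Suc n\<rfloor>)) / real (Suc n) \<le> s + 1 / Suc n"
proof -
  have nat: "real (nat \<lfloor>s * Suc n\<rfloor>) = of_int \<lfloor>s * Suc n\<rfloor>" for n
    using assms by (simp)
  show a: "s < real (Suc (nat \<lfloor>s * Suc n\<rfloor>)) / real (Suc n)" for n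
    using nat[of n] floor_correct[of "s * Suc n"] by (simp add: pos_less_divide_eq del: of_nat_Suc) linarith
  show b: "real (Suc (nat \<lfloor>s * Suc n\<rfloor>)) / real (Suc n) \<le> s + 1 / Suc n" for n
    using nat[of n] floor_correct[of "s * Suc n"]
    by (simp add: add_divide_distrib pos_divide_le_eq del: of_nat_Suc add: of_nat_Suc[where m="nat _"])
  show "(\<lambda>n. real (Suc (nat \<lfloor>s * Suc n\<rfloor>)) / real (Suc n)) \<longlonglongrightarrow> s"
  proof (rule tendsto_sandwich)
    show "(\<lambda>n. s) \<longlonglongrightarrow> s" by simp
    show "(\<lambda>n. s + 1 / Suc n) \<longlonglongrightarrow> s"
      using tendsto_add[OF tendsto_const[of s] lim_1_over_n[THEN LIMSEQ_Suc]] by simp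
  qed (use a b in \<open>auto intro!: always_eventually less_imp_le\<close>)
qed

section \<open>Joint measurability and the Markov property at deterministic times\<close>

context cadlag_levy
begin

lemma X_right_continuous: "t \<ge> 0 \<Longrightarrow> ((\<lambda>s. X s \<omega>) \<longlongrightarrow> X t \<omega>) (at_right t)"
  using X_cadlag[of \<omega>] unfolding cadlag_def continuous_within by blast

lemma X_seq_right:
  assumes "t \<ge> 0" "\<And>n. r n \<ge> t" "r \<longlonglongrightarrow> t"
  shows "(\<lambda>n. X (r n) \<omega>) \<longlonglongrightarrow> X t \<omega>"
proof -
  have "((\<lambda>s. X s \<omega>) \<longlongrightarrow> X t \<omega>) (at t within {t..})"
    using X_right_continuous[OF assms(1)] by (simp add: at_within_Ici_at_right)
  then have "continuous (at t within {t..}) (\<lambda>s. X s \<omega>)"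
    by (simp add: continuous_within)
  then show ?thesis
    using assms(2,3) unfolding continuous_within_sequentially comp_def by blast
qed

text \<open>At negative times nothing is known about \<open>X\<close>, hence the truncation \<open>max s 0\<close>.\<close>

lemma X_jointly_measurable:
  "(\<lambda>(s, \<omega>). X (max s 0) \<omega>) \<in> borel_measurable (borel \<Otimes>\<^sub>M M)"
proof (rule borel_measurable_LIMSEQ_real)
  fix n :: nat
  have g: "(\<lambda>z. nat \<lfloor>max (fst z) 0 * real (Suc n)\<rfloor>) \<in> borel \<Otimes>\<^sub>M M \<rightarrow>\<^sub>M count_space UNIV"
    by measurable
  have f: "(\<lambda>z. X (real (Suc k) / real (Suc n)) (snd z)) \<in> borel_measurable (borel \<Otimes>\<^sub>M M)" for k
      by (rule measurable_compose[OF measurable_snd X_measurable]) simp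
  show "(\<lambda>(s, \<omega>). X (real (Suc (nat \<lfloor>max s 0 * real (Suc n)\<rfloor>)) / real (Suc n)) \<omega>) \<in> borel_measurable (borel \<Otimes>\<^sub>M M)"
    using measurable_compose_countable[OF f g]
    by (simp only: split_beta')
next
  fix z :: "real \<times> 'a"
  show "(\<lambda>n. case z of (s, \<omega>) \<Rightarrow> X (real (Suc (nat \<lfloor>max s 0 * real (Suc n)\<rfloor>)) / real (Suc n)) \<omega>)
      \<longlonglongrightarrow> (case z of (s, \<omega>) \<Rightarrow> X (max s 0) \<omega>)"
    unfolding split_beta'
    by (rule X_seq_right[OF _ less_imp_le[OF grid_approx_right(2)] grid_approx_right(1)]) auto
qed

lemma measurable_X_compose:
  assumes f: "f \<in> borel_measurable N" and g: "g \<in> N \<rightarrow>\<^sub>M M" and nn: "\<And>z. z \<in> space N \<Longrightarrow> f z \<ge> 0"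
  shows "(\<lambda>z. X (f z) (g z)) \<in> borel_measurable N"
proof -
  have "(\<lambda>z. X (max (f z) 0) (g z)) \<in> borel_measurable N"
    using measurable_compose[OF measurable_Pair[OF f g] X_jointly_measurable] by simp
  then show ?thesis
    by (rule measurable_cong[THEN iffD1, rotated]) (use nn in \<open>simp add: max_absorb1\<close>)
qed

text \<open>Only increments are known to be independent, but the past is a measurable function of
  them: once time 0 is put in front of the grid, the values \<open>X (t i)\<close> are partial sums
  of increments, because \<open>X 0 = 0\<close>.\<close>

lemma indep_past_increment:
  fixes t :: "nat \<Rightarrow> real"
  assumes t: "0 \<le> t 0" "\<And>i. i < n \<Longrightarrow> t i \<le> t (Suc i)" "t n \<le> r"
  shows "indep_var (PiM {..n} (\<lambda>_. borel)) (\<lambda>\<omega>. \<lambda>i\<in>{..n}. X (t i) \<omega>)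
     (PiM {n} (\<lambda>_. borel)) (\<lambda>\<omega>. \<lambda>i\<in>{n}. X r \<omega> - X (t n) \<omega>)"
proof -
  \<comment> \<open>The sequence \<open>0, t 0, ..., t n, r\<close>. Its increment with index
    \<open>Suc n\<close> is the one to be separated from the past.\<close>
  define T where "T i = (case i of 0 \<Rightarrow> 0 | Suc j \<Rightarrow> if j \<le> n then t j else r)" for i
  have "indep_vars (\<lambda>_. borel) (\<lambda>i \<omega>. X (T (Suc i)) \<omega> - X (T i) \<omega>) {..<n+2}"
  proof (rule X_indep)
    show "0 \<le> T 0" by (simp add: T_def)
    show "\<forall>i<n + 2. T i \<le> T (Suc i)"
    proof (intro allI impI)
      fix i assume "i < n + 2"
      then show "T i \<le> T (Suc i)"
        using t by (cases "i = Suc n") (auto simp: T_def less_Suc_eq split: nat.splits)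
    qed
  qed
  then have "indep_var (PiM {..<Suc n} (\<lambda>_. borel)) (\<lambda>\<omega>. \<lambda>i\<in>{..<Suc n}. X (T (Suc i)) \<omega> - X (T i) \<omega>)
     (PiM {Suc n} (\<lambda>_. borel)) (\<lambda>\<omega>. \<lambda>i\<in>{Suc n}. X (T (Suc i)) \<omega> - X (T i) \<omega>)"
    by (rule indep_var_restrict) auto
  then have "indep_var (PiM {..n} (\<lambda>_. borel)) ((\<lambda>v. \<lambda>i\<in>{..n}. \<Sum>j\<le>i. v j) \<circ> (\<lambda>\<omega>. \<lambda>i\<in>{..<Suc n}. X (T (Suc i)) \<omega> - X (T i) \<omega>))
     (PiM {n} (\<lambda>_. borel)) ((\<lambda>v. \<lambda>i\<in>{n}. v (Suc n)) \<circ> (\<lambda>\<omega>. \<lambda>i\<in>{Suc n}. X (T (Suc i)) \<omega> - X (T i) \<omega>))"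
  proof (rule indep_var_compose)
    show "(\<lambda>v. \<lambda>i\<in>{..n}. \<Sum>j\<le>i. v j) \<in> PiM {..<Suc n} (\<lambda>_. borel) \<rightarrow>\<^sub>M PiM {..n} (\<lambda>_. borel :: real measure)"
      by (intro measurable_restrict borel_measurable_sum measurable_component_singleton) auto
    show "(\<lambda>v. \<lambda>i\<in>{n}. v (Suc n)) \<in> PiM {Suc n} (\<lambda>_. borel) \<rightarrow>\<^sub>M PiM {n} (\<lambda>_. borel :: real measure)"
      by (intro measurable_restrict measurable_component_singleton) auto
  qed
  moreover have "(\<Sum>j\<le>i. X (T (Suc j)) \<omega> - X (T j) \<omega>) = X (t i) \<omega>" if "i \<le> n" for i \<omega>
  proof -
    have "(\<Sum>j\<le>i. X (T (Suc j)) \<omega> - X (T j) \<omega>) = X (T (Suc i)) \<omega> - X (T 0) \<omega>"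
      using sum_lessThan_telescope[of "\<lambda>j. X (T j) \<omega>" "Suc i"] by (simp add: lessThan_Suc_atMost)
    then show ?thesis using that by (simp add: T_def X_zero)
  qed
  ultimately show ?thesis
    by (simp add: comp_def T_def cong: restrict_cong)
qed

text \<open>Simple Markov property at the fixed time \<open>t n\<close>. The whole grid past stays
  an argument of \<open>\<Phi>\<close>, so that events like a first grid visit at \<open>t n\<close>
  can be carried along.\<close>

lemma markov_nn_integral:
  fixes t :: "nat \<Rightarrow> real"
  assumes t: "0 \<le> t 0" "\<And>i. i < n \<Longrightarrow> t i \<le> t (Suc i)" and s: "0 \<le> s"
  and \<Phi>: "(\<lambda>(v, z). \<Phi> v z) \<in> borel_measurable (PiM {..n} (\<lambda>_. borel) \<Otimes>\<^sub>M (borel :: real measure))"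
  shows "(\<integral>\<^sup>+\<omega>. \<Phi> (\<lambda>i\<in>{..n}. X (t i) \<omega>) (X (t n + s) \<omega> - X (t n) \<omega>) \<partial>M)
    = (\<integral>\<^sup>+\<omega>. (\<integral>\<^sup>+\<omega>'. \<Phi> (\<lambda>i\<in>{..n}. X (t i) \<omega>) (X s \<omega>') \<partial>M) \<partial>M)"
proof -
  have pos: "0 \<le> t i" if "i \<le> n" for i
    using that by (rule grid_nonneg[of _ n t]) (use t in auto)
  let ?P = "\<lambda>\<omega>. \<lambda>i\<in>{..n}. X (t i) \<omega>" and ?Z = "\<lambda>\<omega>. X (t n + s) \<omega> - X (t n) \<omega>"
  let ?S = "PiM {..n} (\<lambda>_. borel :: real measure)"
  have P[measurable]: "?P \<in> M \<rightarrow>\<^sub>M ?S"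
    using pos by (intro measurable_restrict X_measurable) auto
  have Z[measurable]: "?Z \<in> borel_measurable M"
    using pos s by (intro borel_measurable_diff X_measurable) auto
  have Xs[measurable]: "X s \<in> borel_measurable M" using s by (rule X_measurable)
  note \<Phi>[measurable]
  let ?T = "PiM {n} (\<lambda>_. borel :: real measure)" and ?Z' = "\<lambda>\<omega>. \<lambda>i\<in>{n}. X (t n + s) \<omega> - X (t n) \<omega>"
  have Z'[measurable]: "?Z' \<in> M \<rightarrow>\<^sub>M ?T" by measurable
  have c[measurable]: "(\<lambda>w. w n) \<in> ?T \<rightarrow>\<^sub>M borel" by (rule measurable_component_singleton) auto
  interpret P: prob_space "distr M ?S ?P" by (rule prob_space_distr) measurable
  interpret Z: prob_space "distr M ?T ?Z'" by (rule prob_space_distr) measurable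
  have eq: "distr M ?S ?P \<Otimes>\<^sub>M distr M ?T ?Z' = distr M (?S \<Otimes>\<^sub>M ?T) (\<lambda>x. (?P x, ?Z' x))"
    using indep_past_increment[OF t, of n "t n + s"] s by (simp add: indep_var_distribution_eq)
  have "(\<integral>\<^sup>+\<omega>. \<Phi> (?P \<omega>) (?Z \<omega>) \<partial>M) = (\<integral>\<^sup>+x. \<Phi> (fst x) (snd x n) \<partial>distr M (?S \<Otimes>\<^sub>M ?T) (\<lambda>x. (?P x, ?Z' x)))"
    by (subst nn_integral_distr) auto
  also have "\<dots> = (\<integral>\<^sup>+v. \<integral>\<^sup>+w. \<Phi> v (w n) \<partial>distr M ?T ?Z' \<partial>distr M ?S ?P)"
    unfolding eq[symmetric] by (subst Z.nn_integral_fst[symmetric]) auto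
  also have "\<dots> = (\<integral>\<^sup>+v. \<integral>\<^sup>+z. \<Phi> v z \<partial>distr M borel ?Z \<partial>distr M ?S ?P)"
    by (intro nn_integral_cong) (simp add: nn_integral_distr)
  also have "\<dots> = (\<integral>\<^sup>+v. \<integral>\<^sup>+z. \<Phi> v z \<partial>distr M borel (X s) \<partial>distr M ?S ?P)"
    using X_stationary[of "t n" s] pos s by simp
  also have "\<dots> = (\<integral>\<^sup>+v. \<integral>\<^sup>+\<omega>'. \<Phi> v (X s \<omega>') \<partial>M \<partial>distr M ?S ?P)"
    by (intro nn_integral_cong) (simp add: nn_integral_distr)
  also have "\<dots> = (\<integral>\<^sup>+\<omega>. (\<integral>\<^sup>+\<omega>'. \<Phi> (?P \<omega>) (X s \<omega>') \<partial>M) \<partial>M)"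
    by (subst nn_integral_distr) auto
  finally show ?thesis .
qed

end

section \<open>The symbol near the origin and characteristic functions at infinity\<close>

text \<open>The Taylor remainder after the quadratic term is at most
  \<open>\<bar>x\<bar>^3 / 6\<close>, hence at most \<open>x^2 / 6\<close>, and
  \<open>1/2 - 1/6 = 1/3\<close>.\<close>

lemma one_minus_cos_lower:
  fixes x :: real
  assumes "\<bar>x\<bar> \<le> 1"
  shows "x\<^sup>2 / 3 \<le> 1 - cos x"
proof -
  have "\<bar>Re (iexp x - (\<Sum>k\<le>2. (\<i> * x) ^ k / fact k))\<bar> \<le> \<bar>x\<bar> ^ 3 / fact 3"
    using order_trans[OF abs_Re_le_cmod iexp_approx1[of x 2]] by (simp add: eval_nat_numeral)
  then have "\<bar>cos x - (1 - x\<^sup>2 / 2)\<bar> \<le> \<bar>x\<bar> ^ 3 / 6"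
    by (simp add: eval_nat_numeral Re_exp fact_numeral power2_eq_square)
  moreover have "\<bar>x\<bar> ^ 3 \<le> x\<^sup>2"
    using power_decreasing[of 2 3 "\<bar>x\<bar>"] assms by simp
  ultimately show ?thesis by linarith
qed

text \<open>The symbol of a pure drift is \<open>\<i> * b * u\<close>, the degenerate case that (A)
  excludes. Its resolvent decays no faster than \<open>1 / u\<close>, so the integral up to
  \<open>n\<close> grows like \<open>ln n\<close>.\<close>

lemma not_integrable_drift_resolvent:
  fixes b :: real
  shows "\<not> integrable lborel (\<lambda>u :: real. 1 / (1 - \<i> * b * u))"
proof
  assume int: "integrable lborel (\<lambda>u :: real. 1 / (1 - \<i> * b * u))"
  define f where "f u = cmod (1 / (1 - \<i> * b * u))" for u :: real
  have f: "integrable lborel f" using integrable_norm[OF int] by (simp add: f_def[abs_def])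
  have le: "ln n \<le> (1 + \<bar>b\<bar>) * integral\<^sup>L lborel f" if "n \<ge> 1" for n :: real
  proof -
    have I: "has_bochner_integral lborel (\<lambda>x. (1 / x) * indicator {1..n} x) (ln n - ln 1)"
      using that by (intro has_bochner_integral_FTC_Icc_real) (auto intro!: derivative_eq_intros continuous_intros)
    have "ln n = integral\<^sup>L lborel (\<lambda>x. (1 / x) * indicator {1..n} x)"
      using has_bochner_integral_integral_eq[OF I] by simp
    also have "\<dots> \<le> integral\<^sup>L lborel (\<lambda>x. (1 + \<bar>b\<bar>) * f x)"
    proof (intro integral_mono)
      fix x :: real
      show "1 / x * indicator {1..n} x \<le> (1 + \<bar>b\<bar>) * f x"
      proof (cases "x \<in> {1..n}")
        case True
        have "cmod (1 - \<i> * b * x) \<le> 1 + \<bar>b\<bar> * x"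
          using norm_triangle_ineq4[of 1 "\<i> * b * x"] True by (simp add: norm_mult)
        also have "\<dots> \<le> (1 + \<bar>b\<bar>) * x" using True by (simp add: algebra_simps)
        finally have *: "cmod (1 - \<i> * b * x) \<le> (1 + \<bar>b\<bar>) * x" .
        have "(1 - \<i> * b * x) \<noteq> 0" by (simp add: complex_eq_iff)
        then have "0 < cmod (1 - \<i> * b * x)" by simp
        then show ?thesis using * True by (simp add: f_def norm_divide field_simps)
      qed (simp add: f_def)
    qed (use I f in \<open>auto simp: has_bochner_integral_iff\<close>)
    finally show ?thesis by simp
  qed
  define L where "L = (1 + \<bar>b\<bar>) * integral\<^sup>L lborel f"
  have "0 \<le> L" unfolding L_def by (intro mult_nonneg_nonneg Bochner_Integration.integral_nonneg) (auto simp: f_def)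
  \<comment> \<open>At \<open>n = exp (L + 1)\<close> the logarithm exceeds the alleged bound
    \<open>L\<close>; \<open>L\<close> being nonnegative gives \<open>n >= 1\<close>.\<close>
  then have "L + 1 \<le> L" using le[of "exp (L + 1)"] by (simp add: L_def)
  then show False by simp
qed

text \<open>Small jumps are controlled by the Taylor bound \<open>(u * y)^2 / 2\<close>, large ones
  trivially by 2; the factor \<open>u^2 + 2\<close> covers both.\<close>

lemma levy_khintchine_integrand:
  assumes \<nu>: "levy_measure \<nu>"
  shows "integrable \<nu> (\<lambda>y. iexp (u * y) - 1 - \<i> * u * y * of_bool (\<bar>y\<bar> \<le> 1))" (is "integrable _ ?F")
proof (rule Bochner_Integration.integrable_bound)
  have s[measurable_cong]: "sets \<nu> = sets borel" using \<nu> by (simp add: levy_measure_def)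
  show "integrable \<nu> (\<lambda>y. (u\<^sup>2 + 2) * min (\<bar>y\<bar>\<^sup>2) 1)" using \<nu> by (simp add: levy_measure_def)
  show "?F \<in> borel_measurable \<nu>" by measurable
  have "norm (?F y) \<le> (u\<^sup>2 + 2) * min (\<bar>y\<bar>\<^sup>2) 1" for y
  proof (cases "\<bar>y\<bar> \<le> 1")
    case True
    have "norm (?F y) \<le> \<bar>u * y\<bar>\<^sup>2 / 2"
      using iexp_approx1[of "u * y" 1] True by (simp add: eval_nat_numeral algebra_simps)
    also have "\<dots> \<le> (u\<^sup>2 + 2) * y\<^sup>2"
      by (simp add: abs_mult power_mult_distrib algebra_simps)
    also have "\<dots> = (u\<^sup>2 + 2) * min (\<bar>y\<bar>\<^sup>2) 1"
      using True by (simp add: min_absorb1 abs_square_le_1)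
    finally show ?thesis .
  next
    case False
    then have "norm (?F y) \<le> 2"
      using norm_triangle_ineq4[of "iexp (u * y)" 1] by simp
    also have "\<dots> \<le> (u\<^sup>2 + 2) * 1" by simp
    also have "\<dots> = (u\<^sup>2 + 2) * min (\<bar>y\<bar>\<^sup>2) 1"
      using False one_le_power[of "\<bar>y\<bar>" 2] by (simp add: min_absorb2)
    finally show ?thesis .
  qed
  then show "AE y in \<nu>. norm (?F y) \<le> norm ((u\<^sup>2 + 2) * min (\<bar>y\<bar>\<^sup>2) 1)"
    by (intro AE_I2) (auto intro: order_trans)
qed

lemma levy_khintchine_0: "levy_khintchine b a \<nu> 0 = 0"
  by (simp add: levy_khintchine_def)

lemma levy_khintchine_minus: "levy_khintchine b a \<nu> (- u) = cnj (levy_khintchine b a \<nu> u)"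
proof -
  have "(CLINT y|\<nu>. iexp (- u * y) - 1 - \<i> * (- u) * y * of_bool (\<bar>y\<bar> \<le> 1))
    = (CLINT y|\<nu>. cnj (iexp (u * y) - 1 - \<i> * u * y * of_bool (\<bar>y\<bar> \<le> 1)))"
    by (intro Bochner_Integration.integral_cong refl) (simp add: exp_cnj of_bool_def)
  also have "\<dots> = cnj (CLINT y|\<nu>. iexp (u * y) - 1 - \<i> * u * y * of_bool (\<bar>y\<bar> \<le> 1))"
    by (rule Bochner_Integration.integral_cnj)
  finally have "(CLINT y|\<nu>. iexp (- u * y) - 1 - \<i> * (- u) * y * of_bool (\<bar>y\<bar> \<le> 1)) = \<dots>" .
  then show ?thesis
    unfolding levy_khintchine_def complex_cnj_add by simp
qed

lemma Re_levy_khintchine: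
  assumes "levy_measure \<nu>"
  shows "integrable \<nu> (\<lambda>y. 1 - cos (u * y))"
    "- Re (levy_khintchine b a \<nu> u) = a / 2 * u\<^sup>2 + (LINT y|\<nu>. 1 - cos (u * y))"
proof -
  note int = levy_khintchine_integrand[OF assms, of u]
  have *: "- Re (iexp (u * y) - 1 - \<i> * u * y * of_bool (\<bar>y\<bar> \<le> 1)) = 1 - cos (u * y)" for y
    by (simp add: Re_exp of_bool_def)
  show "integrable \<nu> (\<lambda>y. 1 - cos (u * y))"
    using integrable_minus[OF integrable_Re[OF int]] unfolding * .
  have "Re (CLINT y|\<nu>. iexp (u * y) - 1 - \<i> * u * y * of_bool (\<bar>y\<bar> \<le> 1))
      = (LINT y|\<nu>. Re (iexp (u * y) - 1 - \<i> * u * y * of_bool (\<bar>y\<bar> \<le> 1)))"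
    using integral_Re[OF int] by simp
  also have "\<dots> = - (LINT y|\<nu>. 1 - cos (u * y))"
    by (subst Bochner_Integration.integral_minus[symmetric], intro Bochner_Integration.integral_cong refl)
       (simp only: *[symmetric] minus_minus)
  finally show "- Re (levy_khintchine b a \<nu> u) = a / 2 * u\<^sup>2 + (LINT y|\<nu>. 1 - cos (u * y))"
    unfolding levy_khintchine_def
    by (simp add: power2_eq_square)
qed

text \<open>This is what makes \<open>u^2 / cmod (\<eta> u)\<close> bounded near the origin. A
  Gaussian part gives the bound at once; otherwise jumps of bounded size give it through
  \<open>one_minus_cos_lower\<close>. If both are absent the symbol is that of a drift, against the
  integrability assumption.\<close>

lemma levy_khintchine_quadratic_lower_bound:
  assumes \<nu>: "levy_measure \<nu>" and a: "a \<ge> 0"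
    and int: "integrable lborel (\<lambda>u. 1 / (1 - levy_khintchine b a \<nu> u))"
  shows "\<exists>c>0. \<exists>r>0. \<forall>u. \<bar>u\<bar> \<le> r \<longrightarrow> c * u\<^sup>2 \<le> - Re (levy_khintchine b a \<nu> u)"
proof -
  have s[measurable_cong]: "sets \<nu> = sets borel" using \<nu> by (simp add: levy_measure_def)
  have nn: "0 \<le> (LINT y|\<nu>. 1 - cos (u * y))" for u by (rule Bochner_Integration.integral_nonneg) simp
  \<comment> \<open>The cutoff \<open>K\<close> is left open because all jumps may be larger than 1.
    For \<open>\<bar>u\<bar> <= 1 / (K + 1)\<close> every jump that is kept satisfies
    \<open>\<bar>u * y\<bar> <= 1\<close>.\<close>
  let ?z = "\<lambda>K y. y\<^sup>2 * indicator {- real K..real K} y"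
  have zint: "integrable \<nu> (?z K)" for K
  proof (rule Bochner_Integration.integrable_bound)
    show "integrable \<nu> (\<lambda>y. ((real K)\<^sup>2 + 1) * min (\<bar>y\<bar>\<^sup>2) 1)" using \<nu> by (simp add: levy_measure_def)
    have "?z K y \<le> ((real K)\<^sup>2 + 1) * min (\<bar>y\<bar>\<^sup>2) 1" for y
    proof (cases "y\<^sup>2 \<le> 1")
      case True
      then show ?thesis by (simp add: min_absorb1 algebra_simps indicator_def)
    next
      case False
      have "y \<in> {- real K..real K} \<Longrightarrow> y\<^sup>2 \<le> (real K)\<^sup>2"
        by (intro power2_le_iff_abs_le[THEN iffD2]) auto
      then show ?thesis using False by (auto simp: min_absorb2 indicator_def)
    qed
    then show "AE y in \<nu>. norm (?z K y) \<le> norm (((real K)\<^sup>2 + 1) * min (\<bar>y\<bar>\<^sup>2) 1)"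
      by (intro AE_I2) (auto intro: order_trans)
  qed measurable
  consider "a > 0" | K where "integral\<^sup>L \<nu> (?z K) \<noteq> 0" | "a = 0" "\<And>K. integral\<^sup>L \<nu> (?z K) = 0"
    using a by (metis less_eq_real_def)
  then show ?thesis
  proof cases
    case 1
    then show ?thesis using nn Re_levy_khintchine(2)[OF \<nu>, of b a]
      by (intro exI[of _ "a/2"] conjI exI[of _ 1]) auto
  next
    case (2 K)
    have "0 \<le> integral\<^sup>L \<nu> (?z K)" by (rule Bochner_Integration.integral_nonneg) simp
    with 2 have pos: "0 < integral\<^sup>L \<nu> (?z K)" by linarith
    have "integral\<^sup>L \<nu> (?z K) / 3 * u\<^sup>2 \<le> - Re (levy_khintchine b a \<nu> u)" if u: "\<bar>u\<bar> \<le> 1 / (real K + 1)" for u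
    proof -
      have "integral\<^sup>L \<nu> (?z K) / 3 * u\<^sup>2 = (LINT y|\<nu>. u\<^sup>2 / 3 * ?z K y)"
        using zint[of K] by simp
      also have "\<dots> \<le> (LINT y|\<nu>. 1 - cos (u * y))"
      proof (intro integral_mono Re_levy_khintchine \<nu>)
        fix y
        show "u\<^sup>2 / 3 * ?z K y \<le> 1 - cos (u * y)"
        proof (cases "y \<in> {- real K..real K}")
          case True
          then have "\<bar>u\<bar> * \<bar>y\<bar> \<le> 1 / (real K + 1) * (real K + 1)"
            using u by (intro mult_mono) auto
          then have "\<bar>u * y\<bar> \<le> 1" by (simp add: abs_mult)
          from one_minus_cos_lower[OF this] True show ?thesis by (simp add: power_mult_distrib)
        qed simp
      qed (use zint[of K] in simp)
      also have "\<dots> \<le> - Re (levy_khintchine b a \<nu> u)"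
        using a Re_levy_khintchine(2)[OF \<nu>, of b a u] by simp
      finally show ?thesis .
    qed
    then show ?thesis using pos
      by (intro exI[of _ "integral\<^sup>L \<nu> (?z K) / 3"] conjI exI[of _ "1 / (real K + 1)"]) auto
  next
    case 3
    have "AE y in \<nu>. ?z K y = 0" for K
      using 3(2)[of K] zint[of K] by (subst (asm) integral_nonneg_eq_0_iff_AE) auto
    then have "AE y in \<nu>. \<forall>K. ?z K y = 0" by (simp only: AE_all_countable) blast
    moreover have "AE y in \<nu>. y \<noteq> 0"
      using \<nu> by (intro AE_I[of _ _ "{0}"]) (auto simp: levy_measure_def)
    ultimately have "AE y in \<nu>. False"
    proof eventually_elim
      case (elim y)
      obtain K :: nat where "\<bar>y\<bar> \<le> real K" using real_arch_simple by blast
      then show ?case using elim by (auto dest: spec[of _ K] simp: indicator_def)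
    qed
    then have "(CLINT y|\<nu>. iexp (u * y) - 1 - \<i> * u * y * of_bool (\<bar>y\<bar> \<le> 1)) = 0" for u
      by (intro integral_eq_zero_AE) auto
    then have "levy_khintchine b a \<nu> u = \<i> * b * u" for u
      using 3(1) by (simp add: levy_khintchine_def)
    then show ?thesis using int not_integrable_drift_resolvent[of b] by simp
  qed
qed

text \<open>Cauchy-Schwarz, in the form that a variance is nonnegative, for the modulus of
  \<open>iexp (v * x) - 1\<close>, whose square is \<open>2 * (1 - cos (v * x))\<close>. As the
  bound is free of \<open>u\<close>, it yields uniform continuity, and exact periodicity as soon as
  \<open>char M v = 1\<close>.\<close>

lemma (in real_distribution) char_increment_bound:
  "(cmod (char M (u + v) - char M u))\<^sup>2 \<le> 2 * (1 - Re (char M v))"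
proof -
  have int: "integrable M (\<lambda>x. iexp (u * x))" for u by (rule integrable_iexp) auto
  have cos_abs_bound: "- (2 * cos y) \<le> 2" for y :: real using cos_ge_minus_one[of y] by linarith
  have int2: "integrable M (\<lambda>x. 2 * (1 - cos (v * x)))"
    by (rule integrable_const_bound[where B=4]) (auto intro!: AE_I2 cos_abs_bound simp: abs_le_iff)
  let ?Z = "\<lambda>x. cmod (iexp (v * x) - 1)"
  have Z2: "(?Z x)\<^sup>2 = 2 * (1 - cos (v * x))" for x
  proof -
    have "(?Z x)\<^sup>2 = (cos (v * x) - 1)\<^sup>2 + (sin (v * x))\<^sup>2"
      by (simp add: cmod_power2 Re_exp Im_exp)
    then show ?thesis using sin_cos_squared_add[of "v * x"] by (simp add: power2_eq_square algebra_simps)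
  qed
  have Zint: "integrable M ?Z"
    using int[of v] by (intro integrable_norm Bochner_Integration.integrable_diff) auto
  have "cmod (char M (u + v) - char M u) = cmod (CLINT x|M. iexp (u * x) * (iexp (v * x) - 1))"
    unfolding char_def
    by (subst Bochner_Integration.integral_diff[symmetric, OF int int])
       (simp add: algebra_simps exp_add)
  also have "\<dots> \<le> (LINT x|M. ?Z x)"
    by (rule order_trans[OF integral_norm_bound]) (simp add: norm_mult)
  finally have "(cmod (char M (u + v) - char M u))\<^sup>2 \<le> (LINT x|M. ?Z x)\<^sup>2"
    by (intro power_mono) auto
  also have "\<dots> \<le> (LINT x|M. (?Z x)\<^sup>2)"
    using variance_eq[OF Zint int2[folded Z2]] variance_positive[of ?Z] by linarith
  also have "\<dots> = 2 * (1 - (LINT x|M. cos (v * x)))"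
  proof -
    have "integrable M (\<lambda>x. cos (v * x))" by (rule integrable_const_bound[where B=1]) auto
    then show ?thesis unfolding Z2 using prob_space by simp
  qed
  also have "(LINT x|M. cos (v * x)) = Re (char M v)"
    unfolding char_def using integral_Re[OF int[of v]] by (simp add: Re_exp)
  finally show ?thesis .
qed

text \<open>An integrable, uniformly continuous function vanishes at infinity: a modulus of at least
  \<open>e\<close> at \<open>u\<close> would stay at least \<open>e / 2\<close> on
  \<open>[u, u + \<delta>]\<close>, against the smallness of the tail integral.\<close>

lemma (in real_distribution) char_integrable_tendsto_0:
  assumes int: "integrable lborel (char M)"
  shows "(char M \<longlongrightarrow> 0) at_top"
proof (rule tendstoI)
  fix e :: real assume e: "e > 0"
  have cont: "isCont (\<lambda>v. 2 * (1 - Re (char M v))) 0"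
    using isCont_char[of 0] unfolding isCont_def by (intro tendsto_intros)
  then obtain d where d: "d > 0" "\<And>v. \<bar>v\<bar> < d \<Longrightarrow> 2 * (1 - Re (char M v)) < (e/2)\<^sup>2"
  proof -
    from e have "(e/2)\<^sup>2 > 0" by simp
    with cont obtain d where d: "d > 0" "\<And>v. dist v 0 < d \<Longrightarrow> dist (2 * (1 - Re (char M v))) (2 * (1 - Re (char M 0))) < (e/2)\<^sup>2"
      unfolding continuous_at_eps_delta by blast
    show thesis
    proof (rule that[OF d(1)])
      fix v :: real assume "\<bar>v\<bar> < d"
      then have "dist (2 * (1 - Re (char M v))) (2 * (1 - Re (char M 0))) < (e/2)\<^sup>2"
        by (intro d(2)) simp
      then show "2 * (1 - Re (char M v)) < (e/2)\<^sup>2"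
        unfolding dist_real_def char_zero by simp
    qed
  qed
  \<comment> \<open>Half of \<open>d\<close>, so that the closed interval
    \<open>{u..u + \<delta>}\<close> lies strictly within the range where increments are
    controlled.\<close>
  define \<delta> where "\<delta> = d / 2"
  have \<delta>: "\<delta> > 0" "\<delta> < d" using d by (auto simp: \<delta>_def)
  have near: "cmod (char M u) \<le> cmod (char M (u + v)) + e / 2" if "\<bar>v\<bar> < d" for u v
  proof -
    have "(cmod (char M (u + v) - char M u))\<^sup>2 \<le> (e/2)\<^sup>2"
      using char_increment_bound[of u v] d(2)[OF that] by linarith
    then have "cmod (char M (u + v) - char M u) \<le> e / 2"
      using e by (simp add: power2_le_iff_abs_le)
    then show ?thesis using norm_triangle_ineq3[of "char M u" "char M (u + v)"]
      by (simp add: norm_minus_commute)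
  qed
  have nint: "integrable lborel (\<lambda>w. cmod (char M w))" using int by (rule integrable_norm)
  have "((\<lambda>u. LINT w|lborel. indicator {u..} w * cmod (char M w)) \<longlongrightarrow> (LINT w :: real|lborel. 0 :: real)) at_top"
  proof (rule integral_dominated_convergence_at_top[OF _ _ nint])
    show "AE w in lborel. ((\<lambda>u. indicator {u..} w * cmod (char M w)) \<longlongrightarrow> 0) at_top"
    proof (intro AE_I2 tendsto_eventually)
      fix w :: real
      show "\<forall>\<^sub>F u in at_top. indicator {u..} w * cmod (char M w) = 0"
        using eventually_gt_at_top[of w] by eventually_elim auto
    qed
  qed (auto simp: indicator_def)
  then have "\<forall>\<^sub>F u in at_top. (LINT w|lborel. indicator {u..} w * cmod (char M w)) < \<delta> * (e / 2)"
    using \<delta> e by (intro order_tendstoD) auto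
  then show "\<forall>\<^sub>F u in at_top. dist (char M u) 0 < e"
  proof eventually_elim
    case (elim u)
    have ind: "integrable lborel (indicator {u..u+\<delta>} :: real \<Rightarrow> real)"
      by (rule integrable_real_indicator) (auto simp: emeasure_lborel_Icc_eq)
    have "\<delta> * cmod (char M u) = (LINT w|lborel. indicator {u..u+\<delta>} w * cmod (char M u))"
      using \<delta> by simp
    also have "\<dots> \<le> (LINT w|lborel. indicator {u..} w * cmod (char M w) + indicator {u..u+\<delta>} w * (e/2))"
    proof (intro integral_mono Bochner_Integration.integrable_add)
      show "integrable lborel (\<lambda>w. indicator {u..} w * cmod (char M w))"
        by (rule Bochner_Integration.integrable_bound[OF nint]) (auto simp: indicator_def)
      fix w
      show "indicator {u..u + \<delta>} w * cmod (char M u) \<le> indicator {u..} w * cmod (char M w) + indicator {u..u+\<delta>} w * (e/2)"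
        using near[of "w - u" u] \<delta> by (auto simp: indicator_def)
    qed (use ind in auto)
    also have "\<dots> = (LINT w|lborel. indicator {u..} w * cmod (char M w)) + \<delta> * (e/2)"
    proof -
      have "integrable lborel (\<lambda>w. indicator {u..} w * cmod (char M w))"
        by (rule Bochner_Integration.integrable_bound[OF nint]) (auto simp: indicator_def)
      then show ?thesis using ind \<delta> by simp
    qed
    also have "\<dots> < \<delta> * e" using elim by (simp add: field_simps)
    finally show ?case using \<delta> by simp
  qed
qed

section \<open>Fourier inversion\<close>

text \<open>\<open>sinc_fun (e * t)\<close> is the characteristic function at \<open>t\<close> of
  the uniform law on \<open>(- e, e)\<close>; it appears because balls are measured instead of
  points.\<close>

definition sinc_fun :: "real \<Rightarrow> real" where
  "sinc_fun x = (if x = 0 then 1 else sin x / x)"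

lemma isCont_sinc_fun: "isCont sinc_fun x"
  using isCont_sinc[of x] unfolding sinc_fun_def[abs_def] .

lemma borel_measurable_sinc_fun [measurable]: "sinc_fun \<in> borel_measurable borel"
  using borel_measurable_sinc unfolding sinc_fun_def[abs_def] .

lemma abs_sinc_fun_le_1: "\<bar>sinc_fun x\<bar> \<le> 1"
  using abs_sin_x_le_abs_x[of x] by (simp add: sinc_fun_def divide_le_eq)

lemma sinc_fun_bound_mult:
  "\<bar>x\<bar> * \<bar>sinc_fun y\<bar> \<le> \<bar>x\<bar>" "\<bar>x\<bar> * \<bar>sinc_fun y - 1\<bar> \<le> 2 * \<bar>x\<bar>"
  using mult_left_mono[OF abs_sinc_fun_le_1[of y], of "\<bar>x\<bar>"]
    mult_left_mono[of "\<bar>sinc_fun y - 1\<bar>" 2 "\<bar>x\<bar>"] abs_sinc_fun_le_1[of y]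
  by (auto simp: abs_le_iff)

text \<open>The kernel of Levy's inversion formula for \<open>(x - e, x + e]\<close>, in a form
  whose singularity at \<open>t = 0\<close> is removed and whose modulus is at most
  \<open>2 * e\<close>.\<close>

lemma sinc_fun_kernel:
  assumes "t \<noteq> 0" "e > 0"
  shows "(iexp (-(t * (x - e))) - iexp (-(t * (x + e)))) / (\<i> * t) = 2 * e * sinc_fun (e * t) * iexp (-(t * x))"
proof -
  have 1: "iexp (-(t * (x - e))) = iexp (-(t * x)) * iexp (e * t)"
    "iexp (-(t * (x + e))) = iexp (-(t * x)) * iexp (-(e * t))"
    by (auto simp: exp_add[symmetric] algebra_simps)
  have "iexp (e * t) - iexp (-(e * t)) = 2 * \<i> * sin (e * t)"
    by (simp add: complex_eq_iff Re_exp Im_exp)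
  then have "iexp (-(t * (x - e))) - iexp (-(t * (x + e))) = iexp (-(t * x)) * (2 * \<i> * sin (e * t))"
    unfolding 1 right_diff_distrib[symmetric] by simp
  then show ?thesis using assms by (simp add: sinc_fun_def)
qed

text \<open>Levy's inversion formula is a limit of truncated integrals; integrability of the
  characteristic function lets dominated convergence remove the truncation. The condition on the
  endpoints comes from the inversion formula and is discharged by
  \<open>measure_singleton_char\<close>.\<close>

lemma (in real_distribution) measure_Ioc_char:
  assumes int: "integrable lborel (char M)" and e: "e > 0"
    and null: "measure M {x - e} = 0" "measure M {x + e} = 0"
  shows "complex_of_real (measure M {x - e<..x + e}) = e / pi * (CLINT t|lborel. sinc_fun (e * t) * iexp (-(t * x)) * char M t)"
proof -
  let ?G = "\<lambda>t. 2 * e * sinc_fun (e * t) * iexp (-(t * x)) * char M t"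
  let ?H = "\<lambda>t. (iexp (-(t * (x - e))) - iexp (-(t * (x + e)))) / (\<i> * t) * char M t"
  have Gint: "integrable lborel ?G"
  proof (rule Bochner_Integration.integrable_bound)
    show "integrable lborel (\<lambda>t. 2 * e * cmod (char M t))" using int by (intro integrable_mult_right) (auto)
    show "AE t in lborel. norm (?G t) \<le> norm (2 * e * cmod (char M t))"
      using abs_sinc_fun_le_1 e by (auto simp: norm_mult mult_left_le_one_le intro!: AE_I2)
  qed measurable
  have lim1: "(\<lambda>T. 1 / (2 * pi) * (CLBINT t=-T..T. ?H t)) \<longlonglongrightarrow> measure M {x - e<..x + e}"
    using e null by (intro Levy_Inversion) auto
  have "(\<lambda>T. CLINT t|lborel. indicator {-real T<..<real T} t *\<^sub>R ?G t) \<longlonglongrightarrow> (CLINT t|lborel. ?G t)"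
  proof (rule integral_dominated_convergence)
    show "integrable lborel (\<lambda>t. cmod (?G t))" using Gint by (rule integrable_norm)
    show "AE t in lborel. (\<lambda>T. indicator {-real T<..<real T} t *\<^sub>R ?G t) \<longlonglongrightarrow> ?G t"
    proof (intro AE_I2 tendsto_eventually)
      fix t :: real
      obtain N :: nat where N: "\<bar>t\<bar> < real N" using reals_Archimedean2 by blast
      show "\<forall>\<^sub>F T in sequentially. indicator {-real T<..<real T} t *\<^sub>R ?G t = ?G t"
        using eventually_ge_at_top[of N] by eventually_elim (use N in \<open>auto simp: indicator_def abs_less_iff\<close>)
    qed
  qed (auto simp: indicator_def)
  moreover have "(CLINT t|lborel. indicator {-real T<..<real T} t *\<^sub>R ?G t) = (CLBINT t=-T..T. ?H t)" for T :: nat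
  proof -
    have "(CLBINT t=-T..T. ?H t) = (CLINT t|lborel. indicator {-real T<..<real T} t *\<^sub>R ?H t)"
      by (simp add: interval_lebesgue_integral_def set_lebesgue_integral_def einterval_eq)
    also have "\<dots> = (CLINT t|lborel. indicator {-real T<..<real T} t *\<^sub>R ?G t)"
    proof (rule integral_cong_AE)
      show "AE t in lborel. indicator {-real T<..<real T} t *\<^sub>R ?H t = indicator {-real T<..<real T} t *\<^sub>R ?G t"
        using AE_lborel_singleton[of "0 :: real"]
      proof eventually_elim
        case (elim t)
        then show ?case by (simp only: sinc_fun_kernel[OF elim e])
      qed
    qed measurable
    finally show ?thesis by simp
  qed
  ultimately have "(\<lambda>T. 1 / (2 * pi) * (CLBINT t=-T..T. ?H t)) \<longlonglongrightarrow> 1 / (2 * pi) * (CLINT t|lborel. ?G t)"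
    by (intro tendsto_mult tendsto_const) simp
  from LIMSEQ_unique[OF lim1 this]
  have "complex_of_real (measure M {x - e<..x + e}) = 1 / (2 * pi) * (CLINT t|lborel. ?G t)" by simp
  also have "(CLINT t|lborel. ?G t) = 2 * e * (CLINT t|lborel. sinc_fun (e * t) * iexp (-(t * x)) * char M t)"
  proof -
    have "(CLINT t|lborel. ?G t) = (CLINT t|lborel. complex_of_real (2 * e) * (sinc_fun (e * t) * iexp (-(t * x)) * char M t))"
      by (intro Bochner_Integration.integral_cong refl) simp
    then show ?thesis by (simp only: integral_mult_right_zero)
  qed
  finally show ?thesis by (simp add: field_simps)
qed

text \<open>There are countably many atoms, so arbitrarily small radii \<open>e\<close> have
  atom-free endpoints \<open>x - e\<close> and \<open>x + e\<close>. For these the inversion formula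
  bounds the mass of the interval, and thus of \<open>{x}\<close>, by a constant times
  \<open>e\<close>.\<close>

lemma (in real_distribution) measure_singleton_char:
  assumes int: "integrable lborel (char M)"
  shows "measure M {x} = 0"
proof -
  define C where "C = (LINT t|lborel. cmod (char M t)) / pi"
  have le: "measure M {x} \<le> C * d" if d: "d > 0" for d
  proof -
    let ?A = "{y. measure M {y} \<noteq> 0}"
    have A: "countable ?A" by (rule countable_support)
    \<comment> \<open>The radii for which one of the two endpoints would be an atom.\<close>
    define B where "B = (\<lambda>y. x - y) ` ?A \<union> (\<lambda>y. y - x) ` ?A"
    have "countable B" using A by (auto simp: B_def)
    then obtain e where e: "e \<in> {0<..<d}" "e \<notin> B"
      using real_interval_avoid_countable_set[OF d] by blast
    have nA: "measure M {x - e} = 0" "measure M {x + e} = 0"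
      using e(2) by (force simp: B_def)+
    have "measure M {x} \<le> measure M {x - e<..x + e}"
      using e by (intro finite_measure_mono) auto
    also have "\<dots> = cmod (complex_of_real (measure M {x - e<..x + e}))" by simp
    also have "\<dots> = e / pi * cmod (CLINT t|lborel. sinc_fun (e * t) * iexp (-(t * x)) * char M t)"
      using e by (subst measure_Ioc_char[OF int _ nA]) (auto simp: norm_mult norm_divide)
    also have "\<dots> \<le> e / pi * (LINT t|lborel. cmod (char M t))"
    proof (rule mult_left_mono)
      let ?g = "\<lambda>t. complex_of_real (sinc_fun (e * t)) * iexp (-(t * x)) * char M t"
      have le: "cmod (?g t) \<le> cmod (char M t)" for t
        by (auto simp: norm_mult abs_sinc_fun_le_1 mult_left_le_one_le)
      have "integrable lborel ?g"
        by (rule Bochner_Integration.integrable_bound[OF int]) (auto simp only: le intro!: AE_I2, measurable)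
      then show "cmod (CLINT t|lborel. ?g t) \<le> (LINT t|lborel. cmod (char M t))"
        by (intro order_trans[OF integral_norm_bound] integral_mono integrable_norm int le)
      show "0 \<le> e / pi" using e by simp
    qed
    also have "\<dots> = C * e" by (simp add: C_def)
    also have "\<dots> \<le> C * d"
      using e by (intro mult_left_mono) (auto simp: C_def)
    finally show ?thesis .
  qed
  have lim: "((\<lambda>d. C * d) \<longlongrightarrow> C * 0) (at_right 0)"
    by (rule tendsto_mult[OF tendsto_const tendsto_ident_at])
  have "\<forall>\<^sub>F d in at_right 0. measure M {x} \<le> C * d"
    using eventually_at_right_less[of "0 :: real"] by eventually_elim (rule le)
  then have "measure M {x} \<le> C * 0"
    by (intro tendsto_lowerbound[OF lim]) (simp_all only: trivial_limit_at_right_real not_False_eq_True)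
  then show ?thesis by (simp add: antisym)
qed

lemma (in real_distribution) measure_ball_char:
  assumes int: "integrable lborel (char M)" and e: "e > 0"
  shows "complex_of_real (measure M {x - e<..<x + e}) = e / pi * (CLINT t|lborel. sinc_fun (e * t) * iexp (-(t * x)) * char M t)"
proof -
  have "{x - e<..x + e} = {x - e<..<x + e} \<union> {x + e}" using e by auto
  then have "measure M {x - e<..x + e} = measure M {x - e<..<x + e} + measure M {x + e}"
    by (subst finite_measure_Union[symmetric]) (auto intro: arg_cong[where f="measure M"])
  then show ?thesis
    using measure_Ioc_char[OF int e, of x] measure_singleton_char[OF int] by simp
qed

text \<open>The antiderivative \<open>- exp (- s * z) / z\<close> decays because
  \<open>Re z > 0\<close>. With \<open>z = q - \<eta> u\<close> this turns characteristic functions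
  at fixed times into the resolvent.\<close>

lemma laplace_complex_exp:
  assumes z: "Re z > 0"
  shows "integrable lborel (\<lambda>s. indicator {0..} s *\<^sub>R exp (- (complex_of_real s * z)))"
    "(CLINT s|lborel. indicator {0..} s *\<^sub>R exp (- (complex_of_real s * z))) = 1 / z"
proof -
  let ?e = "\<lambda>s. exp (- (complex_of_real s * z))"
  have ae: "AE s in lborel. indicator {0<..} s *\<^sub>R ?e s = indicator {0..} s *\<^sub>R ?e s"
    using AE_lborel_singleton[of "0 :: real"] by eventually_elim (auto simp: indicator_def)
  have int0: "integrable lborel (\<lambda>s. indicator {0<..} s *\<^sub>R ?e s)"
  proof (rule Bochner_Integration.integrable_bound)
    show "integrable lborel (\<lambda>s. indicator {0<..} s *\<^sub>R exp (- (s * Re z)))"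
      using integrable_I0i_exp_mscale[OF z] by (simp add: set_integrable_def)
  qed (auto simp: indicator_def)
  show "integrable lborel (\<lambda>s. indicator {0..} s *\<^sub>R ?e s)"
    using int0 by (rule integrable_cong_AE_imp[OF _ _ ae]) measurable
  have [simp]: "z \<noteq> 0" using z by auto
  have "(LBINT s=0..\<infinity>. ?e s) = 0 - (- 1 / z)"
  proof (rule interval_integral_FTC_integrable[where F="\<lambda>s. - ?e s / z"])
    fix s :: real
    show "((\<lambda>s. - ?e s / z) has_vector_derivative ?e s) (at s)"
      by (auto intro!: derivative_eq_intros has_vector_derivative_real_field)
  next
    show "set_integrable lborel (einterval 0 \<infinity>) (\<lambda>s. ?e s)"
      using int0 by (simp add: set_integrable_def einterval_def zero_ereal_def greaterThan_def)
  next
    have "((\<lambda>s. - ?e s / z) \<longlongrightarrow> - exp (- (complex_of_real 0 * z)) / z) (at_right 0)"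
      by (intro tendsto_intros) auto
    then show "(((\<lambda>s. - ?e s / z) \<circ> real_of_ereal) \<longlongrightarrow> (- 1 / z)) (at_right 0)"
      by (simp add: ereal_tendsto_simps zero_ereal_def)
  next
    have "((\<lambda>s. exp (- (Re z * s)) / cmod z) \<longlongrightarrow> 0 / cmod z) at_top"
      using z by (intro tendsto_divide filterlim_compose[OF exp_at_bot] tendsto_const)
        (auto intro!: filterlim_tendsto_pos_mult_at_top[OF tendsto_const] filterlim_ident simp: filterlim_uminus_at_bot)
    then have "((\<lambda>s. - ?e s / z) \<longlongrightarrow> 0) at_top"
      by (intro Lim_null_comparison[where f="\<lambda>s. - ?e s / z", OF always_eventually])
         (auto simp: norm_divide mult.commute)
    then show "(((\<lambda>s. - ?e s / z) \<circ> real_of_ereal) \<longlongrightarrow> 0) (at_left \<infinity>)"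
      by (simp add: ereal_tendsto_simps)
  qed auto
  also have "(LBINT s=0..\<infinity>. ?e s) = (CLINT s|lborel. indicator {0<..} s *\<^sub>R ?e s)"
    by (simp add: interval_lebesgue_integral_0_infty set_lebesgue_integral_def)
  also have "\<dots> = (CLINT s|lborel. indicator {0..} s *\<^sub>R ?e s)"
    by (rule integral_cong_AE[OF _ _ ae]) measurable
  finally show "(CLINT s|lborel. indicator {0..} s *\<^sub>R ?e s) = 1 / z" by simp
qed

section \<open>Resolvent densities\<close>

text \<open>Mean value inequality on the left half-plane, which is convex and on which the
  derivative of \<open>exp\<close> has modulus at most 1.\<close>

lemma cmod_exp_minus_1_le:
  assumes "Re z \<le> 0"
  shows "cmod (exp z - 1) \<le> cmod z"
proof -
  have "cmod (exp z - exp 0) \<le> 1 * cmod (z - 0)"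
  proof (rule field_differentiable_bound[where S="{w. Re w \<le> 0}" and f=exp and f'=exp])
    show "convex {w. Re w \<le> 0}" by (rule convex_halfspace_Re_le)
  qed (use assms in \<open>auto intro!: derivative_eq_intros\<close>)
  then show ?thesis by simp
qed

text \<open>The Levy-Khintchine triple enters only through \<open>symbol_0\<close>,
  \<open>symbol_minus\<close> and \<open>symbol_lower\<close>; it does not reappear before the final
  theorem. Condition (B) is kept out and is assumed where the limit \<open>q\<close> to 0 needs
  it.\<close>

locale levy_symbol = cadlag_levy +
  fixes \<eta> :: "real \<Rightarrow> complex"
  assumes char_X: "\<And>t u. 0 \<le> t \<Longrightarrow> (CLINT \<omega>|M. iexp (u * X t \<omega>)) = exp (complex_of_real t * \<eta> u)"
    and symbol_0: "\<eta> 0 = 0"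
    and symbol_minus: "\<And>u. \<eta> (- u) = cnj (\<eta> u)"
    and symbol_lower: "\<exists>c>0. \<exists>r>0. \<forall>u. \<bar>u\<bar> \<le> r \<longrightarrow> c * u\<^sup>2 \<le> - Re (\<eta> u)"
    and resolvent_integrable': "\<And>q :: real. q > 0 \<Longrightarrow> integrable lborel (\<lambda>u. 1 / (complex_of_real q - \<eta> u))"
begin

definition resolvent :: "real \<Rightarrow> real \<Rightarrow> complex" where
  "resolvent q u = 1 / (complex_of_real q - \<eta> u)"

lemma resolvent_integrable: "q > 0 \<Longrightarrow> integrable lborel (resolvent q)"
  using resolvent_integrable' unfolding resolvent_def[abs_def] .

lemma Re_symbol_le_0: "Re (\<eta> u) \<le> 0"
proof -
  have "cmod (exp (\<eta> u)) = cmod (CLINT \<omega>|M. iexp (u * X 1 \<omega>))"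
    using char_X[of 1 u] by simp
  also have "\<dots> \<le> (LINT \<omega>|M. cmod (iexp (u * X 1 \<omega>)))" by (rule integral_norm_bound)
  also have "\<dots> = 1" by (simp add: prob_space)
  finally show ?thesis by simp
qed

text \<open>Since \<open>Re (\<eta> u) <= 0\<close>, adding \<open>q >= 0\<close> moves
  \<open>- \<eta> u\<close> away from the origin. The second bound is uniform in \<open>q\<close>
  and serves as domination when \<open>q\<close> tends to 0.\<close>

lemma cmod_minus_symbol_ge:
  assumes "q \<ge> 0"
  shows "q \<le> cmod (complex_of_real q - \<eta> u)" "cmod (\<eta> u) \<le> cmod (complex_of_real q - \<eta> u)"
proof -
  show "q \<le> cmod (complex_of_real q - \<eta> u)"
    using complex_Re_le_cmod[of "complex_of_real q - \<eta> u"] Re_symbol_le_0[of u] by simp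
  have "(Re (\<eta> u))\<^sup>2 \<le> (q - Re (\<eta> u))\<^sup>2"
    using assms Re_symbol_le_0[of u] by (intro power2_le_iff_abs_le[THEN iffD2]) auto
  then show "cmod (\<eta> u) \<le> cmod (complex_of_real q - \<eta> u)"
    by (simp add: cmod_def)
qed

lemma cmod_resolvent_le: "q > 0 \<Longrightarrow> \<eta> u \<noteq> 0 \<Longrightarrow> cmod (resolvent q u) \<le> 1 / cmod (\<eta> u)"
  using cmod_minus_symbol_ge(2)[of q u] by (auto simp: resolvent_def norm_divide intro!: divide_left_mono mult_pos_pos)

section \<open>The law of the process at an independent exponential time\<close>

abbreviation exp_time :: "real \<Rightarrow> real measure" where
  "exp_time q \<equiv> density lborel (\<lambda>s. ennreal (exponential_density q s))"

text \<open>The product space makes the exponential time independent of the process. The result is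
  \<open>q\<close> times the \<open>q\<close>-resolvent measure, normalised so that results on
  probability laws apply.\<close>

definition exp_law :: "real \<Rightarrow> real measure" where
  "exp_law q = distr (exp_time q \<Otimes>\<^sub>M M) borel (\<lambda>(s, \<omega>). X (max s 0) \<omega>)"

lemma X_jointly_measurable_exp_time:
  "(\<lambda>(s, \<omega>). X (max s 0) \<omega>) \<in> borel_measurable (exp_time q \<Otimes>\<^sub>M M)"
  using X_jointly_measurable
  by (subst measurable_cong_sets[OF sets_pair_measure_cong[OF _ refl, of _ borel] refl]) auto

lemma pair_prob_space_exp_time: "q > 0 \<Longrightarrow> pair_prob_space (exp_time q) M"
  unfolding pair_prob_space_def pair_sigma_finite_def
  by (auto intro: prob_space_imp_sigma_finite prob_space_exponential_density prob_space_axioms)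

lemma real_distribution_exp_law: "q > 0 \<Longrightarrow> real_distribution (exp_law q)"
proof -
  assume q: "q > 0"
  then interpret P: pair_prob_space "exp_time q" M by (rule pair_prob_space_exp_time)
  show ?thesis unfolding exp_law_def
    by (rule P.real_distribution_distr) (rule X_jointly_measurable_exp_time)
qed

text \<open>By Fubini the exponential time averages \<open>exp (s * \<eta> u)\<close>, which is a
  Laplace transform. Through this formula (A) becomes integrability of a characteristic function, as
  Fourier inversion requires.\<close>

lemma char_exp_law:
  assumes q: "q > 0"
  shows "char (exp_law q) u = q * resolvent q u"
proof -
  interpret P: pair_prob_space "exp_time q" M using q by (rule pair_prob_space_exp_time)
  note [measurable] = X_jointly_measurable_exp_time[of q]
  let ?f = "\<lambda>z. iexp (u * (case z of (s, \<omega>) \<Rightarrow> X (max s 0) \<omega>))"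
  have m: "?f \<in> borel_measurable (exp_time q \<Otimes>\<^sub>M M)"
    by measurable
  have int: "integrable (exp_time q \<Otimes>\<^sub>M M) ?f"
    by (rule P.integrable_const_bound[OF _ m, where B=1]) auto
  have Re: "Re (complex_of_real q - \<eta> u) > 0" using Re_symbol_le_0[of u] q by simp
  have "char (exp_law q) u = (CLINT z|exp_time q \<Otimes>\<^sub>M M. ?f z)"
    unfolding char_def exp_law_def
    by (subst integral_distr) (auto intro: X_jointly_measurable_exp_time)
  also have "\<dots> = (CLINT s|exp_time q. CLINT \<omega>|M. ?f (s, \<omega>))"
    by (rule P.integral_fst'[symmetric, OF int])
  also have "\<dots> = (CLINT s|exp_time q. exp (complex_of_real (max s 0) * \<eta> u))"
    by (intro Bochner_Integration.integral_cong refl) (simp only: prod.case, rule char_X, simp)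
  also have "\<dots> = (CLINT s|lborel. exponential_density q s *\<^sub>R exp (complex_of_real (max s 0) * \<eta> u))"
    using q by (intro integral_density) (auto simp: exponential_density_def)
  also have "\<dots> = (CLINT s|lborel. q * (indicator {0..} s *\<^sub>R exp (- (complex_of_real s * (complex_of_real q - \<eta> u)))))"
    by (intro Bochner_Integration.integral_cong refl)
       (auto simp: exponential_density_def indicator_def scaleR_conv_of_real exp_of_real[symmetric] exp_add[symmetric] algebra_simps)
  also have "\<dots> = q * resolvent q u"
    by (simp only: integral_mult_right_zero laplace_complex_exp(2)[OF Re] resolvent_def)
  finally show ?thesis .
qed

text \<open>Rewrites the law as discounted occupation: the weight \<open>exp (- (q * s))\<close>
  stands visibly under the integral and can later be split at a random time.\<close>

lemma nn_integral_exp_law: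
  assumes q: "q > 0" and A: "A \<in> sets borel"
  shows "(\<integral>\<^sup>+s. ennreal (indicator {0..} s * exp (- (q * s))) * (\<integral>\<^sup>+\<omega>. indicator A (X (max s 0) \<omega>) \<partial>M) \<partial>lborel)
    = ennreal (measure (exp_law q) A / q)"
proof -
  let ?P = "\<lambda>s. \<integral>\<^sup>+\<omega>. indicator A (X (max s 0) \<omega>) \<partial>M"
  let ?g = "\<lambda>s. ennreal (indicator {0..} s * exp (- (q * s)))"
  interpret P: pair_prob_space "exp_time q" M using q by (rule pair_prob_space_exp_time)
  interpret L: real_distribution "exp_law q" using q by (rule real_distribution_exp_law)
  note [measurable] = X_jointly_measurable_exp_time[of q] A X_jointly_measurable
  have "ennreal (measure (exp_law q) A) = emeasure (exp_law q) A"
    by (simp add: L.emeasure_eq_measure)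
  also have "\<dots> = (\<integral>\<^sup>+x. indicator A x \<partial>exp_law q)" by simp
  also have "\<dots> = (\<integral>\<^sup>+z. indicator A (case z of (s, \<omega>) \<Rightarrow> X (max s 0) \<omega>) \<partial>(exp_time q \<Otimes>\<^sub>M M))"
    unfolding exp_law_def by (subst nn_integral_distr) auto
  also have "\<dots> = (\<integral>\<^sup>+s. \<integral>\<^sup>+\<omega>. indicator A (X (max s 0) \<omega>) \<partial>M \<partial>exp_time q)"
    by (subst nn_integral_fst[symmetric]) auto
  also have "\<dots> = (\<integral>\<^sup>+s. ennreal (exponential_density q s) * ?P s \<partial>lborel)"
    by (subst nn_integral_density) auto
  also have "\<dots> = (\<integral>\<^sup>+s. ennreal q * (?g s * ?P s) \<partial>lborel)"
  proof (intro nn_integral_cong)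
    fix s :: real
    have "ennreal (exponential_density q s) = ennreal q * ?g s"
      using q by (simp add: ennreal_mult'[symmetric] exponential_density_def mult.commute)
    then show "ennreal (exponential_density q s) * ?P s =
      ennreal q * (?g s * ?P s)"
      by (simp only: mult.assoc)
  qed
  also have "\<dots> = ennreal q * (\<integral>\<^sup>+s. ?g s * ?P s \<partial>lborel)"
    by (rule nn_integral_cmult) measurable
  finally have "ennreal (measure (exp_law q) A) = ennreal q * (\<integral>\<^sup>+s. ?g s * ?P s \<partial>lborel)" .
  then have "ennreal (measure (exp_law q) A) / ennreal q = (\<integral>\<^sup>+s. ?g s * ?P s \<partial>lborel)"
    using q by (simp only: mult.commute[of "ennreal q"]) (rule mult_divide_eq_ennreal, auto)
  then show ?thesis using q by (simp add: divide_ennreal)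
qed

section \<open>The potential density as a Fourier integral, and its local averages\<close>

definition pot :: "real \<Rightarrow> real \<Rightarrow> real" where
  "pot q y = 1 / (2 * pi) * (LINT u|lborel. Re (iexp (u * y) * resolvent q u))"

text \<open>The mean of \<open>pot q\<close> over \<open>(y - e, y + e)\<close>: averaging over an
  interval multiplies the Fourier integrand by \<open>sinc_fun (e * u)\<close>.\<close>

definition pot_avg :: "real \<Rightarrow> real \<Rightarrow> real \<Rightarrow> real" where
  "pot_avg q e y = 1 / (2 * pi) * (LINT u|lborel. Re (sinc_fun (e * u) * (iexp (u * y) * resolvent q u)))"

definition pot_bound :: "real \<Rightarrow> real" where
  "pot_bound q = 1 / (2 * pi) * (LINT u|lborel. cmod (resolvent q u))"

text \<open>It contains no space variable, so that the averages converge uniformly; this matters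
  because \<open>pot_avg\<close> is evaluated at the random position of the process.\<close>

definition pot_err :: "real \<Rightarrow> real \<Rightarrow> real" where
  "pot_err q e = 1 / (2 * pi) * (LINT u|lborel. cmod (resolvent q u) * \<bar>sinc_fun (e * u) - 1\<bar>)"

lemma resolvent_measurable [measurable]: "q > 0 \<Longrightarrow> resolvent q \<in> borel_measurable borel"
  using borel_measurable_integrable[OF resolvent_integrable] by simp

lemma pot_integrands:
  assumes q: "q > 0"
  shows "integrable lborel (\<lambda>u. iexp (u * y) * resolvent q u)"
    "integrable lborel (\<lambda>u. sinc_fun (e * u) * (iexp (u * y) * resolvent q u))"
    "integrable lborel (\<lambda>u. cmod (resolvent q u) * \<bar>sinc_fun (e * u) - 1\<bar>)"
proof -
  note [measurable] = resolvent_measurable[OF q]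
  show "integrable lborel (\<lambda>u. iexp (u * y) * resolvent q u)"
    by (rule Bochner_Integration.integrable_bound[OF resolvent_integrable[OF q]]) (auto simp: norm_mult)
  show "integrable lborel (\<lambda>u. sinc_fun (e * u) * (iexp (u * y) * resolvent q u))"
    by (rule Bochner_Integration.integrable_bound[OF resolvent_integrable[OF q]])
       (auto simp: norm_mult abs_sinc_fun_le_1 mult_left_le_one_le)
  show "integrable lborel (\<lambda>u. cmod (resolvent q u) * \<bar>sinc_fun (e * u) - 1\<bar>)"
  proof (rule Bochner_Integration.integrable_bound)
    show "integrable lborel (\<lambda>u. 2 * cmod (resolvent q u))"
      using resolvent_integrable[OF q] by simp
    show "AE u in lborel. norm (cmod (resolvent q u) * \<bar>sinc_fun (e * u) - 1\<bar>) \<le> norm (2 * cmod (resolvent q u))"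
      using sinc_fun_bound_mult(2)[of "cmod (resolvent q _)" "e * _"] by (auto intro!: AE_I2 simp: abs_mult)
  qed measurable
qed

lemma pot_bounds:
  assumes q: "q > 0"
  shows "\<bar>pot q y\<bar> \<le> pot_bound q" "\<bar>pot_avg q e y\<bar> \<le> pot_bound q" "\<bar>pot_avg q e y - pot q y\<bar> \<le> pot_err q e"
proof -
  note int = pot_integrands[OF q] integrable_norm[OF resolvent_integrable[OF q]]
  have *: "\<bar>1 / (2 * pi) * a\<bar> \<le> 1 / (2 * pi) * b" if "\<bar>a\<bar> \<le> b" for a b :: real
    using that mult_left_mono[OF that, of "1 / (2 * pi)"] by (simp add: abs_mult)
  have Re_le: "\<bar>Re (iexp (u * y) * resolvent q u)\<bar> \<le> cmod (resolvent q u)" for u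
    using abs_Re_le_cmod[of "iexp (u * y) * resolvent q u"] by (simp add: norm_mult)
  show "\<bar>pot q y\<bar> \<le> pot_bound q"
    unfolding pot_def pot_bound_def
    by (intro * order_trans[OF integral_abs_bound] integral_mono integrable_abs integrable_Re int Re_le)
  have "\<bar>Re (sinc_fun (e * u) * (iexp (u * y) * resolvent q u))\<bar> \<le> cmod (resolvent q u)" for u
    using abs_Re_le_cmod[of "sinc_fun (e * u) * (iexp (u * y) * resolvent q u)"]
    by (rule order_trans) (simp add: norm_mult abs_sinc_fun_le_1 mult_left_le_one_le)
  then show "\<bar>pot_avg q e y\<bar> \<le> pot_bound q"
    unfolding pot_avg_def pot_bound_def
    by (intro * order_trans[OF integral_abs_bound] integral_mono integrable_abs integrable_Re int)
  have "pot_avg q e y - pot q y = 1 / (2 * pi) *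
     (LINT u|lborel. Re (sinc_fun (e * u) * (iexp (u * y) * resolvent q u)) - Re (iexp (u * y) * resolvent q u))"
    unfolding pot_avg_def pot_def
    by (simp only: right_diff_distrib Bochner_Integration.integral_diff[OF integrable_Re[OF int(2)] integrable_Re[OF int(1)]])
  moreover have "\<bar>Re (sinc_fun (e * u) * (iexp (u * y) * resolvent q u)) - Re (iexp (u * y) * resolvent q u)\<bar>
     \<le> cmod (resolvent q u) * \<bar>sinc_fun (e * u) - 1\<bar>" for u
  proof -
    have "Re (sinc_fun (e * u) * (iexp (u * y) * resolvent q u)) - Re (iexp (u * y) * resolvent q u)
      = (sinc_fun (e * u) - 1) * Re (iexp (u * y) * resolvent q u)"
      by (simp add: left_diff_distrib)
    then show ?thesis
      using mult_left_mono[OF Re_le[of u], of "\<bar>sinc_fun (e * u) - 1\<bar>"] by (simp add: abs_mult mult.commute)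
  qed
  ultimately show "\<bar>pot_avg q e y - pot q y\<bar> \<le> pot_err q e"
    unfolding pot_err_def
    by (simp only:) (intro * order_trans[OF integral_abs_bound] integral_mono integrable_abs Bochner_Integration.integrable_diff integrable_Re int)
qed

lemma pot_err_tendsto_0:
  assumes q: "q > 0"
  shows "(\<lambda>n. pot_err q (1 / Suc n)) \<longlonglongrightarrow> 0"
proof -
  note [measurable] = resolvent_measurable[OF q]
  have "(\<lambda>n. LINT u|lborel. cmod (resolvent q u) * \<bar>sinc_fun (1 / Suc n * u) - 1\<bar>) \<longlonglongrightarrow> (LINT u :: real|lborel. (0 :: real))"
  proof (rule integral_dominated_convergence)
    show "integrable lborel (\<lambda>u. 2 * cmod (resolvent q u))"
      using resolvent_integrable[OF q] by simp
    show "AE u in lborel. (\<lambda>n. cmod (resolvent q u) * \<bar>sinc_fun (1 / Suc n * u) - 1\<bar>) \<longlonglongrightarrow> 0"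
    proof (intro AE_I2)
      fix u :: real
      have "(\<lambda>n. 1 / Suc n * u) \<longlonglongrightarrow> 0"
        using tendsto_mult_left_zero[OF LIMSEQ_Suc[OF lim_1_over_n], of u] by simp
      then have "(\<lambda>n. sinc_fun (1 / Suc n * u)) \<longlonglongrightarrow> sinc_fun 0"
        by (rule isCont_tendsto_compose[OF isCont_sinc_fun])
      then have "(\<lambda>n. cmod (resolvent q u) * \<bar>sinc_fun (1 / Suc n * u) - 1\<bar>) \<longlonglongrightarrow> cmod (resolvent q u) * \<bar>sinc_fun 0 - 1\<bar>"
        by (intro tendsto_intros)
      then show "(\<lambda>n. cmod (resolvent q u) * \<bar>sinc_fun (1 / Suc n * u) - 1\<bar>) \<longlonglongrightarrow> 0"
        by (simp add: sinc_fun_def)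
    qed
    show "AE u in lborel. norm (cmod (resolvent q u) * \<bar>sinc_fun (1 / Suc n * u) - 1\<bar>) \<le> 2 * cmod (resolvent q u)" for n
      using sinc_fun_bound_mult(2)[of "cmod (resolvent q _)" "1 / Suc n * _"] by (auto intro!: AE_I2 simp: abs_mult)
  qed measurable
  then show ?thesis
    unfolding pot_err_def by (intro tendsto_mult_right_zero) simp
qed

lemma isCont_pot:
  assumes q: "q > 0"
  shows "isCont (pot q) y"
  unfolding continuous_at_sequentially
proof (intro allI impI)
  fix z :: "nat \<Rightarrow> real" assume z: "z \<longlonglongrightarrow> y"
  note [measurable] = resolvent_measurable[OF q]
  have "(\<lambda>n. LINT u|lborel. Re (iexp (u * z n) * resolvent q u)) \<longlonglongrightarrow> (LINT u|lborel. Re (iexp (u * y) * resolvent q u))"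
  proof (rule integral_dominated_convergence)
    show "integrable lborel (\<lambda>u. cmod (resolvent q u))" using resolvent_integrable[OF q] by simp
    show "AE u in lborel. (\<lambda>n. Re (iexp (u * z n) * resolvent q u)) \<longlonglongrightarrow> Re (iexp (u * y) * resolvent q u)"
      by (intro AE_I2 tendsto_intros z)
    show "AE u in lborel. norm (Re (iexp (u * z n) * resolvent q u)) \<le> cmod (resolvent q u)" for n
      by (intro AE_I2 order_trans[OF abs_Re_le_cmod, folded real_norm_def]) (simp add: norm_mult)
  qed measurable
  then show "(pot q \<circ> z) \<longlonglongrightarrow> pot q y"
    unfolding pot_def comp_def by (intro tendsto_mult tendsto_const)
qed

lemma pot_measurable [measurable]: "q > 0 \<Longrightarrow> pot q \<in> borel_measurable borel"
  by (intro borel_measurable_continuous_onI continuous_at_imp_continuous_on ballI isCont_pot)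

text \<open>The bridge between paths and Fourier integrals. The walker started at \<open>y\<close>
  is in \<open>(- e, e)\<close> exactly when \<open>X\<close> is in the ball of radius
  \<open>e\<close> around \<open>- y\<close>, whose mass under \<open>exp_law q\<close> the
  inversion formula computes. Nonnegativity of the average is read off from the probability.\<close>

lemma occupation_pot_avg:
  assumes q: "q > 0" and e: "e > 0"
  shows "(\<integral>\<^sup>+s. ennreal (indicator {0..} s * exp (- (q * s))) *
      (\<integral>\<^sup>+\<omega>. indicator {-e<..<e} (y + X (max s 0) \<omega>) \<partial>M) \<partial>lborel) = ennreal (2 * e * pot_avg q e y)"
    "0 \<le> pot_avg q e y"
proof -
  interpret L: real_distribution "exp_law q" using q by (rule real_distribution_exp_law)
  have char: "char (exp_law q) = (\<lambda>u. q * resolvent q u)" using char_exp_law[OF q] by auto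
  have int: "integrable lborel (char (exp_law q))"
    unfolding char using resolvent_integrable[OF q] by simp
  have "complex_of_real (measure (exp_law q) {-y - e<..<-y + e}) = e / pi * (CLINT t|lborel. sinc_fun (e * t) * iexp (- (t * (- y))) * char (exp_law q) t)"
    by (rule L.measure_ball_char[OF int e])
  also have "(CLINT t|lborel. sinc_fun (e * t) * iexp (- (t * (- y))) * char (exp_law q) t) =
    (CLINT t|lborel. complex_of_real q * (sinc_fun (e * t) * (iexp (t * y) * resolvent q t)))"
    unfolding char by (intro Bochner_Integration.integral_cong refl) simp
  also have "\<dots> = complex_of_real q * (CLINT t|lborel. sinc_fun (e * t) * (iexp (t * y) * resolvent q t))"
    by (rule integral_mult_right_zero)
  finally have "complex_of_real (measure (exp_law q) {-y - e<..<-y + e}) =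
    complex_of_real (e / pi * q) * (CLINT t|lborel. sinc_fun (e * t) * (iexp (t * y) * resolvent q t))"
    by simp
  then have "Re (complex_of_real (measure (exp_law q) {-y - e<..<-y + e})) =
    Re (complex_of_real (e / pi * q) * (CLINT t|lborel. sinc_fun (e * t) * (iexp (t * y) * resolvent q t)))"
    by (rule arg_cong)
  then have "measure (exp_law q) {-y - e<..<-y + e} = e / pi * q * Re (CLINT t|lborel. sinc_fun (e * t) * (iexp (t * y) * resolvent q t))"
    by (simp only: scaleR_conv_of_real[symmetric] scaleR_complex.sel Re_complex_of_real)
  also have "Re (CLINT t|lborel. sinc_fun (e * t) * (iexp (t * y) * resolvent q t)) =
     (LINT t|lborel. Re (sinc_fun (e * t) * (iexp (t * y) * resolvent q t)))"
    by (rule integral_Re[symmetric, OF pot_integrands(2)[OF q]])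
  finally have *: "measure (exp_law q) {-y - e<..<-y + e} / q = 2 * e * pot_avg q e y"
    using q by (simp add: pot_avg_def field_simps)
  have "indicator {-e<..<e} (y + z) = (indicator {-y - e<..<-y + e} z :: ennreal)" for z
    by (auto simp: indicator_def)
  then show "(\<integral>\<^sup>+s. ennreal (indicator {0..} s * exp (- (q * s))) *
      (\<integral>\<^sup>+\<omega>. indicator {-e<..<e} (y + X (max s 0) \<omega>) \<partial>M) \<partial>lborel) = ennreal (2 * e * pot_avg q e y)"
    using nn_integral_exp_law[OF q, of "{-y - e<..<-y + e}"] * by simp
  have "0 \<le> measure (exp_law q) {-y - e<..<-y + e} / q" using q by simp
  then show "0 \<le> pot_avg q e y" unfolding * using e by (simp add: zero_le_mult_iff)
qed

lemma pot_nonneg: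
  assumes q: "q > 0"
  shows "0 \<le> pot q y"
proof -
  have "- pot_err q (1 / Suc n) \<le> pot q y" for n
    using pot_bounds(3)[OF q, of "1 / Suc n" y] occupation_pot_avg(2)[OF q, of "1 / Suc n" y] by simp
  then show ?thesis
    using tendsto_minus[OF pot_err_tendsto_0[OF q]] by (intro LIMSEQ_le_const2[of "\<lambda>n. - pot_err q (1 / Suc n)" 0]) auto
qed

text \<open>At 0 the oscillating factor is 1 and the integrand \<open>Re (resolvent q u)\<close> is
  strictly positive everywhere. Regularity of zero rests on dividing by this number.\<close>

lemma pot_0_pos:
  assumes q: "q > 0"
  shows "0 < pot q 0"
proof (rule ccontr)
  assume "\<not> 0 < pot q 0"
  then have "pot q 0 = 0" using pot_nonneg[OF q, of 0] by simp
  then have "(LINT u|lborel. Re (resolvent q u)) = 0" by (simp add: pot_def)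
  moreover have pos: "0 < Re (resolvent q u)" for u
  proof -
    have "complex_of_real q - \<eta> u \<noteq> 0" using Re_symbol_le_0[of u] q by (auto simp: complex_eq_iff)
    then show ?thesis
      unfolding resolvent_def using Re_symbol_le_0[of u] q
      by (auto simp: Re_divide complex_eq_iff intro!: divide_pos_pos sum_power2_gt_zero_iff[THEN iffD2])
  qed
  ultimately have "AE u in lborel. Re (resolvent q u) = 0"
    using integral_nonneg_eq_0_iff_AE[of lborel "\<lambda>u. Re (resolvent q u)"] resolvent_integrable[OF q]
    by (simp add: less_imp_le)
  then have "AE u in (lborel :: real measure). False"
    by eventually_elim (use pos in \<open>auto simp: less_le\<close>)
  then show False by (auto simp: AE_iff_null null_sets_def emeasure_lborel_UNIV)
qed

end

section \<open>First hits on a time grid\<close>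

lemma eventually_grid_point:
  fixes s b t :: real
  assumes "0 \<le> s" "s < b" "0 < t"
  shows "\<forall>\<^sub>F n in sequentially. \<exists>j :: nat. s \<le> real j * t / real (Suc n) \<and> real j * t / real (Suc n) < b"
proof -
  obtain N :: nat where N: "t / (b - s) < real N" using reals_Archimedean2 by blast
  show ?thesis
    using eventually_ge_at_top[of N]
  proof eventually_elim
    case (elim n)
    let ?N = "real (Suc n)"
    \<comment> \<open>The first grid index at or after \<open>s\<close>; it overshoots by less than
      the mesh width, which is smaller than \<open>b - s\<close>.\<close>
    define j where "j = nat \<lceil>s * ?N / t\<rceil>"
    have nn: "0 \<le> s * ?N / t" using assms by simp
    then have j: "s * ?N / t \<le> real j" "real j < s * ?N / t + 1"
      unfolding j_def using ceiling_correct[of "s * ?N / t"]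
      by (auto simp: of_nat_nat ceiling_mono[of 0, simplified])
    have "t / (b - s) < ?N" using N elim by linarith
    then have "t < ?N * (b - s)" using assms by (simp add: pos_divide_less_eq)
    then have 1: "s * ?N + t < b * ?N" by (simp add: algebra_simps)
    have "s * ?N \<le> real j * t" using j(1) assms by (simp add: pos_divide_le_eq)
    moreover have "real j * t < b * ?N"
    proof -
      have "real j * t < (s * ?N / t + 1) * t" using j(2) assms by (intro mult_strict_right_mono)
      also have "\<dots> = s * ?N + t" using assms by (simp only: distrib_right) simp
      finally show ?thesis using 1 by simp
    qed
    ultimately show ?case
      by (intro exI[of _ j]) (simp add: pos_le_divide_eq pos_divide_less_eq)
  qed
qed

context levy_symbol
begin

lemma pot_avg_measurable:
  assumes q: "q > 0"
  shows "pot_avg q e \<in> borel_measurable borel"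
proof -
  note [measurable] = resolvent_measurable[OF q]
  have "(\<lambda>(y, u). Re (complex_of_real (sinc_fun (e * u)) * (iexp (u * y) * resolvent q u)))
      \<in> borel_measurable (borel \<Otimes>\<^sub>M lborel)"
    by measurable
  then show ?thesis
    unfolding pot_avg_def[abs_def]
    by (intro borel_measurable_times borel_measurable_const lborel.borel_measurable_lebesgue_integral)
qed

text \<open>Fubini reduces to a fixed delay \<open>s\<close>, where the simple Markov property
  restarts the process from its position at \<open>t n\<close>; integrating over \<open>s\<close>
  again recovers the occupation identity. \<open>max s 0\<close> keeps the integrand meaningful at
  negative \<open>s\<close>, where the weight is zero.\<close>

lemma markov_occupation:
  fixes t :: "nat \<Rightarrow> real"
  assumes q: "q > 0" and e: "e > 0"
    and t: "0 \<le> t 0" "\<And>i. i < n \<Longrightarrow> t i \<le> t (Suc i)"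
    and A[measurable]: "A \<in> sets (PiM {..n} (\<lambda>_. borel))"
  shows "(\<integral>\<^sup>+\<omega>. indicator A (\<lambda>i\<in>{..n}. X (t i) \<omega>) *
      (\<integral>\<^sup>+s. ennreal (indicator {0..} s * exp (- (q * s))) * indicator {-e<..<e} (x + X (t n + max s 0) \<omega>) \<partial>lborel) \<partial>M)
    = (\<integral>\<^sup>+\<omega>. indicator A (\<lambda>i\<in>{..n}. X (t i) \<omega>) * ennreal (2 * e * pot_avg q e (x + X (t n) \<omega>)) \<partial>M)"
    (is "(\<integral>\<^sup>+\<omega>. ?a \<omega> * (\<integral>\<^sup>+s. ?g s * ?i s \<omega> \<partial>lborel) \<partial>M) = _")
proof -
  let ?I = "\<lambda>s \<omega>. \<integral>\<^sup>+\<omega>'. indicator {-e<..<e} (x + X (t n) \<omega> + X (max s 0) \<omega>') \<partial>M"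
  let ?J = "\<lambda>s. \<integral>\<^sup>+\<omega>. \<integral>\<^sup>+\<omega>'. ?a \<omega> * indicator {-e<..<e} (x + X (t n) \<omega> + X (max s 0) \<omega>') \<partial>M \<partial>M"
  have pos: "0 \<le> t i" if "i \<le> n" for i
    using that by (rule grid_nonneg[of _ n t]) (use t in auto)
  interpret P: pair_sigma_finite lborel M ..
  have path[measurable]: "(\<lambda>\<omega>. \<lambda>i\<in>{..n}. X (t i) \<omega>) \<in> M \<rightarrow>\<^sub>M PiM {..n} (\<lambda>_. borel)"
    using pos by (intro measurable_restrict X_measurable) auto
  have Xm[measurable]: "(\<lambda>z. X (t n + max (fst z) 0) (snd z)) \<in> borel_measurable (lborel \<Otimes>\<^sub>M M)"
    using pos by (intro measurable_X_compose) auto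
  have X0m[measurable]: "(\<lambda>z. X (max (fst z) 0) (snd z)) \<in> borel_measurable (lborel \<Otimes>\<^sub>M M)"
    by (intro measurable_X_compose) auto
  have Xn[measurable]: "X (t n) \<in> borel_measurable M" using pos by (intro X_measurable) auto
  have comp: "(\<lambda>v. v n) \<in> PiM {..n} (\<lambda>_. borel) \<rightarrow>\<^sub>M (borel :: real measure)"
    by (rule measurable_component_singleton) auto
  have "(\<integral>\<^sup>+\<omega>. ?a \<omega> * (\<integral>\<^sup>+s. ?g s * ?i s \<omega> \<partial>lborel) \<partial>M) = (\<integral>\<^sup>+\<omega>. \<integral>\<^sup>+s. ?a \<omega> * (?g s * ?i s \<omega>) \<partial>lborel \<partial>M)"
  proof (intro nn_integral_cong nn_integral_cmult[symmetric])
    fix \<omega> assume "\<omega> \<in> space M"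
    then have [measurable]: "(\<lambda>s. X (t n + max s 0) \<omega>) \<in> borel_measurable lborel"
      using measurable_compose[OF measurable_Pair2'[of \<omega> M lborel] Xm] by simp
    show "(\<lambda>s. ?g s * ?i s \<omega>) \<in> borel_measurable lborel" by measurable
  qed
  also have "\<dots> = (\<integral>\<^sup>+s. \<integral>\<^sup>+\<omega>. ?a \<omega> * (?g s * ?i s \<omega>) \<partial>M \<partial>lborel)"
    by (rule P.Fubini') (simp add: split_beta', measurable)
  also have "\<dots> = (\<integral>\<^sup>+s. ?g s * (\<integral>\<^sup>+\<omega>. ?a \<omega> * ?i s \<omega> \<partial>M) \<partial>lborel)"
  proof (intro nn_integral_cong)
    fix s :: real
    have [measurable]: "X (t n + max s 0) \<in> borel_measurable M"
      using pos[of n] by (intro X_measurable) auto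
    show "(\<integral>\<^sup>+\<omega>. ?a \<omega> * (?g s * ?i s \<omega>) \<partial>M) = ?g s * (\<integral>\<^sup>+\<omega>. ?a \<omega> * ?i s \<omega> \<partial>M)"
      by (subst nn_integral_cmult[symmetric]) (measurable, simp only: mult_ac)
  qed
  also have "\<dots> = (\<integral>\<^sup>+s. ?g s * ?J s \<partial>lborel)"
  proof (rule nn_integral_cong)
    fix s :: real
    let ?\<Phi> = "\<lambda>v z. indicator A v * indicator {-e<..<e} (x + v n + z) :: ennreal"
    note comp[measurable]
    have "(\<lambda>(v, z). ?\<Phi> v z) \<in> borel_measurable (PiM {..n} (\<lambda>_. borel) \<Otimes>\<^sub>M (borel :: real measure))"
      by measurable
    from markov_nn_integral[where \<Phi>="?\<Phi>" and s="max s 0", OF t _ this]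
    have "(\<integral>\<^sup>+\<omega>. ?a \<omega> * ?i s \<omega> \<partial>M) =
      ?J s"
      by (simp add: algebra_simps)
    then show "?g s * (\<integral>\<^sup>+\<omega>. ?a \<omega> * ?i s \<omega> \<partial>M) =
      ?g s * ?J s"
      by (rule arg_cong)
  qed
  also have "\<dots> = (\<integral>\<^sup>+s. \<integral>\<^sup>+\<omega>. ?a \<omega> * (?g s * ?I s \<omega>) \<partial>M \<partial>lborel)"
  proof (intro nn_integral_cong)
    fix s :: real
    have [measurable]: "X (max s 0) \<in> borel_measurable M" by (intro X_measurable) auto
    show "?g s * ?J s =
      (\<integral>\<^sup>+\<omega>. ?a \<omega> * (?g s * ?I s \<omega>) \<partial>M)"
      by (subst nn_integral_cmult[symmetric]) (measurable, simp add: nn_integral_cmult mult_ac)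
  qed
  also have "\<dots> = (\<integral>\<^sup>+\<omega>. \<integral>\<^sup>+s. ?a \<omega> * (?g s * ?I s \<omega>) \<partial>lborel \<partial>M)"
  proof (rule P.Fubini'[symmetric])
    have [measurable]: "(\<lambda>z. X (max (fst (fst z)) 0) (snd z)) \<in> borel_measurable ((lborel \<Otimes>\<^sub>M M) \<Otimes>\<^sub>M M)"
      by (intro measurable_X_compose) auto
    have "(\<lambda>z. \<integral>\<^sup>+\<omega>'. indicator {-e<..<e} (x + X (t n) (snd z) + X (max (fst z) 0) \<omega>') \<partial>M) \<in> borel_measurable (lborel \<Otimes>\<^sub>M M)"
      by (rule borel_measurable_nn_integral) (simp add: split_beta', measurable)
    then show "(\<lambda>(s, \<omega>). ?a \<omega> * (?g s * ?I s \<omega>)) \<in> borel_measurable (lborel \<Otimes>\<^sub>M M)"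
      by (simp add: split_beta')
  qed
  also have "\<dots> = (\<integral>\<^sup>+\<omega>. ?a \<omega> * ennreal (2 * e * pot_avg q e (x + X (t n) \<omega>)) \<partial>M)"
  proof (intro nn_integral_cong)
    fix \<omega>
    have "(\<lambda>s. ?I s \<omega>) \<in> borel_measurable lborel"
      by (rule borel_measurable_nn_integral) (simp add: split_beta', measurable)
    then have "(\<integral>\<^sup>+s. ?a \<omega> * (?g s * ?I s \<omega>) \<partial>lborel)
      = ?a \<omega> * (\<integral>\<^sup>+s. ?g s * ?I s \<omega> \<partial>lborel)"
      by (intro nn_integral_cmult) measurable
    then show "(\<integral>\<^sup>+s. ?a \<omega> * (?g s * ?I s \<omega>) \<partial>lborel)
      = ?a \<omega> * ennreal (2 * e * pot_avg q e (x + X (t n) \<omega>))"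
      by (simp only: occupation_pot_avg(1)[OF q e])
  qed
  finally show ?thesis .
qed

section \<open>Grid times, the first grid visit to a ball, and the occupation split there\<close>

definition grid_time :: "real \<Rightarrow> nat \<Rightarrow> nat \<Rightarrow> real" where
  "grid_time t n j = real j * t / real (Suc n)"

text \<open>The alternative \<open>j = Suc n\<close> stops the search at the horizon, whose grid
  time is \<open>t\<close>. That value is ambiguous between no visit and a visit at \<open>t\<close>
  itself, which \<open>grid_avoid\<close> tells apart. The shift \<open>r\<close> serves to restart
  at a small positive time when regularity of zero is proved.\<close>

definition hit_index :: "real \<Rightarrow> real \<Rightarrow> real \<Rightarrow> real \<Rightarrow> nat \<Rightarrow> 'a \<Rightarrow> nat" where
  "hit_index x r t e n \<omega> = (LEAST j. j = Suc n \<or> \<bar>x + X (r + grid_time t n j) \<omega>\<bar> < e)"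

definition grid_avoid :: "real \<Rightarrow> real \<Rightarrow> real \<Rightarrow> real \<Rightarrow> nat \<Rightarrow> 'a set" where
  "grid_avoid x r t e n = {\<omega>\<in>space M. \<forall>j\<le>Suc n. e \<le> \<bar>x + X (r + grid_time t n j) \<omega>\<bar>}"

lemma grid_time_nonneg: "0 \<le> t \<Longrightarrow> 0 \<le> grid_time t n j"
  by (simp add: grid_time_def)

lemma grid_time_mono: "0 \<le> t \<Longrightarrow> i \<le> j \<Longrightarrow> grid_time t n i \<le> grid_time t n j"
  by (simp add: grid_time_def divide_right_mono mult_right_mono)

lemma grid_time_Suc_n [simp]: "grid_time t n (Suc n) = t"
  by (simp add: grid_time_def)

lemma hit_index_eq_iff:
  "hit_index x r t e n \<omega> = j \<longleftrightarrow> j \<le> Suc n \<and> (\<forall>k<j. e \<le> \<bar>x + X (r + grid_time t n k) \<omega>\<bar>) \<and>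
     (j = Suc n \<or> \<bar>x + X (r + grid_time t n j) \<omega>\<bar> < e)"
  (is "_ = j \<longleftrightarrow> ?R j")
proof -
  let ?P = "\<lambda>j. j = Suc n \<or> \<bar>x + X (r + grid_time t n j) \<omega>\<bar> < e"
  have "?R (hit_index x r t e n \<omega>)"
    unfolding hit_index_def
  proof (intro conjI allI impI)
    show "(LEAST j. ?P j) \<le> Suc n" by (rule Least_le) simp
    show "?P (LEAST j. ?P j)" by (rule LeastI[of ?P "Suc n"]) simp
    show "e \<le> \<bar>x + X (r + grid_time t n k) \<omega>\<bar>" if "k < (LEAST j. ?P j)" for k
      using not_less_Least[OF that] by simp
  qed
  moreover have "i = j" if "?R i" "?R j" for i j
    using that by (metis le_neq_implies_less linorder_neqE_nat not_le order_less_le_trans)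
  ultimately show ?thesis by blast
qed

lemma hit_index_le: "hit_index x r t e n \<omega> \<le> Suc n"
  using hit_index_eq_iff by blast

lemma hit_index_measurable [measurable]:
  assumes "0 \<le> r" "0 \<le> t"
  shows "hit_index x r t e n \<in> M \<rightarrow>\<^sub>M count_space UNIV"
proof -
  have [measurable]: "X (r + grid_time t n j) \<in> borel_measurable M" for j
    using assms by (intro X_measurable) (simp add: grid_time_nonneg)
  show ?thesis unfolding hit_index_def[abs_def] by measurable
qed

lemma grid_avoid_sets [measurable]:
  assumes "0 \<le> r" "0 \<le> t"
  shows "grid_avoid x r t e n \<in> sets M"
proof -
  have [measurable]: "X (r + grid_time t n j) \<in> borel_measurable M" for j
    using assms by (intro X_measurable) (simp add: grid_time_nonneg)
  show ?thesis unfolding grid_avoid_def by measurable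
qed

text \<open>The discounted time near zero before the first visit seen by the grid, that is, the
  occupation missed by the discretisation.\<close>

definition grid_err :: "real \<Rightarrow> real \<Rightarrow> real \<Rightarrow> real \<Rightarrow> real \<Rightarrow> nat \<Rightarrow> 'a \<Rightarrow> ennreal" where
  "grid_err q x r t e n \<omega> = (\<integral>\<^sup>+s. ennreal (indicator {0..} s * exp (- (q * s))) *
     indicator {-e<..<e} (x + X (r + max s 0) \<omega>) * indicator {..<grid_time t n (hit_index x r t e n \<omega>)} s \<partial>lborel)"

text \<open>The occupation is cut at the first grid visit. Translating time in the second part
  produces the discount factor; as the index takes finitely many values, each decided by the grid
  path up to it, the Markov property at fixed times handles them one by one.\<close>

lemma grid_decomposition:
  assumes q: "q > 0" and e: "e > 0" and r: "0 \<le> r" and t: "0 \<le> t"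
  shows "(\<integral>\<^sup>+\<omega>. ennreal (2 * e * pot_avg q e (x + X r \<omega>)) \<partial>M) =
    (\<integral>\<^sup>+\<omega>. grid_err q x r t e n \<omega> \<partial>M) +
    (\<integral>\<^sup>+\<omega>. ennreal (exp (- (q * grid_time t n (hit_index x r t e n \<omega>)))) *
       ennreal (2 * e * pot_avg q e (x + X (r + grid_time t n (hit_index x r t e n \<omega>)) \<omega>)) \<partial>M)"
proof -
  let ?g = "\<lambda>s. ennreal (indicator {0..} s * exp (- (q * s)))"
  let ?\<sigma> = "hit_index x r t e n"
  let ?T = "grid_time t n"
  let ?path = "\<lambda>j \<omega>. \<lambda>i\<in>{..j}. X (r + ?T i) \<omega>"
  let ?U = "\<lambda>j \<omega>. ennreal (2 * e * pot_avg q e (x + X (r + ?T j) \<omega>))"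
  let ?E = "\<lambda>j. ennreal (exp (- (q * ?T j)))"
  define W where "W d \<omega> = (\<integral>\<^sup>+s. ?g s * indicator {-e<..<e} (x + X (r + d + max s 0) \<omega>) \<partial>lborel)" for d \<omega>
  have T[simp]: "0 \<le> ?T j" for j using t by (rule grid_time_nonneg)
  have \<sigma>[measurable]: "?\<sigma> \<in> M \<rightarrow>\<^sub>M count_space UNIV" using r t by (rule hit_index_measurable)
  have Xm[measurable]: "(\<lambda>z. X (r + d + max (fst z) 0) (snd z)) \<in> borel_measurable (lborel \<Otimes>\<^sub>M M)" if "d \<ge> 0" for d
    using r that by (intro measurable_X_compose) auto
  have Xm'[measurable]: "(\<lambda>z. X (r + d + max (snd z) 0) (fst z)) \<in> borel_measurable (M \<Otimes>\<^sub>M lborel)" if "d \<ge> 0" for d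
    using r that by (intro measurable_X_compose) auto
  have Xs: "(\<lambda>s. X (r + d + max s 0) \<omega>) \<in> borel_measurable lborel" if "d \<ge> 0" "\<omega> \<in> space M" for d \<omega>
    using measurable_compose[OF measurable_Pair2'[of \<omega> M lborel, OF that(2)] Xm[OF that(1)]] by simp
  have X1[measurable]: "X (r + ?T j) \<in> borel_measurable M" for j using r by (intro X_measurable) simp
  have Wm[measurable]: "W d \<in> borel_measurable M" if "d \<ge> 0" for d
    unfolding W_def[abs_def] using Xm'[OF that] by (intro lborel.borel_measurable_nn_integral) (simp add: split_beta')
  have em: "grid_err q x r t e n \<in> borel_measurable M"
    unfolding grid_err_def[abs_def] using Xm'[of 0]
    by (intro lborel.borel_measurable_nn_integral) (simp add: split_beta')
  \<comment> \<open>With a single grid point and the trivial event, \<open>markov_occupation\<close>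
    gives the plain expectation at time \<open>r\<close>.\<close>
  have sp: "space (PiM {..0 :: nat} (\<lambda>_. borel :: real measure)) \<in> sets (PiM {..0 :: nat} (\<lambda>_. borel))" by simp
  have "(\<integral>\<^sup>+\<omega>. ennreal (2 * e * pot_avg q e (x + X r \<omega>)) \<partial>M) = (\<integral>\<^sup>+\<omega>. W 0 \<omega> \<partial>M)"
    using markov_occupation[OF q e _ _ sp, of "\<lambda>_. r" x] r
    by (simp add: W_def space_PiM)
  also have "\<dots> = (\<integral>\<^sup>+\<omega>. grid_err q x r t e n \<omega> + ?E (?\<sigma> \<omega>) * W (?T (?\<sigma> \<omega>)) \<omega> \<partial>M)"
  proof (intro nn_integral_cong)
    fix \<omega> assume \<omega>: "\<omega> \<in> space M"
    define d where "d = ?T (?\<sigma> \<omega>)"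
    have d: "d \<ge> 0" by (simp add: d_def)
    note [measurable] = Xs[OF d \<omega>] Xs[OF order_refl \<omega>, simplified]
    let ?F = "\<lambda>s. ?g s * indicator {-e<..<e} (x + X (r + max s 0) \<omega>)"
    have "W 0 \<omega> = (\<integral>\<^sup>+s. ?F s * indicator {..<d} s + ?F s * indicator {d..} s \<partial>lborel)"
      unfolding W_def by (intro nn_integral_cong) (auto simp: indicator_def)
    also have "\<dots> = (\<integral>\<^sup>+s. ?F s * indicator {..<d} s \<partial>lborel) + (\<integral>\<^sup>+s. ?F s * indicator {d..} s \<partial>lborel)"
      by (rule nn_integral_add) measurable
    also have "(\<integral>\<^sup>+s. ?F s * indicator {..<d} s \<partial>lborel) = grid_err q x r t e n \<omega>"
      by (simp add: grid_err_def d_def)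
    also have "(\<integral>\<^sup>+s. ?F s * indicator {d..} s \<partial>lborel) = (\<integral>\<^sup>+s. ?F (d + 1 * s) * indicator {d..} (d + 1 * s) \<partial>lborel)"
      by (subst nn_integral_real_affine[where c=1 and t=d]) auto
    also have "\<dots> = (\<integral>\<^sup>+s. ennreal (exp (- (q * d))) * (?g s * indicator {-e<..<e} (x + X (r + d + max s 0) \<omega>)) \<partial>lborel)"
    proof (intro nn_integral_cong)
      fix s :: real
      show "?F (d + 1 * s) * indicator {d..} (d + 1 * s) = ennreal (exp (- (q * d))) * (?g s * indicator {-e<..<e} (x + X (r + d + max s 0) \<omega>))"
      proof (cases "s \<ge> 0")
        case True
        have "ennreal (exp (- (q * (d + s)))) = ennreal (exp (- (q * d))) * ennreal (exp (- (q * s)))"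
          by (simp add: ennreal_mult'[symmetric] exp_add[symmetric] algebra_simps)
        then show ?thesis using True d by (simp add: mult.assoc add.assoc)
      qed simp
    qed
    also have "\<dots> = ennreal (exp (- (q * d))) * W d \<omega>"
      unfolding W_def by (intro nn_integral_cmult) measurable
    finally show "W 0 \<omega> = grid_err q x r t e n \<omega> + ?E (?\<sigma> \<omega>) * W (?T (?\<sigma> \<omega>)) \<omega>"
      by (simp add: d_def)
  qed
  also have "\<dots> = (\<integral>\<^sup>+\<omega>. grid_err q x r t e n \<omega> \<partial>M) + (\<integral>\<^sup>+\<omega>. ?E (?\<sigma> \<omega>) * W (?T (?\<sigma> \<omega>)) \<omega> \<partial>M)"
  proof (rule nn_integral_add[OF em])
    show "(\<lambda>\<omega>. ?E (?\<sigma> \<omega>) * W (?T (?\<sigma> \<omega>)) \<omega>) \<in> borel_measurable M"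
      by (rule measurable_compose_countable[where f="\<lambda>j \<omega>. ?E j * W (?T j) \<omega>" and g="?\<sigma>"]) measurable
  qed
  also have "(\<integral>\<^sup>+\<omega>. ?E (?\<sigma> \<omega>) * W (?T (?\<sigma> \<omega>)) \<omega> \<partial>M) =
    (\<integral>\<^sup>+\<omega>. ?E (?\<sigma> \<omega>) * ?U (?\<sigma> \<omega>) \<omega> \<partial>M)"
  proof -
    \<comment> \<open>The event that the first grid visit has index \<open>j\<close>, written as a
      set of grid paths up to \<open>j\<close>: no later coordinate enters.\<close>
    define A where "A j = {v \<in> space (PiM {..j} (\<lambda>_. borel :: real measure)). (\<forall>k<j. e \<le> \<bar>x + v k\<bar>) \<and> (j = Suc n \<or> \<bar>x + v j\<bar> < e)}" for j
    have comp[measurable]: "(\<lambda>v. v k) \<in> PiM {..j} (\<lambda>_. borel) \<rightarrow>\<^sub>M (borel :: real measure)" if "k \<le> j" for k j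
      using that by (intro measurable_component_singleton) auto
    have A[measurable]: "A j \<in> sets (PiM {..j} (\<lambda>_. borel))" for j
    proof -
      have "A j = {v \<in> space (PiM {..j} (\<lambda>_. borel :: real measure)). (\<forall>k\<in>{..<j}. e \<le> \<bar>x + v k\<bar>) \<and> (j = Suc n \<or> \<bar>x + v j\<bar> < e)}"
        by (auto simp: A_def)
      also have "\<dots> \<in> sets (PiM {..j} (\<lambda>_. borel))"
        by (intro sets.sets_Collect_conj sets.sets_Collect_finite_All sets.sets_Collect_disj) (auto intro!: comp)
      finally show ?thesis .
    qed
    have path[measurable]: "?path j \<in> M \<rightarrow>\<^sub>M PiM {..j} (\<lambda>_. borel)" for j
      by (intro measurable_restrict X1)
    have ind: "indicator (A j) (?path j \<omega>) = (indicator {?\<sigma> \<omega>} j :: ennreal)" if "j \<le> Suc n" for j \<omega>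
      using that hit_index_eq_iff[of x r t e n \<omega> j] by (auto simp: A_def indicator_def space_PiM)
    \<comment> \<open>Exactly one summand survives, which turns evaluation at a random index into a
      finite sum over fixed indices.\<close>
    have select: "F (?\<sigma> \<omega>) = (\<Sum>j\<le>Suc n. indicator (A j) (?path j \<omega>) * F j)" for F :: "nat \<Rightarrow> ennreal" and \<omega>
    proof -
      have "(\<Sum>j\<le>Suc n. indicator (A j) (?path j \<omega>) * F j) = (\<Sum>j\<le>Suc n. indicator {?\<sigma> \<omega>} j * F j)"
        by (intro sum.cong refl) (simp add: ind)
      also have "\<dots> = (\<Sum>j\<in>{?\<sigma> \<omega>}. F j)"
        using hit_index_le[of x r t e n \<omega>] by (intro sum.mono_neutral_cong_right) (auto simp: indicator_def)
      finally show ?thesis by simp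
    qed
    have Wj: "(\<integral>\<^sup>+\<omega>. indicator (A j) (?path j \<omega>) * W (?T j) \<omega> \<partial>M) =
       (\<integral>\<^sup>+\<omega>. indicator (A j) (?path j \<omega>) * ?U j \<omega> \<partial>M)" for j
    proof -
      have 0: "0 \<le> r + ?T 0" using r by simp
      have S: "r + ?T i \<le> r + ?T (Suc i)" for i by (simp add: grid_time_mono[OF t])
      show ?thesis
        unfolding W_def
        by (rule markov_occupation[where t="\<lambda>i. r + ?T i" and n=j and A="A j" and x=x, OF q e 0 S A])
    qed
    have pm[measurable]: "?U j \<in> borel_measurable M" for j
      by (intro measurable_compose[OF _ measurable_ennreal] borel_measurable_times borel_measurable_const
          measurable_compose[OF _ pot_avg_measurable[OF q]] borel_measurable_add X1)
    have "(\<integral>\<^sup>+\<omega>. ?E (?\<sigma> \<omega>) * W (?T (?\<sigma> \<omega>)) \<omega> \<partial>M) =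
      (\<integral>\<^sup>+\<omega>. (\<Sum>j\<le>Suc n. ?E j * (indicator (A j) (?path j \<omega>) * W (?T j) \<omega>)) \<partial>M)"
    proof (rule nn_integral_cong)
      fix \<omega>
      show "?E (?\<sigma> \<omega>) * W (?T (?\<sigma> \<omega>)) \<omega> =
        (\<Sum>j\<le>Suc n. ?E j * (indicator (A j) (?path j \<omega>) * W (?T j) \<omega>))"
        using select[of "\<lambda>j. ?E j * W (?T j) \<omega>" \<omega>] by (simp only: mult_ac)
    qed
    also have "\<dots> = (\<Sum>j\<le>Suc n. \<integral>\<^sup>+\<omega>. ?E j * (indicator (A j) (?path j \<omega>) * W (?T j) \<omega>) \<partial>M)"
      by (rule nn_integral_sum) measurable
    also have "\<dots> = (\<Sum>j\<le>Suc n. \<integral>\<^sup>+\<omega>. ?E j * (indicator (A j) (?path j \<omega>) * ?U j \<omega>) \<partial>M)"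
    proof (rule sum.cong[OF refl])
      fix j
      have m1: "(\<lambda>\<omega>. indicator (A j) (?path j \<omega>) * W (?T j) \<omega>) \<in> borel_measurable M"
        by (intro borel_measurable_times_ennreal Wm T measurable_compose[OF path borel_measurable_indicator] A)
      have m2: "(\<lambda>\<omega>. indicator (A j) (?path j \<omega>) * ?U j \<omega>) \<in> borel_measurable M"
        by (intro borel_measurable_times_ennreal pm measurable_compose[OF path borel_measurable_indicator] A)
      show "(\<integral>\<^sup>+\<omega>. ?E j * (indicator (A j) (?path j \<omega>) * W (?T j) \<omega>) \<partial>M) =
        (\<integral>\<^sup>+\<omega>. ?E j * (indicator (A j) (?path j \<omega>) * ?U j \<omega>) \<partial>M)"
        unfolding nn_integral_cmult[OF m1] nn_integral_cmult[OF m2] Wj ..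
    qed
    also have "\<dots> = (\<integral>\<^sup>+\<omega>. (\<Sum>j\<le>Suc n. ?E j * (indicator (A j) (?path j \<omega>) * ?U j \<omega>)) \<partial>M)"
      by (rule nn_integral_sum[symmetric]) measurable
    also have "\<dots> = (\<integral>\<^sup>+\<omega>. ?E (?\<sigma> \<omega>) * ?U (?\<sigma> \<omega>) \<omega> \<partial>M)"
    proof (rule nn_integral_cong)
      fix \<omega>
      show "(\<Sum>j\<le>Suc n. ?E j * (indicator (A j) (?path j \<omega>) * ?U j \<omega>)) =
        ?E (?\<sigma> \<omega>) * ?U (?\<sigma> \<omega>) \<omega>"
        using select[of "\<lambda>j. ?E j * ?U j \<omega>" \<omega>] by (simp only: mult_ac)
    qed
    finally show ?thesis .
  qed
  finally show ?thesis .
qed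

end

section \<open>Passage to the limit in the grid\<close>

context levy_symbol
begin

lemma nn_integral_exp_weight:
  assumes q: "q > 0"
  shows "(\<integral>\<^sup>+s. ennreal (indicator {0..} s * exp (- (q * s))) \<partial>lborel) = ennreal (1 / q)"
proof -
  interpret L: real_distribution "exp_law q" using q by (rule real_distribution_exp_law)
  have "measure (exp_law q) UNIV = 1" using L.prob_space by (simp add: sets_eq_imp_space_eq[OF L.events_eq_borel])
  then show ?thesis using nn_integral_exp_law[OF q, of UNIV] emeasure_space_1 by simp
qed

definition avoid :: "real \<Rightarrow> real \<Rightarrow> real \<Rightarrow> real \<Rightarrow> 'a set" where
  "avoid x r t e = {\<omega>\<in>space M. \<forall>s\<in>{0..t}. e \<le> \<bar>x + X (r + s) \<omega>\<bar>}"

text \<open>Positive distance from zero on all of \<open>[0, t]\<close>, which is more than not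
  vanishing there, since a left limit may be zero. The grids lead to this event;
  \<open>AE_killed_eval\<close> compares it with the killing event.\<close>

definition avoid_zero :: "real \<Rightarrow> real \<Rightarrow> real \<Rightarrow> 'a set" where
  "avoid_zero x r t = (\<Union>m. avoid x r t (1 / Suc m))"

lemma ball_right_neighbourhood:
  assumes "0 \<le> r" "0 \<le> s" "\<bar>x + X (r + s) \<omega>\<bar> < e"
  shows "\<exists>b>s. \<forall>u. s \<le> u \<longrightarrow> u < b \<longrightarrow> \<bar>x + X (r + u) \<omega>\<bar> < e"
proof -
  have "((\<lambda>u. \<bar>x + X u \<omega>\<bar>) \<longlongrightarrow> \<bar>x + X (r + s) \<omega>\<bar>) (at_right (r + s))"
    using assms by (intro tendsto_intros X_right_continuous) auto
  then have "\<forall>\<^sub>F u in at_right (r + s). \<bar>x + X u \<omega>\<bar> < e"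
    using assms(3) by (rule order_tendstoD(2))
  then obtain b where b: "b > r + s" "\<And>u. r + s < u \<Longrightarrow> u < b \<Longrightarrow> \<bar>x + X u \<omega>\<bar> < e"
    unfolding eventually_at_right_field by blast
  show ?thesis
  proof (intro exI[of _ "b - r"] conjI allI impI)
    fix u assume u: "s \<le> u" "u < b - r"
    show "\<bar>x + X (r + u) \<omega>\<bar> < e"
      using assms(3) b(2)[of "r + u"] u by (cases "u = s") auto
  qed (use b in auto)
qed

text \<open>By right continuity a visit to the open ball lasts for a positive time, so a fine grid
  sees it; the gap \<open>s < s'\<close> leaves room for the grid point.\<close>

lemma eventually_grid_hit:
  assumes "0 \<le> r" "0 \<le> s" "\<bar>x + X (r + s) \<omega>\<bar> < e" "s < s'" "s' \<le> t"
  shows "\<forall>\<^sub>F n in sequentially. \<exists>j. grid_time t n j < s' \<and> \<bar>x + X (r + grid_time t n j) \<omega>\<bar> < e"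
proof -
  obtain b where b: "b > s" "\<And>u. s \<le> u \<Longrightarrow> u < b \<Longrightarrow> \<bar>x + X (r + u) \<omega>\<bar> < e"
    using ball_right_neighbourhood[OF assms(1-3)] by blast
  have "\<forall>\<^sub>F n in sequentially. \<exists>j :: nat. s \<le> real j * t / real (Suc n) \<and> real j * t / real (Suc n) < min b s'"
    using assms b by (intro eventually_grid_point) auto
  then show ?thesis
    by eventually_elim (use b in \<open>auto simp: grid_time_def simp del: of_nat_Suc\<close>)
qed

lemma grid_time_less_imp:
  assumes "grid_time t n j < grid_time t n k" "0 \<le> t"
  shows "j < k"
  using assms grid_time_mono[of t k j n] by (meson leD not_le)

lemma eventually_not_grid_avoid:
  assumes "0 \<le> r" "0 \<le> t" "\<omega> \<in> space M" "\<omega> \<notin> avoid x r t e"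
  shows "\<forall>\<^sub>F n in sequentially. \<omega> \<notin> grid_avoid x r t e n"
proof -
  obtain s where s: "0 \<le> s" "s \<le> t" "\<bar>x + X (r + s) \<omega>\<bar> < e"
    using assms by (auto simp: avoid_def not_le)
  show ?thesis
  \<comment> \<open>A visit exactly at the horizon has no room to its right within the grid, but
    \<open>t\<close> is itself the last grid point.\<close>
  proof (cases "s = t")
    case True
    then have "\<omega> \<notin> grid_avoid x r t e n" for n
      using s by (auto simp: grid_avoid_def not_le intro!: exI[of _ "Suc n"])
    then show ?thesis by simp
  next
    case False
    then have "s < t" using s by simp
    from eventually_grid_hit[OF assms(1) s(1,3) this order_refl] show ?thesis
    proof eventually_elim
      case (elim n)
      then obtain j where j: "grid_time t n j < t" "\<bar>x + X (r + grid_time t n j) \<omega>\<bar> < e" by blast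
      then have "j < Suc n" using grid_time_less_imp[of t n j "Suc n"] assms by simp
      then show ?case using j by (auto simp: grid_avoid_def not_le intro!: exI[of _ j])
    qed
  qed
qed

lemma avoid_subset_grid_avoid:
  assumes "0 \<le> t"
  shows "avoid x r t e \<subseteq> grid_avoid x r t e n"
proof
  fix \<omega> assume \<omega>: "\<omega> \<in> avoid x r t e"
  have "grid_time t n j \<in> {0..t}" if "j \<le> Suc n" for j
    using grid_time_mono[OF assms that, of n] grid_time_nonneg[OF assms, of n j] by simp
  then show "\<omega> \<in> grid_avoid x r t e n"
    using \<omega> by (auto simp: avoid_def grid_avoid_def)
qed

lemma indicator_grid_avoid_tendsto:
  assumes "0 \<le> r" "0 \<le> t" "\<omega> \<in> space M"
  shows "(\<lambda>n. indicator (grid_avoid x r t e n) \<omega> :: real) \<longlonglongrightarrow> indicator (avoid x r t e) \<omega>"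
proof (cases "\<omega> \<in> avoid x r t e")
  case True
  then show ?thesis using avoid_subset_grid_avoid[OF assms(2), of x r e] by (simp add: subset_iff)
next
  case False
  show ?thesis
    by (rule tendsto_eventually, use eventually_not_grid_avoid[OF assms False] in eventually_elim)
       (simp add: False)
qed

text \<open>The condition concerns uncountably many times; right continuity makes the event a
  countable intersection of grid events.\<close>

lemma avoid_sets [measurable]:
  assumes "0 \<le> r" "0 \<le> t"
  shows "avoid x r t e \<in> sets M"
proof -
  have "avoid x r t e = (\<Inter>n. grid_avoid x r t e n)"
  proof (intro antisym subsetI)
    fix \<omega> assume *: "\<omega> \<in> (\<Inter>n. grid_avoid x r t e n)"
    then have "\<omega> \<in> space M" by (auto simp: grid_avoid_def)
    then show "\<omega> \<in> avoid x r t e"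
      using * eventually_not_grid_avoid[OF assms, of \<omega> x e] by (auto simp: eventually_sequentially)
  qed (use avoid_subset_grid_avoid[OF assms(2)] in blast)
  also have "\<dots> \<in> sets M" using grid_avoid_sets[OF assms] by blast
  finally show ?thesis .
qed

lemma avoid_zero_sets [measurable]: "0 \<le> r \<Longrightarrow> 0 \<le> t \<Longrightarrow> avoid_zero x r t \<in> sets M"
  unfolding avoid_zero_def by (intro sets.countable_UN) (auto intro: avoid_sets)

lemma indicator_avoid_tendsto:
  "(\<lambda>m. indicator (avoid x r t (1 / Suc m)) \<omega> :: real) \<longlonglongrightarrow> indicator (avoid_zero x r t) \<omega>"
proof -
  have "incseq (\<lambda>m. avoid x r t (1 / Suc m))"
  proof (rule incseq_SucI)
    fix m
    have "1 / real (Suc (Suc m)) \<le> 1 / real (Suc m)" by (simp add: field_simps)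
    then show "avoid x r t (1 / Suc m) \<subseteq> avoid x r t (1 / Suc (Suc m))"
      unfolding avoid_def by (blast intro: order_trans)
  qed
  then show ?thesis unfolding avoid_zero_def by (rule LIMSEQ_indicator_incseq)
qed

lemma grid_err_bound:
  assumes q: "q > 0"
  shows "grid_err q x r t e n \<omega> \<le> ennreal (1 / q)"
proof -
  have "grid_err q x r t e n \<omega> \<le> (\<integral>\<^sup>+s. ennreal (indicator {0..} s * exp (- (q * s))) \<partial>lborel)"
    unfolding grid_err_def
    by (intro nn_integral_mono) (auto simp: indicator_def)
  then show ?thesis using nn_integral_exp_weight[OF q] by simp
qed

lemma X_shift_measurable:
  assumes "0 \<le> r"
  shows "(\<lambda>z. X (r + max (snd z) 0) (fst z)) \<in> borel_measurable (M \<Otimes>\<^sub>M lborel)"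
  using assms by (intro measurable_X_compose) auto

lemma X_path_measurable:
  assumes "0 \<le> r" "\<omega> \<in> space M"
  shows "(\<lambda>s. X (r + max s 0) \<omega>) \<in> borel_measurable lborel"
  using measurable_compose[OF measurable_Pair1'[of \<omega> M lborel, OF assms(2)] X_shift_measurable[OF assms(1)]] by simp

lemma grid_err_measurable:
  assumes "0 \<le> r" "0 \<le> t"
  shows "grid_err q x r t e n \<in> borel_measurable M"
proof -
  note [measurable] = X_shift_measurable[OF assms(1)] hit_index_measurable[OF assms]
  have [measurable]: "(\<lambda>\<omega>. grid_time t n (hit_index x r t e n \<omega>)) \<in> borel_measurable M"
    by (rule measurable_compose[OF hit_index_measurable[OF assms]]) simp
  show ?thesis
    unfolding grid_err_def[abs_def]
    by (intro lborel.borel_measurable_nn_integral) (simp add: split_beta' indicator_def[of "{..<_}"] lessThan_iff)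
qed

text \<open>For a fixed path, a time \<open>s\<close> can contribute to infinitely many of the errors only if the path
  is near zero at \<open>s\<close> but at no earlier time; there is at most one such \<open>s\<close>.\<close>

lemma grid_err_tendsto_0:
  assumes q: "q > 0" and r: "0 \<le> r" and t: "0 \<le> t" and \<omega>: "\<omega> \<in> space M"
  shows "(\<lambda>n. grid_err q x r t e n \<omega>) \<longlonglongrightarrow> 0"
proof -
  let ?g = "\<lambda>s. ennreal (indicator {0..} s * exp (- (q * s)))"
  let ?T = "\<lambda>n. grid_time t n (hit_index x r t e n \<omega>)"
  define S where "S = {s. 0 \<le> s \<and> \<bar>x + X (r + s) \<omega>\<bar> < e \<and> (\<exists>\<^sub>\<infinity>n. s < ?T n)}"
  have no_pair: False if "s \<in> S" "s' \<in> S" "s < s'" for s s'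
  proof -
    have s: "0 \<le> s" "\<bar>x + X (r + s) \<omega>\<bar> < e" using that by (auto simp: S_def)
    have Tt: "?T n \<le> t" for n using grid_time_mono[OF t hit_index_le[of x r t e n \<omega>], of n] by simp
    have freq: "\<exists>\<^sub>F n in sequentially. s' < ?T n"
      using that by (simp add: S_def cofinite_eq_sequentially)
    then obtain n where "s' < ?T n" by (auto dest: frequently_ex)
    then have "s' \<le> t" using Tt[of n] by simp
    have "\<forall>\<^sub>F n in sequentially. \<not> s' < ?T n"
      using eventually_grid_hit[OF r s that(3) \<open>s' \<le> t\<close>]
    proof eventually_elim
      case (elim n)
      then obtain j where j: "grid_time t n j < s'" "\<bar>x + X (r + grid_time t n j) \<omega>\<bar> < e" by blast
      show ?case
      proof
        assume "s' < ?T n"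
        then have "j < hit_index x r t e n \<omega>"
          using j(1) by (intro grid_time_less_imp[of t n j, OF _ t]) simp
        then have "e \<le> \<bar>x + X (r + grid_time t n j) \<omega>\<bar>"
          using hit_index_eq_iff[of x r t e n \<omega> "hit_index x r t e n \<omega>"] by blast
        then show False using j(2) by simp
      qed
    qed
    then show False using freq by (simp add: frequently_def)
  qed
  have "AE s in lborel. s \<notin> S"
  proof (cases "S = {}")
    case False
    then obtain p where "p \<in> S" by blast
    then have "S = {p}" using no_pair by (metis insertI1 insert_absorb is_singletonI' is_singleton_def linorder_neqE_linordered_idom singleton_iff)
    then show ?thesis using AE_lborel_singleton[of p] by simp
  qed simp
  note [measurable] = X_path_measurable[OF r \<omega>]
  have "(\<lambda>n. \<integral>\<^sup>+s. ?g s * indicator {-e<..<e} (x + X (r + max s 0) \<omega>) * indicator {..<?T n} s \<partial>lborel) \<longlonglongrightarrow> (\<integral>\<^sup>+s. 0 \<partial>(lborel :: real measure))"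
  proof (rule nn_integral_dominated_convergence[where w="?g"])
    show "(\<integral>\<^sup>+s. ?g s \<partial>lborel) < \<infinity>" using nn_integral_exp_weight[OF q] by simp
    show "AE s in lborel. (\<lambda>n. ?g s * indicator {-e<..<e} (x + X (r + max s 0) \<omega>) * indicator {..<?T n} s) \<longlonglongrightarrow> 0"
      using \<open>AE s in lborel. s \<notin> S\<close>
    proof eventually_elim
      case (elim s)
      then consider "s < 0" | "s \<ge> 0" "\<not> \<bar>x + X (r + s) \<omega>\<bar> < e" | "\<forall>\<^sub>F n in sequentially. \<not> s < ?T n"
        by (fastforce simp: S_def cofinite_eq_sequentially frequently_def)
      then show ?case
      proof cases
        case 3
        then have "\<forall>\<^sub>F n in sequentially. ?g s * indicator {-e<..<e} (x + X (r + max s 0) \<omega>) * indicator {..<?T n} s = 0"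
          by eventually_elim simp
        then show ?thesis by (rule tendsto_eventually)
      qed (auto simp: max_absorb1 indicator_def abs_less_iff)
    qed
  qed (auto simp: indicator_def)
  then show ?thesis by (simp add: grid_err_def)
qed

lemma expected_grid_err_tendsto_0:
  assumes q: "q > 0" and r: "0 \<le> r" and t: "0 \<le> t"
  shows "(\<lambda>n. enn2real (\<integral>\<^sup>+\<omega>. grid_err q x r t e n \<omega> \<partial>M)) \<longlonglongrightarrow> 0"
proof -
  have "(\<lambda>n. \<integral>\<^sup>+\<omega>. grid_err q x r t e n \<omega> \<partial>M) \<longlonglongrightarrow> (\<integral>\<^sup>+\<omega>. 0 \<partial>M)"
  proof (rule nn_integral_dominated_convergence[where w="\<lambda>_. ennreal (1 / q)"])
    show "(\<integral>\<^sup>+\<omega>. ennreal (1 / q) \<partial>M) < \<infinity>" by (simp add: emeasure_space_1)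
  qed (use grid_err_measurable[OF r t] grid_err_bound[OF q] grid_err_tendsto_0[OF q r t] in auto)
  then have "(\<lambda>n. \<integral>\<^sup>+\<omega>. grid_err q x r t e n \<omega> \<partial>M) \<longlonglongrightarrow> ennreal 0" by simp
  from tendsto_enn2real[OF this] show ?thesis by simp
qed

lemma expected_grid_err_finite:
  assumes q: "q > 0"
  shows "(\<integral>\<^sup>+\<omega>. grid_err q x r t e n \<omega> \<partial>M) \<noteq> \<infinity>"
proof -
  have "(\<integral>\<^sup>+\<omega>. grid_err q x r t e n \<omega> \<partial>M) \<le> (\<integral>\<^sup>+\<omega>. ennreal (1 / q) \<partial>M)"
    by (intro nn_integral_mono grid_err_bound[OF q])
  also have "\<dots> < \<infinity>" by (simp add: emeasure_space_1)
  finally show ?thesis by simp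
qed

text \<open>The limiting payoff after stopping: off \<open>A\<close> the process is at zero and is
  worth \<open>pot q 0\<close>; on \<open>A\<close> it has survived to time \<open>t\<close> with
  discount \<open>c\<close>, which will be \<open>exp (- (q * t))\<close> or 1.\<close>

definition hit_mix :: "real \<Rightarrow> real \<Rightarrow> real \<Rightarrow> real \<Rightarrow> real \<Rightarrow> 'a set \<Rightarrow> real" where
  "hit_mix q x r t c A =
     (LINT \<omega>|M. indicator A \<omega> * (c * pot q (x + X (r + t) \<omega>)) + (1 - indicator A \<omega>) * pot q 0)"

lemma pot_X_measurable [measurable]:
  "q > 0 \<Longrightarrow> 0 \<le> r \<Longrightarrow> (\<lambda>\<omega>. pot q (x + X r \<omega>)) \<in> borel_measurable M"
  by (rule measurable_compose[OF _ pot_measurable]) (auto intro!: borel_measurable_add X_measurable)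

lemma hit_mix_bound:
  fixes i :: real
  assumes q: "q > 0" and "0 \<le> i" "i \<le> 1" "0 \<le> c" "c \<le> 1"
  shows "\<bar>i * (c * pot q y) + (1 - i) * pot q 0\<bar> \<le> 2 * pot_bound q"
proof -
  have b: "0 \<le> pot q y" "pot q y \<le> pot_bound q" "0 \<le> pot q 0" "pot q 0 \<le> pot_bound q"
    using pot_bounds(1)[OF q, of y] pot_bounds(1)[OF q, of 0] pot_nonneg[OF q] by auto
  have "i * (c * pot q y) \<le> 1 * (1 * pot_bound q)" using assms b by (intro mult_mono) auto
  moreover have "(1 - i) * pot q 0 \<le> 1 * pot_bound q" using assms b by (intro mult_mono) auto
  moreover have "0 \<le> i * (c * pot q y)" "0 \<le> (1 - i) * pot q 0" using assms b by auto
  ultimately show ?thesis by simp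
qed

lemma hit_mix_tendsto:
  assumes q: "q > 0" and r: "0 \<le> r" and t: "0 \<le> t" and c: "0 \<le> c" "c \<le> 1"
    and A: "\<And>n. A n \<in> sets M" "B \<in> sets M"
    and lim: "\<And>\<omega>. \<omega> \<in> space M \<Longrightarrow> (\<lambda>n. indicator (A n) \<omega> :: real) \<longlonglongrightarrow> indicator B \<omega>"
  shows "(\<lambda>n. hit_mix q x r t c (A n)) \<longlonglongrightarrow> hit_mix q x r t c B"
  unfolding hit_mix_def
proof (rule integral_dominated_convergence[where w="\<lambda>_. 2 * pot_bound q"])
  have [measurable]: "(\<lambda>\<omega>. pot q (x + X (r + t) \<omega>)) \<in> borel_measurable M"
    using q r t by (intro pot_X_measurable) auto
  note [measurable] = A
  show "(\<lambda>\<omega>. indicator B \<omega> * (c * pot q (x + X (r + t) \<omega>)) + (1 - indicator B \<omega>) * pot q 0) \<in> borel_measurable M"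
    by measurable
  show "(\<lambda>\<omega>. indicator (A n) \<omega> * (c * pot q (x + X (r + t) \<omega>)) + (1 - indicator (A n) \<omega>) * pot q 0) \<in> borel_measurable M" for n
    by measurable
  show "AE \<omega> in M. (\<lambda>n. indicator (A n) \<omega> * (c * pot q (x + X (r + t) \<omega>)) + (1 - indicator (A n) \<omega>) * pot q 0)
      \<longlonglongrightarrow> indicator B \<omega> * (c * pot q (x + X (r + t) \<omega>)) + (1 - indicator B \<omega>) * pot q 0"
    by (intro AE_I2 tendsto_intros lim)
  show "AE \<omega> in M. norm (indicator (A n) \<omega> * (c * pot q (x + X (r + t) \<omega>)) + (1 - indicator (A n) \<omega>) * pot q 0) \<le> 2 * pot_bound q" for n
    unfolding real_norm_def by (intro AE_I2 hit_mix_bound q c) auto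
qed simp

lemma hit_mix_integrable:
  assumes q: "q > 0" and r: "0 \<le> r" and t: "0 \<le> t" and c: "0 \<le> c" "c \<le> 1"
    and A[measurable]: "A \<in> sets M"
  shows "integrable M (\<lambda>\<omega>. indicator A \<omega> * (c * pot q (x + X (r + t) \<omega>)) + (1 - indicator A \<omega>) * pot q 0)"
proof (rule integrable_const_bound[where B="2 * pot_bound q"])
  have [measurable]: "(\<lambda>\<omega>. pot q (x + X (r + t) \<omega>)) \<in> borel_measurable M"
    using q r t by (intro pot_X_measurable) auto
  show "(\<lambda>\<omega>. indicator A \<omega> * (c * pot q (x + X (r + t) \<omega>)) + (1 - indicator A \<omega>) * pot q 0) \<in> borel_measurable M"
    by measurable
  show "AE \<omega> in M. norm (indicator A \<omega> * (c * pot q (x + X (r + t) \<omega>)) + (1 - indicator A \<omega>) * pot q 0) \<le> 2 * pot_bound q"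
    unfolding real_norm_def by (intro AE_I2 hit_mix_bound q c) auto
qed

text \<open>The exact decomposition is divided by \<open>2 * e\<close>. Replacing
  \<open>pot_avg\<close> by \<open>pot\<close> at the start costs \<open>\<delta>\<close>, and at
  the stopping point \<open>2 * \<delta>\<close> covers both this and the replacement of
  \<open>pot\<close> near zero by \<open>pot q 0\<close>. Off \<open>D\<close> the unknown discount
  is bounded by 1 for the first claim and from below by \<open>c\<close> for the second.\<close>

lemma grid_bounds:
  fixes x :: real and n :: nat
  assumes q: "q > 0" and e: "e > 0" and r: "0 \<le> r" and t: "0 \<le> t"
    and \<delta>: "pot_err q e \<le> \<delta>" "\<And>y. \<bar>y\<bar> < e \<Longrightarrow> \<bar>pot q y - pot q 0\<bar> \<le> \<delta>"
  defines "c \<equiv> exp (- (q * t))" and "D \<equiv> grid_avoid x r t e n"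
  shows "(LINT \<omega>|M. pot q (x + X r \<omega>)) \<le> hit_mix q x r t c D + enn2real (\<integral>\<^sup>+\<omega>. grid_err q x r t e n \<omega> \<partial>M) / (2 * e) + 3 * \<delta>"
    "c * hit_mix q x r t 1 D \<le> (LINT \<omega>|M. pot q (x + X r \<omega>)) + 3 * \<delta>"
proof -
  let ?L = "LINT \<omega>|M. pot q (x + X r \<omega>)" and ?La = "LINT \<omega>|M. pot_avg q e (x + X r \<omega>)"
  let ?T = "\<lambda>\<omega>. grid_time t n (hit_index x r t e n \<omega>)"
  \<comment> \<open>The discounted averaged potential at the stopping point: the last term of
    \<open>grid_decomposition\<close> without the factor \<open>2 * e\<close>.\<close>
  define V where "V \<omega> = exp (- (q * ?T \<omega>)) * pot_avg q e (x + X (r + ?T \<omega>) \<omega>)" for \<omega>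
  define E where "E = enn2real (\<integral>\<^sup>+\<omega>. grid_err q x r t e n \<omega> \<partial>M)"
  have \<delta>0: "0 \<le> \<delta>" using \<delta>(2)[of 0] e by simp
  have c: "0 \<le> c" "c \<le> 1" using q t by (auto simp: c_def)
  have T: "0 \<le> ?T \<omega>" "?T \<omega> \<le> t" for \<omega>
    using grid_time_nonneg[OF t] grid_time_mono[OF t hit_index_le[of x r t e n \<omega>], of n] by auto
  have pa: "0 \<le> pot_avg q e y" "pot_avg q e y \<le> pot q y + \<delta>" "pot q y - \<delta> \<le> pot_avg q e y" "pot_avg q e y \<le> pot_bound q" for y
    using occupation_pot_avg(2)[OF q e, of y] pot_bounds(3)[OF q, of e y] pot_bounds(2)[OF q, of e y] \<delta>(1) by auto
  have am[measurable]: "(\<lambda>\<omega>. pot_avg q e (x + X d \<omega>)) \<in> borel_measurable M" if "d \<ge> 0" for d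
    by (rule measurable_compose[OF _ pot_avg_measurable[OF q]]) (use that in \<open>auto intro!: borel_measurable_add X_measurable\<close>)
  have Vm: "V \<in> borel_measurable M"
  proof -
    have "(\<lambda>\<omega>. exp (- (q * grid_time t n j)) * pot_avg q e (x + X (r + grid_time t n j) \<omega>)) \<in> borel_measurable M" for j
      using am[of "r + grid_time t n j"] r grid_time_nonneg[OF t, of n j] by (intro borel_measurable_times) auto
    from measurable_compose_countable[OF this hit_index_measurable[OF r t]]
    show ?thesis unfolding V_def[abs_def] .
  qed
  have V0: "0 \<le> V \<omega>" and V1: "V \<omega> \<le> pot_avg q e (x + X (r + ?T \<omega>) \<omega>)" and V2: "c * pot_avg q e (x + X (r + ?T \<omega>) \<omega>) \<le> V \<omega>" for \<omega>
  proof -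
    have "exp (- (q * ?T \<omega>)) \<le> 1" using q T[of \<omega>] by simp
    then show "0 \<le> V \<omega>" "V \<omega> \<le> pot_avg q e (x + X (r + ?T \<omega>) \<omega>)"
      using pa(1) unfolding V_def by (auto intro: mult_left_le_one_le)
    show "c * pot_avg q e (x + X (r + ?T \<omega>) \<omega>) \<le> V \<omega>"
      unfolding V_def c_def using pa(1) q T[of \<omega>] by (intro mult_right_mono) auto
  qed
  have Vint: "integrable M V"
    by (rule integrable_const_bound[where B="pot_bound q"]) (use Vm V0 V1 pa(4) in \<open>auto intro!: AE_I2 intro: order_trans\<close>)
  have aint: "integrable M (\<lambda>\<omega>. pot_avg q e (x + X r \<omega>))"
    by (rule integrable_const_bound[where B="pot_bound q"]) (use am[OF r] pa in auto)
  have pint: "integrable M (\<lambda>\<omega>. pot q (x + X r \<omega>))"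
    by (rule integrable_const_bound[where B="pot_bound q"]) (use pot_X_measurable[OF q r] pot_bounds(1)[OF q] in auto)
  have "ennreal (LINT \<omega>|M. 2 * e * pot_avg q e (x + X r \<omega>)) = ennreal E + ennreal (LINT \<omega>|M. 2 * e * V \<omega>)"
  proof -
    have "ennreal (LINT \<omega>|M. 2 * e * pot_avg q e (x + X r \<omega>)) = (\<integral>\<^sup>+\<omega>. ennreal (2 * e * pot_avg q e (x + X r \<omega>)) \<partial>M)"
      using aint e pa(1) by (intro nn_integral_eq_integral[symmetric]) auto
    also have "\<dots> = (\<integral>\<^sup>+\<omega>. grid_err q x r t e n \<omega> \<partial>M) + (\<integral>\<^sup>+\<omega>. ennreal (2 * e * V \<omega>) \<partial>M)"
    proof -
      have "ennreal (exp (- (q * ?T \<omega>))) * ennreal (2 * e * pot_avg q e (x + X (r + ?T \<omega>) \<omega>)) = ennreal (2 * e * V \<omega>)" for \<omega>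
        by (simp add: ennreal_mult'[symmetric] V_def mult_ac)
      then show ?thesis using grid_decomposition[OF q e r t, of x n] by simp
    qed
    also have "(\<integral>\<^sup>+\<omega>. ennreal (2 * e * V \<omega>) \<partial>M) = ennreal (LINT \<omega>|M. 2 * e * V \<omega>)"
      using Vint e V0 by (intro nn_integral_eq_integral) auto
    also have "(\<integral>\<^sup>+\<omega>. grid_err q x r t e n \<omega> \<partial>M) = ennreal E"
      unfolding E_def using expected_grid_err_finite[OF q, of x r t e n] by (simp add: less_top)
    finally show ?thesis .
  qed
  moreover have "0 \<le> (LINT \<omega>|M. 2 * e * V \<omega>)" "0 \<le> (LINT \<omega>|M. 2 * e * pot_avg q e (x + X r \<omega>))"
    using V0 pa(1) e by (auto intro!: Bochner_Integration.integral_nonneg)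
  moreover have "0 \<le> E" by (simp add: E_def)
  ultimately have "2 * e * ?La = E + 2 * e * (LINT \<omega>|M. V \<omega>)"
    by (simp add: ennreal_plus[symmetric] del: ennreal_plus)
  then have id: "?La = E / (2 * e) + (LINT \<omega>|M. V \<omega>)"
    using e by (simp add: field_simps)
  have ap: "?L \<le> ?La + \<delta>"
    "?La \<le> ?L + \<delta>"
  proof -
    have "?L \<le> (LINT \<omega>|M. pot_avg q e (x + X r \<omega>) + \<delta>)"
      using pint aint pa(3) by (intro integral_mono) (auto simp: diff_le_eq)
    then show "?L \<le> ?La + \<delta>"
      using aint by (simp add: prob_space)
    have "?La \<le> (LINT \<omega>|M. pot q (x + X r \<omega>) + \<delta>)"
      using pint aint pa(2) by (intro integral_mono) auto
    then show "?La \<le> ?L + \<delta>"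
      using pint by (simp add: prob_space)
  qed
  have in_D: "?T \<omega> = t" if "\<omega> \<in> D" for \<omega>
  proof -
    have "hit_index x r t e n \<omega> = Suc n"
      using that by (subst hit_index_eq_iff) (auto simp: D_def grid_avoid_def)
    then show ?thesis by simp
  qed
  have not_in_D: "\<bar>x + X (r + ?T \<omega>) \<omega>\<bar> < e" if "\<omega> \<in> space M" "\<omega> \<notin> D" for \<omega>
  proof (rule ccontr)
    assume far: "\<not> \<bar>x + X (r + ?T \<omega>) \<omega>\<bar> < e"
    have h: "hit_index x r t e n \<omega> = Suc n" "\<forall>k<Suc n. e \<le> \<bar>x + X (r + grid_time t n k) \<omega>\<bar>"
      using hit_index_eq_iff[of x r t e n \<omega> "hit_index x r t e n \<omega>"] far by auto
    then have "\<forall>k\<le>Suc n. e \<le> \<bar>x + X (r + grid_time t n k) \<omega>\<bar>"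
      using far by (auto simp: le_Suc_eq less_Suc_eq_le)
    then show False using that by (simp add: D_def grid_avoid_def)
  qed
  have D[measurable]: "D \<in> sets M" unfolding D_def using r t by (rule grid_avoid_sets)
  have near: "pot_avg q e y \<le> pot q 0 + 2 * \<delta>" "pot q 0 - 2 * \<delta> \<le> pot_avg q e y" if "\<bar>y\<bar> < e" for y
    using \<delta>(2)[OF that] pa(2,3)[of y] by auto
  have "(LINT \<omega>|M. V \<omega>) \<le> (LINT \<omega>|M. (indicator D \<omega> * (c * pot q (x + X (r + t) \<omega>)) + (1 - indicator D \<omega>) * pot q 0) + 2 * \<delta>)"
  proof (rule integral_mono[OF Vint])
    show "integrable M (\<lambda>\<omega>. (indicator D \<omega> * (c * pot q (x + X (r + t) \<omega>)) + (1 - indicator D \<omega>) * pot q 0) + 2 * \<delta>)"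
      by (rule Bochner_Integration.integrable_add[OF hit_mix_integrable[OF q r t c D]]) simp
    fix \<omega> assume \<omega>: "\<omega> \<in> space M"
    show "V \<omega> \<le> (indicator D \<omega> * (c * pot q (x + X (r + t) \<omega>)) + (1 - indicator D \<omega>) * pot q 0) + 2 * \<delta>"
    proof (cases "\<omega> \<in> D")
      case True
      have "V \<omega> = c * pot_avg q e (x + X (r + t) \<omega>)" using in_D[OF True] by (simp add: V_def c_def)
      also have "\<dots> \<le> c * (pot q (x + X (r + t) \<omega>) + \<delta>)" using c pa(2) by (intro mult_left_mono)
      also have "\<dots> \<le> c * pot q (x + X (r + t) \<omega>) + 2 * \<delta>"
        using c \<delta>0 mult_right_mono[of c 1 \<delta>] by (simp add: distrib_left)
      finally show ?thesis using True by simp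
    next
      case False
      then show ?thesis using near(1)[OF not_in_D[OF \<omega> False]] V1[of \<omega>] by simp
    qed
  qed
  also have "\<dots> = hit_mix q x r t c D + 2 * \<delta>"
    unfolding hit_mix_def using hit_mix_integrable[OF q r t c D, of x] by (simp add: prob_space)
  finally show "?L \<le> hit_mix q x r t c D + enn2real (\<integral>\<^sup>+\<omega>. grid_err q x r t e n \<omega> \<partial>M) / (2 * e) + 3 * \<delta>"
    using ap(1) id by (simp add: E_def)
  have "c * hit_mix q x r t 1 D = (LINT \<omega>|M. c * (indicator D \<omega> * (1 * pot q (x + X (r + t) \<omega>)) + (1 - indicator D \<omega>) * pot q 0))"
    unfolding hit_mix_def by (rule integral_mult_right_zero[symmetric])
  also have "\<dots> \<le> (LINT \<omega>|M. V \<omega> + 2 * \<delta>)"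
  proof (rule integral_mono)
    show "integrable M (\<lambda>\<omega>. c * (indicator D \<omega> * (1 * pot q (x + X (r + t) \<omega>)) + (1 - indicator D \<omega>) * pot q 0))"
      by (rule integrable_mult_right[OF hit_mix_integrable[OF q r t _ _ D]]) simp_all
    show "integrable M (\<lambda>\<omega>. V \<omega> + 2 * \<delta>)"
      by (rule Bochner_Integration.integrable_add[OF Vint]) simp
    fix \<omega> assume \<omega>: "\<omega> \<in> space M"
    have c\<delta>: "c * \<delta> \<le> \<delta>" using c \<delta>0 mult_right_mono[of c 1 \<delta>] by simp
    show "c * (indicator D \<omega> * (1 * pot q (x + X (r + t) \<omega>)) + (1 - indicator D \<omega>) * pot q 0) \<le> V \<omega> + 2 * \<delta>"
    proof (cases "\<omega> \<in> D")
      case True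
      have "c * (pot q (x + X (r + t) \<omega>) - \<delta>) \<le> c * pot_avg q e (x + X (r + t) \<omega>)"
        using c pa(3) by (intro mult_left_mono)
      also have "\<dots> = V \<omega>" using in_D[OF True] by (simp add: V_def c_def)
      finally show ?thesis using True c\<delta> \<delta>0 by (simp add: right_diff_distrib)
    next
      case False
      have "c * (pot q 0 - 2 * \<delta>) \<le> c * pot_avg q e (x + X (r + ?T \<omega>) \<omega>)"
        using c near(2)[OF not_in_D[OF \<omega> False]] by (intro mult_left_mono)
      then show ?thesis using False c\<delta> \<delta>0 V2[of \<omega>] by (simp add: right_diff_distrib)
    qed
  qed
  also have "\<dots> = (LINT \<omega>|M. V \<omega>) + 2 * \<delta>" using Vint by (simp add: prob_space)
  finally have upper: "c * hit_mix q x r t 1 D \<le> (LINT \<omega>|M. V \<omega>) + 2 * \<delta>" .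
  show "c * hit_mix q x r t 1 D \<le> ?L + 3 * \<delta>"
  proof -
    \<comment> \<open>In this direction the occupation missed by the grid has the favourable sign
      and is dropped.\<close>
    have "0 \<le> E / (2 * e)" using \<open>0 \<le> E\<close> e by simp
    then show ?thesis using upper ap(2) id by linarith
  qed
qed

text \<open>The order of limits matters: the grid is refined for a fixed radius \<open>e\<close>,
  because its error is divided by \<open>2 * e\<close>; then the radius \<open>1 / Suc m\<close>
  shrinks, and \<open>\<delta>\<close> goes last.\<close>

lemma hit_mix_inequalities:
  fixes x :: real
  assumes q: "q > 0" and r: "0 \<le> r" and t: "0 \<le> t"
  defines "c \<equiv> exp (- (q * t))" and "G \<equiv> avoid_zero x r t"
  shows "(LINT \<omega>|M. pot q (x + X r \<omega>)) \<le> hit_mix q x r t c G"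
    "c * hit_mix q x r t 1 G \<le> (LINT \<omega>|M. pot q (x + X r \<omega>))"
proof -
  let ?L = "LINT \<omega>|M. pot q (x + X r \<omega>)"
  have c: "0 \<le> c" "c \<le> 1" using q t by (auto simp: c_def)
  have lim_n: "(\<lambda>n. hit_mix q x r t d (grid_avoid x r t e n)) \<longlonglongrightarrow> hit_mix q x r t d (avoid x r t e)"
    if "0 \<le> d" "d \<le> 1" for d e
    using that by (intro hit_mix_tendsto q r t grid_avoid_sets avoid_sets indicator_grid_avoid_tendsto)
  have lim_m: "(\<lambda>m. hit_mix q x r t d (avoid x r t (1 / Suc m))) \<longlonglongrightarrow> hit_mix q x r t d G"
    if "0 \<le> d" "d \<le> 1" for d
    unfolding G_def using that by (intro hit_mix_tendsto q r t avoid_zero_sets avoid_sets indicator_avoid_tendsto)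
  have ev: "\<forall>\<^sub>F m in sequentially. ?L \<le> hit_mix q x r t c (avoid x r t (1 / Suc m)) + 3 * \<delta> \<and>
      c * hit_mix q x r t 1 (avoid x r t (1 / Suc m)) \<le> ?L + 3 * \<delta>" if \<delta>: "\<delta> > 0" for \<delta>
  proof -
    have e1: "\<forall>\<^sub>F m in sequentially. pot_err q (1 / Suc m) < \<delta>"
      using pot_err_tendsto_0[OF q] \<delta> by (rule order_tendstoD(2))
    obtain d where d: "d > 0" "\<And>y. dist y 0 < d \<Longrightarrow> dist (pot q y) (pot q 0) < \<delta>"
      using isCont_pot[OF q, of 0] \<delta> unfolding continuous_at_eps_delta by blast
    have e2: "\<forall>\<^sub>F m in sequentially. 1 / Suc m < d"
      using LIMSEQ_Suc[OF lim_1_over_n] d(1) by (rule order_tendstoD(2))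
    from e1 e2 show ?thesis
    proof eventually_elim
      case (elim m)
      let ?e = "1 / real (Suc m)"
      have "\<bar>pot q y - pot q 0\<bar> \<le> \<delta>" if "\<bar>y\<bar> < ?e" for y
        using d(2)[of y] that elim by (simp add: dist_real_def)
      note b = grid_bounds[OF q _ r t less_imp_le[OF elim(1)] this, folded c_def, where x=x]
      have "(\<lambda>n. hit_mix q x r t c (grid_avoid x r t ?e n) + enn2real (\<integral>\<^sup>+\<omega>. grid_err q x r t ?e n \<omega> \<partial>M) / (2 * ?e) + 3 * \<delta>)
        \<longlonglongrightarrow> hit_mix q x r t c (avoid x r t ?e) + 0 / (2 * ?e) + 3 * \<delta>"
        by (intro tendsto_intros lim_n c expected_grid_err_tendsto_0 q r t) simp
      then have 1: "?L \<le> hit_mix q x r t c (avoid x r t ?e) + 0 / (2 * ?e) + 3 * \<delta>"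
        by (rule LIMSEQ_le_const) (intro exI[of _ 0] allI impI b(1), simp_all)
      have "(\<lambda>n. c * hit_mix q x r t 1 (grid_avoid x r t ?e n)) \<longlonglongrightarrow> c * hit_mix q x r t 1 (avoid x r t ?e)"
        by (intro tendsto_intros lim_n) auto
      then have 2: "c * hit_mix q x r t 1 (avoid x r t ?e) \<le> ?L + 3 * \<delta>"
        by (rule LIMSEQ_le_const2) (intro exI[of _ 0] allI impI b(2), simp_all)
      from 1 2 show ?case by simp
    qed
  qed
  have eps: "?L \<le> hit_mix q x r t c G + 3 * \<delta>" "c * hit_mix q x r t 1 G \<le> ?L + 3 * \<delta>" if \<delta>: "\<delta> > 0" for \<delta>
  proof -
    show "?L \<le> hit_mix q x r t c G + 3 * \<delta>"
      by (rule tendsto_lowerbound[OF tendsto_add[OF lim_m[OF c] tendsto_const]])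
         (use ev[OF \<delta>] in \<open>auto elim: eventually_mono\<close>)
    show "c * hit_mix q x r t 1 G \<le> ?L + 3 * \<delta>"
      by (rule tendsto_upperbound[OF tendsto_mult[OF tendsto_const lim_m]])
         (use ev[OF \<delta>] in \<open>auto elim: eventually_mono\<close>)
  qed
  show "?L \<le> hit_mix q x r t c G"
    by (rule field_le_epsilon) (use eps(1)[of "_ / 3"] in auto)
  show "c * hit_mix q x r t 1 G \<le> ?L"
    by (rule field_le_epsilon) (use eps(2)[of "_ / 3"] in auto)
qed

end

section \<open>Consequences for the resolvent density and the symbol\<close>

context levy_symbol
begin

section \<open>Continuity and nonvanishing of the symbol, and integrability of its inverse\<close>

lemma cmod_symbol_minus: "cmod (\<eta> (- u)) = cmod (\<eta> u)"
  by (simp add: symbol_minus)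

lemma cmod_symbol_abs: "cmod (\<eta> \<bar>u\<bar>) = cmod (\<eta> u)"
  by (simp add: abs_if cmod_symbol_minus)

lemma resolvent_minus: "resolvent q (- u) = cnj (resolvent q u)"
  by (simp add: resolvent_def symbol_minus)

lemma cmod_resolvent_abs: "cmod (resolvent q \<bar>u\<bar>) = cmod (resolvent q u)"
  by (simp add: abs_if resolvent_minus)

lemma symbol_ne: "q > 0 \<Longrightarrow> complex_of_real q - \<eta> u \<noteq> 0"
  using Re_symbol_le_0[of u] by (auto simp: complex_eq_iff)

lemma char_exp_law_1: "char (exp_law 1) = resolvent 1"
  using char_exp_law[of 1] by auto

text \<open>\<open>resolvent 1\<close> is a characteristic function, hence continuous, and
  \<open>\<eta>\<close> is recovered from it as \<open>1 - 1 / resolvent 1\<close>.\<close>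

lemma isCont_symbol: "isCont \<eta> u"
proof -
  interpret L: real_distribution "exp_law 1" by (rule real_distribution_exp_law) simp
  have *: "\<eta> = (\<lambda>u. 1 - 1 / resolvent 1 u)"
    using symbol_ne[of 1] by (auto simp: resolvent_def fun_eq_iff)
  have "resolvent 1 u \<noteq> 0" using symbol_ne[of 1 u] by (simp add: resolvent_def)
  then have "isCont (\<lambda>u. 1 - 1 / resolvent 1 u) u"
    using L.isCont_char[of u] unfolding char_exp_law_1 by (intro continuous_intros)
  then show ?thesis using * by simp
qed

lemma symbol_measurable [measurable]: "\<eta> \<in> borel_measurable borel"
  by (intro borel_measurable_continuous_onI continuous_at_imp_continuous_on ballI isCont_symbol)

lemma resolvent_at_top: "(resolvent 1 \<longlongrightarrow> 0) at_top"
proof -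
  interpret L: real_distribution "exp_law 1" by (rule real_distribution_exp_law) simp
  show ?thesis
    using L.char_integrable_tendsto_0 resolvent_integrable[of 1] by (simp add: char_exp_law_1)
qed

text \<open>A zero \<open>u \<noteq> 0\<close> of the symbol would make the characteristic function \<open>1 / (1 - \<eta>)\<close> periodic,
  while it vanishes at infinity.\<close>

lemma symbol_nonzero:
  assumes "u \<noteq> 0"
  shows "\<eta> u \<noteq> 0"
proof
  assume "\<eta> u = 0"
  define v where "v = \<bar>u\<bar>"
  have v: "v > 0" "\<eta> v = 0"
    using assms \<open>\<eta> u = 0\<close> cmod_symbol_abs[of u] by (auto simp: v_def)
  interpret L: real_distribution "exp_law 1" by (rule real_distribution_exp_law) simp
  have per: "resolvent 1 (w + v) = resolvent 1 w" for w
    using L.char_increment_bound[of w v] v(2) unfolding char_exp_law_1 by (simp add: resolvent_def)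
  have "resolvent 1 (real n * v) = 1" for n
  proof (induction n)
    case 0 then show ?case by (simp add: resolvent_def symbol_0)
  next
    case (Suc n) then show ?case using per[of "real n * v"] by (simp add: algebra_simps)
  qed
  moreover have "filterlim (\<lambda>n. real n * v) at_top sequentially"
    using v(1) by (intro filterlim_at_top_mult_tendsto_pos[OF tendsto_const] filterlim_real_sequentially)
  then have "(\<lambda>n. resolvent 1 (real n * v)) \<longlonglongrightarrow> 0"
    by (rule filterlim_compose[OF resolvent_at_top])
  ultimately show False by (simp add: LIMSEQ_const_iff)
qed

text \<open>Three ranges: near 0 the quadratic lower bound makes the quotient bounded; on a compact
  range away from 0 the symbol is continuous without zeros; far out \<open>1 / \<eta>\<close> is
  comparable with \<open>resolvent 1\<close>.\<close>

lemma inverse_symbol_integrable: "integrable lborel (\<lambda>u. min (u\<^sup>2) 1 / cmod (\<eta> u))"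
proof -
  obtain c r where cr: "c > 0" "r > 0" "\<And>u. \<bar>u\<bar> \<le> r \<Longrightarrow> c * u\<^sup>2 \<le> - Re (\<eta> u)"
    using symbol_lower by blast
  have "\<forall>\<^sub>F u in at_top. dist (resolvent 1 u) 0 < 1 / 2"
    using resolvent_at_top by (rule tendstoD) simp
  then obtain R0 where R0: "\<And>u. u \<ge> R0 \<Longrightarrow> cmod (resolvent 1 u) < 1 / 2"
    by (auto simp: eventually_at_top_linorder)
  define R where "R = max r R0"
  have "\<exists>x\<in>{r..R}. \<forall>y\<in>{r..R}. cmod (\<eta> x) \<le> cmod (\<eta> y)"
    by (intro continuous_attains_inf continuous_on_norm continuous_at_imp_continuous_on ballI isCont_symbol)
       (auto simp: R_def)
  then obtain x where x: "x \<in> {r..R}" "\<And>y. y \<in> {r..R} \<Longrightarrow> cmod (\<eta> x) \<le> cmod (\<eta> y)" by blast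
  define m where "m = cmod (\<eta> x)"
  have m: "m > 0" using symbol_nonzero[of x] x(1) cr(2) by (simp add: m_def)
  define K where "K = 1 / c + 1 / m"
  have K: "1 / c \<le> K" "1 / m \<le> K" "0 \<le> K" using cr m by (auto simp: K_def)
  have pos: "min (u\<^sup>2) 1 / cmod (\<eta> u) \<le> K * indicator {-R..R} u + 2 * cmod (resolvent 1 u)" if u0: "u \<ge> 0" for u
  proof -
    consider "u = 0" | "0 < u" "u \<le> r" | "r \<le> u" "u \<le> R" | "R \<le> u" using u0 by (metis less_eq_real_def linorder_le_cases)
    then show ?thesis
    proof cases
      case 1 then show ?thesis using K by (simp add: symbol_0)
    next
      case 2
      have "c * u\<^sup>2 \<le> cmod (\<eta> u)"
        using cr(3)[of u] 2 abs_Re_le_cmod[of "\<eta> u"] by simp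
      moreover have "0 < cmod (\<eta> u)" using symbol_nonzero[of u] 2 by simp
      ultimately have "u\<^sup>2 / cmod (\<eta> u) \<le> 1 / c" using cr(1) by (simp add: field_simps)
      moreover have "min (u\<^sup>2) 1 / cmod (\<eta> u) \<le> u\<^sup>2 / cmod (\<eta> u)" by (intro divide_right_mono) auto
      moreover have "u \<in> {-R..R}" using 2 by (auto simp: R_def)
      ultimately show ?thesis using K(1) by (simp add: add_increasing2)
    next
      case 3
      have "min (u\<^sup>2) 1 / cmod (\<eta> u) \<le> 1 / m"
        using x(2)[of u] 3 m by (intro frac_le) (auto simp: m_def)
      moreover have "u \<in> {-R..R}" using 3 u0 cr(2) by auto
      ultimately show ?thesis using K(2) by (simp add: add_increasing2)
    next
      case 4
      \<comment> \<open>A resolvent below \<open>1 / 2\<close> means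
        \<open>cmod (1 - \<eta> u) > 2\<close>, so the 1 accounts for less than half of it and
        \<open>cmod (1 - \<eta> u) <= 2 * cmod (\<eta> u)\<close>.\<close>
      then have "cmod (resolvent 1 u) < 1 / 2" by (intro R0) (auto simp: R_def)
      then have 2: "2 < cmod (1 - \<eta> u)"
        using symbol_ne[of 1 u] by (simp add: resolvent_def norm_divide field_simps)
      have 3: "cmod (1 - \<eta> u) \<le> 1 + cmod (\<eta> u)" using norm_triangle_ineq4[of 1 "\<eta> u"] by simp
      have "1 / cmod (\<eta> u) \<le> 2 / cmod (1 - \<eta> u)"
      proof -
        have "cmod (1 - \<eta> u) \<le> 2 * cmod (\<eta> u)" "0 < cmod (\<eta> u)" "0 < cmod (1 - \<eta> u)" using 2 3 by linarith+
        then have "1 / cmod (\<eta> u) = 2 / (2 * cmod (\<eta> u))" "2 / (2 * cmod (\<eta> u)) \<le> 2 / cmod (1 - \<eta> u)"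
          by (simp, intro divide_left_mono mult_pos_pos) auto
        then show ?thesis by simp
      qed
      moreover have "min (u\<^sup>2) 1 / cmod (\<eta> u) \<le> 1 / cmod (\<eta> u)" by (intro divide_right_mono) auto
      ultimately have "min (u\<^sup>2) 1 / cmod (\<eta> u) \<le> 2 * cmod (resolvent 1 u)"
        by (simp add: resolvent_def norm_divide)
      then show ?thesis using K(3) by (simp add: add_increasing)
    qed
  qed
  have bound: "min (u\<^sup>2) 1 / cmod (\<eta> u) \<le> K * indicator {-R..R} u + 2 * cmod (resolvent 1 u)" for u
  proof -
    have "0 < R" using cr(2) by (simp add: R_def)
    then have "indicator {-R..R} \<bar>u\<bar> = (indicator {-R..R} u :: real)" by (simp add: indicator_def abs_if)
    then show ?thesis using pos[of "\<bar>u\<bar>"] by (simp add: cmod_symbol_abs cmod_resolvent_abs)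
  qed
  show ?thesis
  proof (rule Bochner_Integration.integrable_bound)
    show "integrable lborel (\<lambda>u. K * indicator {-R..R} u + 2 * cmod (resolvent 1 u))"
      using resolvent_integrable[of 1]
      by (intro Bochner_Integration.integrable_add integrable_mult_right integrable_real_indicator integrable_norm)
         (auto simp: emeasure_lborel_Icc_eq)
    show "(\<lambda>u. min (u\<^sup>2) 1 / cmod (\<eta> u)) \<in> borel_measurable lborel" by measurable
    show "AE u in lborel. norm (min (u\<^sup>2) 1 / cmod (\<eta> u)) \<le> norm (K * indicator {-R..R} u + 2 * cmod (resolvent 1 u))"
      by (intro AE_I2) (auto intro: order_trans[OF bound abs_ge_self])
  qed
qed

section \<open>The maximum of the potential density at zero, approximate invariance, and regularity
  of zero\<close>

lemma expectation_X_0: "(LINT \<omega>|M. pot q (x + X 0 \<omega>)) = pot q x"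
  by (simp add: X_zero prob_space)

text \<open>Let \<open>t\<close> tend to infinity in the first of
  \<open>hit_mix_inequalities\<close>: the surviving part is discounted away, and what has hit zero
  contributes at most \<open>pot q 0\<close>.\<close>

lemma pot_le_pot_0:
  assumes q: "q > 0"
  shows "pot q x \<le> pot q 0"
proof -
  have le: "pot q x \<le> exp (- (q * t)) * pot_bound q + pot q 0" if t: "t \<ge> 0" for t
  proof -
    let ?G = "avoid_zero x 0 t" and ?c = "exp (- (q * t))"
    have c: "0 \<le> ?c" "?c \<le> 1" using q t by auto
    have "pot q x \<le> hit_mix q x 0 t ?c ?G"
      using hit_mix_inequalities(1)[OF q order_refl t, of x] by (simp add: expectation_X_0)
    also have "\<dots> \<le> (LINT \<omega>|M. ?c * pot_bound q + pot q 0)"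
      unfolding hit_mix_def
    proof (rule integral_mono)
      show "integrable M (\<lambda>\<omega>. indicator ?G \<omega> * (?c * pot q (x + X (0 + t) \<omega>)) + (1 - indicator ?G \<omega>) * pot q 0)"
        using t by (intro hit_mix_integrable q c avoid_zero_sets) auto
      fix \<omega>
      have "?c * pot q (x + X (0 + t) \<omega>) \<le> ?c * pot_bound q"
        using pot_bounds(1)[OF q, of "x + X (0 + t) \<omega>"] by (intro mult_left_mono) auto
      moreover have "0 \<le> ?c * pot_bound q" using pot_bounds(1)[OF q, of 0] by simp
      ultimately have "?c * pot q (x + X (0 + t) \<omega>) \<le> ?c * pot_bound q + pot q 0" "pot q 0 \<le> ?c * pot_bound q + pot q 0"
        using pot_nonneg[OF q, of 0] by linarith+
      then show "indicator ?G \<omega> * (?c * pot q (x + X (0 + t) \<omega>)) + (1 - indicator ?G \<omega>) * pot q 0 \<le> ?c * pot_bound q + pot q 0"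
        by (cases "\<omega> \<in> ?G") simp_all
    qed simp
    finally show ?thesis by (simp add: prob_space)
  qed
  have "((\<lambda>t. exp (- (q * t)) * pot_bound q + pot q 0) \<longlongrightarrow> 0 * pot_bound q + pot q 0) at_top"
    by (intro tendsto_intros filterlim_compose[OF exp_at_bot])
       (use q in \<open>auto intro!: filterlim_tendsto_pos_mult_at_top[OF tendsto_const] filterlim_ident simp: filterlim_uminus_at_bot\<close>)
  moreover have "\<forall>\<^sub>F t in at_top. pot q x \<le> exp (- (q * t)) * pot_bound q + pot q 0"
    using eventually_ge_at_top[of 0] by eventually_elim (rule le)
  ultimately have "pot q x \<le> 0 * pot_bound q + pot q 0"
    by (rule tendsto_lowerbound) simp
  then show ?thesis by simp
qed

definition pot_diff :: "real \<Rightarrow> real \<Rightarrow> real" where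
  "pot_diff q y = pot q 0 - pot q y"

lemma pot_diff_nonneg: "q > 0 \<Longrightarrow> 0 \<le> pot_diff q y"
  using pot_le_pot_0[of q y] by (simp add: pot_diff_def)

text \<open>For the upper bound the discount on survival is raised to 1; for the lower one the
  second inequality is multiplied by \<open>exp (q * t)\<close>. Replacing \<open>pot q x\<close> by
  \<open>pot q 0\<close> in the loss makes it independent of the starting point.\<close>

lemma pot_diff_expectation:
  assumes q: "q > 0" and t: "0 \<le> t"
  shows "(LINT \<omega>|M. indicator (avoid_zero x 0 t) \<omega> * pot_diff q (x + X t \<omega>)) \<le> pot_diff q x"
    "pot_diff q x - (exp (q * t) - 1) * pot q 0 \<le> (LINT \<omega>|M. indicator (avoid_zero x 0 t) \<omega> * pot_diff q (x + X t \<omega>))"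
proof -
  let ?G = "avoid_zero x 0 t" and ?c = "exp (- (q * t))"
  have G[measurable]: "?G \<in> sets M" using t by (intro avoid_zero_sets) auto
  have c: "0 \<le> ?c" "?c \<le> 1" using q t by auto
  note int = hit_mix_integrable[OF q order_refl t _ _ G, of _ x]
  have eq: "hit_mix q x 0 t 1 ?G = pot q 0 - (LINT \<omega>|M. indicator ?G \<omega> * pot_diff q (x + X t \<omega>))"
  proof -
    have [measurable]: "(\<lambda>\<omega>. pot q (x + X t \<omega>)) \<in> borel_measurable M" using q t by (rule pot_X_measurable)
    have "integrable M (\<lambda>\<omega>. indicator ?G \<omega> * pot_diff q (x + X t \<omega>))"
    proof (rule integrable_const_bound[where B="pot q 0"])
      show "AE \<omega> in M. norm (indicator ?G \<omega> * pot_diff q (x + X t \<omega>)) \<le> pot q 0"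
        using pot_diff_nonneg[OF q] pot_nonneg[OF q] by (intro AE_I2) (auto simp: indicator_def pot_diff_def)
    qed (simp add: pot_diff_def)
    then have "pot q 0 - (LINT \<omega>|M. indicator ?G \<omega> * pot_diff q (x + X t \<omega>)) = (LINT \<omega>|M. pot q 0 - indicator ?G \<omega> * pot_diff q (x + X t \<omega>))"
      by (simp add: prob_space)
    also have "\<dots> = hit_mix q x 0 t 1 ?G"
      unfolding hit_mix_def
      by (intro Bochner_Integration.integral_cong refl) (auto simp: pot_diff_def algebra_simps)
    finally show ?thesis by simp
  qed
  have "pot q x \<le> hit_mix q x 0 t ?c ?G"
    using hit_mix_inequalities(1)[OF q order_refl t, of x] by (simp add: expectation_X_0)
  also have "\<dots> \<le> hit_mix q x 0 t 1 ?G"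
    unfolding hit_mix_def
  proof (rule integral_mono[OF int[OF c] int])
    fix \<omega>
    have "?c * pot q (x + X (0 + t) \<omega>) \<le> 1 * pot q (x + X (0 + t) \<omega>)"
      using c pot_nonneg[OF q] by (intro mult_right_mono) auto
    then show "indicator ?G \<omega> * (?c * pot q (x + X (0 + t) \<omega>)) + (1 - indicator ?G \<omega>) * pot q 0
      \<le> indicator ?G \<omega> * (1 * pot q (x + X (0 + t) \<omega>)) + (1 - indicator ?G \<omega>) * pot q 0"
      by (auto simp: indicator_def)
  qed auto
  finally show "(LINT \<omega>|M. indicator ?G \<omega> * pot_diff q (x + X t \<omega>)) \<le> pot_diff q x"
    unfolding eq by (simp add: pot_diff_def)
  have "?c * hit_mix q x 0 t 1 ?G \<le> pot q x"
    using hit_mix_inequalities(2)[OF q order_refl t, of x] by (simp add: expectation_X_0)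
  then have "exp (q * t) * (?c * hit_mix q x 0 t 1 ?G) \<le> exp (q * t) * pot q x"
    by (intro mult_left_mono) auto
  then have "hit_mix q x 0 t 1 ?G \<le> exp (q * t) * pot q x"
    by (simp add: mult.assoc[symmetric] exp_add[symmetric])
  moreover have "(exp (q * t) - 1) * pot q x \<le> (exp (q * t) - 1) * pot q 0"
    using q t pot_le_pot_0[OF q] by (intro mult_left_mono) auto
  ultimately show "pot_diff q x - (exp (q * t) - 1) * pot q 0 \<le> (LINT \<omega>|M. indicator ?G \<omega> * pot_diff q (x + X t \<omega>))"
    unfolding eq by (simp add: pot_diff_def algebra_simps)
qed

text \<open>If after time \<open>r\<close> the path avoids zero with probability \<open>p\<close>,
  the mean potential at \<open>X r\<close> falls short of \<open>pot 1 0\<close> by at least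
  \<open>p * (1 - exp (- t)) * pot 1 0\<close>. As \<open>r\<close> tends to 0 that mean tends to
  \<open>pot 1 0\<close>, by right continuity and continuity of \<open>pot 1\<close>, so
  \<open>p\<close> tends to 0.\<close>

lemma avoid_zero_prob_tendsto_0:
  assumes t: "0 < t" and r: "\<And>n. 0 \<le> r n" "r \<longlonglongrightarrow> 0"
  shows "(\<lambda>n. prob (avoid_zero 0 (r n) t)) \<longlonglongrightarrow> 0"
proof -
  let ?c = "exp (- (1 * t))"
  have c: "0 \<le> ?c" "?c \<le> 1" "?c < 1" using t by auto
  have p0: "0 < pot 1 0" by (rule pot_0_pos) simp
  have le: "prob (avoid_zero 0 (r n) t) \<le> (pot 1 0 - (LINT \<omega>|M. pot 1 (0 + X (r n) \<omega>))) / ((1 - ?c) * pot 1 0)" for n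
  proof -
    let ?G = "avoid_zero 0 (r n) t"
    have G[measurable]: "?G \<in> sets M" using r t by (intro avoid_zero_sets) auto
    have "(LINT \<omega>|M. pot 1 (0 + X (r n) \<omega>)) \<le> hit_mix 1 0 (r n) t ?c ?G"
      using t by (intro hit_mix_inequalities(1) r) auto
    also have "\<dots> \<le> (LINT \<omega>|M. pot 1 0 - indicator ?G \<omega> * ((1 - ?c) * pot 1 0))"
      unfolding hit_mix_def
    proof (rule integral_mono[OF hit_mix_integrable[OF _ r(1) less_imp_le[OF t] c(1,2) G]])
      show "integrable M (\<lambda>\<omega>. pot 1 0 - indicator ?G \<omega> * ((1 - ?c) * pot 1 0))"
        by (intro Bochner_Integration.integrable_diff integrable_mult_left integrable_real_indicator) (auto simp: less_top[symmetric])
      fix \<omega>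
      have "?c * pot 1 (0 + X (r n + t) \<omega>) \<le> ?c * pot 1 0"
        by (intro mult_left_mono pot_le_pot_0) auto
      then show "indicator ?G \<omega> * (?c * pot 1 (0 + X (r n + t) \<omega>)) + (1 - indicator ?G \<omega>) * pot 1 0
         \<le> pot 1 0 - indicator ?G \<omega> * ((1 - ?c) * pot 1 0)"
        by (auto simp: indicator_def left_diff_distrib)
    qed simp
    also have "\<dots> = pot 1 0 - prob ?G * ((1 - ?c) * pot 1 0)"
      by (subst Bochner_Integration.integral_diff) (auto simp: prob_space less_top[symmetric])
    finally show ?thesis using c(3) p0 by (simp add: pos_le_divide_eq)
  qed
  have "(\<lambda>n. LINT \<omega>|M. pot 1 (0 + X (r n) \<omega>)) \<longlonglongrightarrow> (LINT \<omega>|M. pot 1 (0 + X 0 \<omega>))"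
  proof (rule integral_dominated_convergence[where w="\<lambda>_. pot_bound 1"])
    show "AE \<omega> in M. (\<lambda>n. pot 1 (0 + X (r n) \<omega>)) \<longlonglongrightarrow> pot 1 (0 + X 0 \<omega>)"
      by (intro AE_I2 isCont_tendsto_compose[OF isCont_pot] tendsto_intros X_seq_right r) auto
    show "AE \<omega> in M. norm (pot 1 (0 + X (r n) \<omega>)) \<le> pot_bound 1" for n
      using pot_bounds(1)[of 1] by auto
  qed (use r in \<open>auto intro!: pot_X_measurable simp del: add_0\<close>)
  then have "(\<lambda>n. (pot 1 0 - (LINT \<omega>|M. pot 1 (0 + X (r n) \<omega>))) / ((1 - ?c) * pot 1 0)) \<longlonglongrightarrow> (pot 1 0 - pot 1 0) / ((1 - ?c) * pot 1 0)"
    unfolding expectation_X_0 by (intro tendsto_intros) (use c(3) p0 in auto)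
  then have lim: "(\<lambda>n. (pot 1 0 - (LINT \<omega>|M. pot 1 (0 + X (r n) \<omega>))) / ((1 - ?c) * pot 1 0)) \<longlonglongrightarrow> 0"
    by simp
  show ?thesis
    by (rule tendsto_sandwich[OF _ _ tendsto_const lim]) (use le in auto)
qed

end

section \<open>Jumps starting near zero\<close>

lemma sum_indicator_consecutive:
  fixes g :: "nat \<Rightarrow> real"
  assumes "\<And>i j. i \<le> j \<Longrightarrow> g i \<le> g j"
  shows "(\<Sum>k<n. indicator {g k..<g (Suc k)} s :: ennreal) = indicator {g 0..<g n} s"
proof (induction n)
  case (Suc n)
  then show ?case using assms[of 0 n] assms[of n "Suc n"] by (auto simp: indicator_def)
qed simp

text \<open>The integral is \<open>R - sin (R * y) / y\<close>, and \<open>1 / \<bar>y\<bar>\<close>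
  is at most \<open>R / 2\<close>. This is the truncation inequality that turns tails into an
  average of the characteristic function.\<close>

lemma integral_one_minus_cos_ge:
  fixes y R :: real
  assumes "R > 0" "2 / R < \<bar>y\<bar>"
  shows "R / 2 \<le> (LINT u|lborel. indicator {0..R} u * (1 - cos (u * y)))"
    "integrable lborel (\<lambda>u. indicator {0..R} u * (1 - cos (u * y)))"
proof -
  have y: "y \<noteq> 0" using assms by auto
  have "has_bochner_integral lborel (\<lambda>u. (1 - cos (u * y)) * indicator {0..R} u) ((R - sin (R * y) / y) - (0 - sin (0 * y) / y))"
    using assms y
    by (intro has_bochner_integral_FTC_Icc_real[where F="\<lambda>u. u - sin (u * y) / y"])
       (auto intro!: derivative_eq_intros continuous_intros)
  then have *: "integrable lborel (\<lambda>u. indicator {0..R} u * (1 - cos (u * y)))"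
    "(LINT u|lborel. indicator {0..R} u * (1 - cos (u * y))) = R - sin (R * y) / y"
    by (auto simp: has_bochner_integral_iff mult.commute)
  have "sin (R * y) / y \<le> 1 / \<bar>y\<bar>"
  proof -
    have "sin (R * y) / y \<le> \<bar>sin (R * y) / y\<bar>" by (rule abs_ge_self)
    also have "\<dots> \<le> 1 / \<bar>y\<bar>" unfolding abs_divide by (intro divide_right_mono) auto
    finally show ?thesis .
  qed
  also have "1 / \<bar>y\<bar> \<le> R / 2"
    using assms y by (simp add: field_simps)
  finally show "R / 2 \<le> (LINT u|lborel. indicator {0..R} u * (1 - cos (u * y)))"
    unfolding * by simp
  show "integrable lborel (\<lambda>u. indicator {0..R} u * (1 - cos (u * y)))" by (rule *)
qed

context levy_symbol
begin

lemma prob_increment_indep: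
  assumes r: "0 \<le> r" and d: "0 \<le> d" and A[measurable]: "A \<in> sets borel" and B[measurable]: "B \<in> sets borel"
  shows "prob {\<omega>\<in>space M. X r \<omega> \<in> A \<and> X (r + d) \<omega> - X r \<omega> \<in> B} =
    prob {\<omega>\<in>space M. X r \<omega> \<in> A} * prob {\<omega>\<in>space M. X d \<omega> \<in> B}"
proof -
  have [measurable]: "X r \<in> borel_measurable M" "X d \<in> borel_measurable M" "X (r + d) \<in> borel_measurable M"
    using r d by (auto intro: X_measurable)
  let ?\<Phi> = "\<lambda>v z. indicator A (v 0) * indicator B z :: ennreal"
  have [measurable]: "(\<lambda>v. v 0) \<in> PiM {..0 :: nat} (\<lambda>_. borel) \<rightarrow>\<^sub>M (borel :: real measure)"
    by (rule measurable_component_singleton) auto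
  have \<Phi>: "(\<lambda>(v, z). ?\<Phi> v z) \<in> borel_measurable (PiM {..0 :: nat} (\<lambda>_. borel) \<Otimes>\<^sub>M (borel :: real measure))"
    by measurable
  have "emeasure M {\<omega>\<in>space M. X r \<omega> \<in> A \<and> X (r + d) \<omega> - X r \<omega> \<in> B}
    = (\<integral>\<^sup>+\<omega>. indicator {\<omega>\<in>space M. X r \<omega> \<in> A \<and> X (r + d) \<omega> - X r \<omega> \<in> B} \<omega> \<partial>M)"
    by (rule nn_integral_indicator[symmetric]) measurable
  also have "\<dots> = (\<integral>\<^sup>+\<omega>. indicator A (X r \<omega>) * indicator B (X (r + d) \<omega> - X r \<omega>) \<partial>M)"
    by (intro nn_integral_cong) (auto simp: indicator_def)
  also have "\<dots> = (\<integral>\<^sup>+\<omega>. \<integral>\<^sup>+\<omega>'. indicator A (X r \<omega>) * indicator B (X d \<omega>') \<partial>M \<partial>M)"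
    using markov_nn_integral[of "\<lambda>_. r" 0 d ?\<Phi>, OF _ _ d \<Phi>] r by simp
  also have "\<dots> = (\<integral>\<^sup>+\<omega>. indicator A (X r \<omega>) * (\<integral>\<^sup>+\<omega>'. indicator B (X d \<omega>') \<partial>M) \<partial>M)"
    by (intro nn_integral_cong nn_integral_cmult) measurable
  also have "\<dots> = (\<integral>\<^sup>+\<omega>. indicator A (X r \<omega>) \<partial>M) * (\<integral>\<^sup>+\<omega>'. indicator B (X d \<omega>') \<partial>M)"
    by (rule nn_integral_multc) measurable
  also have "(\<integral>\<^sup>+\<omega>. indicator A (X r \<omega>) \<partial>M) = (\<integral>\<^sup>+\<omega>. indicator {\<omega>\<in>space M. X r \<omega> \<in> A} \<omega> \<partial>M)"
    by (intro nn_integral_cong) (auto simp: indicator_def)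
  also have "\<dots> = emeasure M {\<omega>\<in>space M. X r \<omega> \<in> A}"
    by (rule nn_integral_indicator) measurable
  also have "(\<integral>\<^sup>+\<omega>. indicator B (X d \<omega>) \<partial>M) = (\<integral>\<^sup>+\<omega>. indicator {\<omega>\<in>space M. X d \<omega> \<in> B} \<omega> \<partial>M)"
    by (intro nn_integral_cong) (auto simp: indicator_def)
  also have "\<dots> = emeasure M {\<omega>\<in>space M. X d \<omega> \<in> B}"
    by (rule nn_integral_indicator) measurable
  finally show ?thesis
    by (simp add: emeasure_eq_measure ennreal_mult'[symmetric])
qed

lemma one_minus_Re_exp_le:
  assumes "0 \<le> d"
  shows "1 - Re (exp (complex_of_real d * \<eta> u)) \<le> d * cmod (\<eta> u)"
proof -
  have "1 - Re (exp (complex_of_real d * \<eta> u)) = Re (- (exp (complex_of_real d * \<eta> u) - 1))" by simp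
  also have "\<dots> \<le> cmod (exp (complex_of_real d * \<eta> u) - 1)"
    by (rule order_trans[OF complex_Re_le_cmod]) (simp only: norm_minus_cancel order_refl)
  also have "\<dots> \<le> cmod (complex_of_real d * \<eta> u)"
    using assms Re_symbol_le_0[of u] by (intro cmod_exp_minus_1_le) (auto simp: mult_nonneg_nonpos)
  finally show ?thesis using assms by (simp add: norm_mult)
qed

lemma expectation_cos:
  assumes "0 \<le> d"
  shows "integrable M (\<lambda>\<omega>. cos (u * X d \<omega>))" "(LINT \<omega>|M. cos (u * X d \<omega>)) = Re (exp (complex_of_real d * \<eta> u))"
proof -
  have [measurable]: "X d \<in> borel_measurable M" using assms by (rule X_measurable)
  show int: "integrable M (\<lambda>\<omega>. cos (u * X d \<omega>))"
    by (rule integrable_const_bound[where B=1]) auto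
  have "integrable M (\<lambda>\<omega>. iexp (u * X d \<omega>))"
    by (rule integrable_const_bound[where B=1]) auto
  then have "Re (CLINT \<omega>|M. iexp (u * X d \<omega>)) = (LINT \<omega>|M. Re (iexp (u * X d \<omega>)))"
    by (rule integral_Re[symmetric])
  then show "(LINT \<omega>|M. cos (u * X d \<omega>)) = Re (exp (complex_of_real d * \<eta> u))"
    unfolding char_X[OF assms] by (simp add: Re_exp)
qed

text \<open>With \<open>R = 2 / \<delta>\<close>, a value beyond \<open>\<delta>\<close> makes the
  integral of \<open>1 - cos (u * X d)\<close> over \<open>[0, R]\<close> at least
  \<open>R / 2\<close>. Its expectation is at most \<open>d\<close> times the integral of
  \<open>cmod (\<eta> u)\<close>, which is bounded on the compact interval.\<close>

lemma tail_prob_linear: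
  assumes \<delta>: "\<delta> > 0"
  shows "\<exists>C\<ge>0. \<forall>d\<ge>0. prob {\<omega>\<in>space M. \<delta> < \<bar>X d \<omega>\<bar>} \<le> C * d"
proof -
  define R where "R = 2 / \<delta>"
  have R: "R > 0" "2 / R = \<delta>" using \<delta> by (auto simp: R_def)
  have "compact (\<eta> ` {0..R})"
    by (intro compact_continuous_image continuous_at_imp_continuous_on ballI isCont_symbol) auto
  then obtain K where K: "\<And>u. u \<in> {0..R} \<Longrightarrow> cmod (\<eta> u) \<le> K"
    using compact_imp_bounded by (force simp: bounded_iff)
  have K0: "0 \<le> K" using order_trans[OF norm_ge_zero K[of 0]] R(1) by simp
  interpret P: pair_sigma_finite lborel M ..
  show ?thesis
  proof (intro exI[of _ "2 * K"] conjI allI impI)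
    fix d :: real assume d: "d \<ge> 0"
    have Xd[measurable]: "X d \<in> borel_measurable M" using d by (rule X_measurable)
    let ?A = "{\<omega>\<in>space M. \<delta> < \<bar>X d \<omega>\<bar>}"
    let ?f = "\<lambda>\<omega> u. indicator {0..R} u * (1 - cos (u * X d \<omega>))"
    have f0: "0 \<le> ?f \<omega> u" for \<omega> u by (simp add: indicator_def)
    have "ennreal (R / 2) * emeasure M ?A = (\<integral>\<^sup>+\<omega>. ennreal (R / 2) * indicator ?A \<omega> \<partial>M)"
      by (rule nn_integral_cmult_indicator[symmetric]) measurable
    also have "\<dots> \<le> (\<integral>\<^sup>+\<omega>. \<integral>\<^sup>+u. ennreal (?f \<omega> u) \<partial>lborel \<partial>M)"
    proof (intro nn_integral_mono)
      fix \<omega> assume \<omega>: "\<omega> \<in> space M"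
      show "ennreal (R / 2) * indicator ?A \<omega> \<le> (\<integral>\<^sup>+u. ennreal (?f \<omega> u) \<partial>lborel)"
      proof (cases "\<omega> \<in> ?A")
        case True
        then have *: "2 / R < \<bar>X d \<omega>\<bar>" using R by simp
        have "(\<integral>\<^sup>+u. ennreal (?f \<omega> u) \<partial>lborel) = ennreal (LINT u|lborel. ?f \<omega> u)"
          by (rule nn_integral_eq_integral[OF integral_one_minus_cos_ge(2)[OF R(1) *]]) (use f0 in auto)
        then show ?thesis using integral_one_minus_cos_ge(1)[OF R(1) *] True by (simp add: ennreal_leI)
      qed simp
    qed
    also have "\<dots> = (\<integral>\<^sup>+u. \<integral>\<^sup>+\<omega>. ennreal (?f \<omega> u) \<partial>M \<partial>lborel)"
      by (rule P.Fubini') (simp add: split_beta')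
    also have "\<dots> \<le> (\<integral>\<^sup>+u. ennreal (d * K) * indicator {0..R} u \<partial>lborel)"
    proof (intro nn_integral_mono)
      fix u :: real
      show "(\<integral>\<^sup>+\<omega>. ennreal (?f \<omega> u) \<partial>M) \<le> ennreal (d * K) * indicator {0..R} u"
      proof (cases "u \<in> {0..R}")
        case True
        have "(\<integral>\<^sup>+\<omega>. ennreal (?f \<omega> u) \<partial>M) = ennreal (LINT \<omega>|M. 1 - cos (u * X d \<omega>))"
          using True expectation_cos(1)[OF d, of u] by (subst nn_integral_eq_integral[symmetric]) auto
        also have "(LINT \<omega>|M. 1 - cos (u * X d \<omega>)) = 1 - Re (exp (complex_of_real d * \<eta> u))"
          using expectation_cos[OF d, of u] by (simp add: prob_space)
        also have "\<dots> \<le> d * K"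
          using one_minus_Re_exp_le[OF d, of u] mult_left_mono[OF K[OF True] d] by linarith
        finally show ?thesis using True by (simp add: ennreal_leI)
      qed simp
    qed
    also have "\<dots> = ennreal (d * K) * ennreal R"
      using R(1) by (simp add: nn_integral_cmult_indicator)
    finally have "ennreal (R / 2 * prob ?A) \<le> ennreal (d * K * R)"
      using R d K0 by (simp add: emeasure_eq_measure ennreal_mult'[symmetric])
    then have "R / 2 * prob ?A \<le> d * K * R"
      using R d K0 by (subst (asm) ennreal_le_iff) auto
    then show "prob ?A \<le> 2 * K * d" using R(1) by (simp add: field_simps)
  qed (use K0 in simp)
qed

text \<open>Before \<open>T\<close> the weight \<open>exp (- s)\<close> is at least
  \<open>exp (- T)\<close>, so the undiscounted time near zero inherits the bound of order
  \<open>e\<close> from the bounded potential density.\<close>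

lemma occupation_time_bound:
  assumes e: "e > 0"
  shows "(\<integral>\<^sup>+s. indicator {0..<T} s * ennreal (prob {\<omega>\<in>space M. \<bar>x + X (max s 0) \<omega>\<bar> < e}) \<partial>lborel)
    \<le> ennreal (exp T * (2 * e * pot_bound 1))"
proof -
  let ?P = "\<lambda>s. \<integral>\<^sup>+\<omega>. indicator {-e<..<e} (x + X (max s 0) \<omega>) \<partial>M"
  let ?g = "\<lambda>s. ennreal (indicator {0..} s * exp (- (1 * s)))"
  have [measurable]: "(\<lambda>z. X (max (fst z) 0) (snd z)) \<in> borel_measurable (lborel \<Otimes>\<^sub>M M)"
    by (intro measurable_X_compose) auto
  have Pm[measurable]: "?P \<in> borel_measurable lborel"
    by (rule borel_measurable_nn_integral) (simp add: split_beta', measurable)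
  have P: "ennreal (prob {\<omega>\<in>space M. \<bar>x + X (max s 0) \<omega>\<bar> < e}) = ?P s" for s
  proof -
    have [measurable]: "X (max s 0) \<in> borel_measurable M" by (intro X_measurable) auto
    have "ennreal (prob {\<omega>\<in>space M. \<bar>x + X (max s 0) \<omega>\<bar> < e}) = (\<integral>\<^sup>+\<omega>. indicator {\<omega>\<in>space M. \<bar>x + X (max s 0) \<omega>\<bar> < e} \<omega> \<partial>M)"
      unfolding emeasure_eq_measure[symmetric] by (rule nn_integral_indicator[symmetric]) measurable
    also have "\<dots> = ?P s" by (intro nn_integral_cong) (auto simp: indicator_def)
    finally show ?thesis .
  qed
  have "(\<integral>\<^sup>+s. indicator {0..<T} s * ennreal (prob {\<omega>\<in>space M. \<bar>x + X (max s 0) \<omega>\<bar> < e}) \<partial>lborel)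
    \<le> (\<integral>\<^sup>+s. ennreal (exp T) * (?g s * ?P s) \<partial>lborel)"
    unfolding P
  proof (intro nn_integral_mono)
    fix s :: real
    show "indicator {0..<T} s * ?P s \<le> ennreal (exp T) * (?g s * ?P s)"
    proof (cases "s \<in> {0..<T}")
      case True
      then have "1 \<le> exp T * (indicator {0..} s * exp (- (1 * s)))" by (simp add: exp_add[symmetric])
      then have "1 \<le> ennreal (exp T) * ?g s" by (simp add: ennreal_mult'[symmetric] ennreal_1[symmetric] ennreal_leI del: ennreal_1)
      then have "1 * ?P s \<le> (ennreal (exp T) * ?g s) * ?P s" by (rule mult_right_mono) simp
      then show ?thesis using True by (simp add: mult.assoc)
    qed simp
  qed
  also have "\<dots> = ennreal (exp T) * (\<integral>\<^sup>+s. ?g s * ?P s \<partial>lborel)"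
    by (rule nn_integral_cmult) measurable
  also have "(\<integral>\<^sup>+s. ?g s * ?P s \<partial>lborel) = ennreal (2 * e * pot_avg 1 e x)"
    by (rule occupation_pot_avg(1)[OF _ e]) simp
  also have "ennreal (exp T) * \<dots> \<le> ennreal (exp T) * ennreal (2 * e * pot_bound 1)"
    using pot_bounds(2)[of 1 e x] e by (intro mult_left_mono ennreal_leI) auto
  finally show ?thesis by (simp add: ennreal_mult')
qed

text \<open>A finite, measurable trace of a large jump out of zero: one grid cell that starts within
  \<open>e\<close> of zero and moves by more than \<open>\<delta>\<close>.\<close>

definition jump_near_zero :: "real \<Rightarrow> real \<Rightarrow> real \<Rightarrow> real \<Rightarrow> nat \<Rightarrow> 'a set" where
  "jump_near_zero x T e \<delta> n = {\<omega>\<in>space M. \<exists>k<Suc n. \<bar>x + X (grid_time T n k) \<omega>\<bar> < e \<and>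
     \<delta> < \<bar>X (grid_time T n (Suc k)) \<omega> - X (grid_time T n k) \<omega>\<bar>}"

lemma jump_near_zero_sets [measurable]:
  assumes "0 \<le> T"
  shows "jump_near_zero x T e \<delta> n \<in> sets M"
proof -
  have [measurable]: "X (grid_time T n k) \<in> borel_measurable M" for k
    using grid_time_nonneg[OF assms] by (intro X_measurable) auto
  show ?thesis unfolding jump_near_zero_def by measurable
qed

text \<open>Being near zero at the start of a cell and moving far within it are independent, and the
  latter costs at most \<open>C\<close> times the mesh. What remains is a Riemann sum for the
  occupation time of a ball, hence of order \<open>e\<close>. \<open>K\<close> is uniform in
  \<open>e\<close>; only the required fineness of the grid depends on \<open>e\<close>.\<close>

lemma prob_jump_near_zero:
  assumes T: "T > 0" and \<delta>: "\<delta> > 0"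
  shows "\<exists>K\<ge>0. \<forall>e>0. \<forall>\<^sub>F n in sequentially. prob (jump_near_zero x T e \<delta> n) \<le> K * e"
proof -
  obtain C where C: "C \<ge> 0" "\<And>d. d \<ge> 0 \<Longrightarrow> prob {\<omega>\<in>space M. \<delta> < \<bar>X d \<omega>\<bar>} \<le> C * d"
    using tail_prob_linear[OF \<delta>] by blast
  have pb: "0 \<le> pot_bound 1" using pot_bounds(1)[of 1 0] by simp
  have main: "\<forall>\<^sub>F n in sequentially. prob (jump_near_zero x T e \<delta> n) \<le> (C * 2 * exp T * 4 * pot_bound 1) * e" if e: "e > 0" for e
  proof -
    \<comment> \<open>A second tail bound, at level \<open>e / 2\<close>: once
      \<open>C' * d < 1 / 2\<close>, the path moves by at most \<open>e / 2\<close> within a cell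
      with probability at least one half. \<open>C'\<close> depends on \<open>e\<close> but does not
      enter the final constant.\<close>
    have "0 < e / 2" using e by simp
    from tail_prob_linear[OF this] obtain C' where C': "C' \<ge> 0" "\<And>d. d \<ge> 0 \<Longrightarrow> prob {\<omega>\<in>space M. e / 2 < \<bar>X d \<omega>\<bar>} \<le> C' * d"
      by blast
    have "(\<lambda>n. C' * T * (1 / Suc n)) \<longlonglongrightarrow> C' * T * 0"
      by (intro tendsto_intros LIMSEQ_Suc[OF lim_1_over_n])
    then have "\<forall>\<^sub>F n in sequentially. C' * T * (1 / Suc n) < 1 / 2"
      by (intro order_tendstoD(2)[where y=0]) auto
    then show ?thesis
    proof eventually_elim
      case (elim n)
      let ?t = "grid_time T n"
      define d where "d = T / real (Suc n)"
      have d: "d > 0" "C' * d < 1 / 2" using T elim by (auto simp: d_def)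
      have step: "?t (Suc k) = ?t k + d" for k by (simp add: grid_time_def d_def add_divide_distrib distrib_right)
      have t0: "0 \<le> ?t k" for k using T by (simp add: grid_time_nonneg)
      have [measurable]: "X (?t k) \<in> borel_measurable M" for k using t0 by (rule X_measurable)
      let ?p = "\<lambda>k. prob {\<omega>\<in>space M. \<bar>x + X (?t k) \<omega>\<bar> < e}"
      let ?P = "\<lambda>s. prob {\<omega>\<in>space M. \<bar>x + X (max s 0) \<omega>\<bar> < 2 * e}"
      \<comment> \<open>Being near zero at a grid time makes it likely to be near zero throughout the following cell, so
        the sum over the grid is controlled by the occupation time.\<close>
      have cell: "?p k \<le> 2 * ?P s" if s: "s \<in> {?t k..<?t (Suc k)}" for s k
      proof -
        define u where "u = s - ?t k"
        have u: "0 \<le> u" "u \<le> d" "s = ?t k + u" "0 \<le> s" using s t0[of k] by (auto simp: u_def step)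
        have [measurable]: "X u \<in> borel_measurable M" "X s \<in> borel_measurable M" using u by (auto intro: X_measurable)
        have "prob {\<omega>\<in>space M. e / 2 < \<bar>X u \<omega>\<bar>} \<le> 1 / 2"
          using C'(2)[OF u(1)] mult_left_mono[OF u(2) C'(1)] d by linarith
        then have "1 / 2 \<le> prob {\<omega>\<in>space M. \<not> e / 2 < \<bar>X u \<omega>\<bar>}"
          by (subst prob_neg) auto
        also have "{\<omega>\<in>space M. \<not> e / 2 < \<bar>X u \<omega>\<bar>} = {\<omega>\<in>space M. X u \<omega> \<in> {- (e/2)..e/2}}"
          by (auto simp: abs_le_iff not_less)
        finally have half: "1 / 2 \<le> prob {\<omega>\<in>space M. X u \<omega> \<in> {- (e/2)..e/2}}" .
        have "?p k = prob {\<omega>\<in>space M. X (?t k) \<omega> \<in> {-x - e<..<-x + e}}"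
          by (intro arg_cong[where f=prob]) (auto simp: abs_less_iff)
        then have "?p k * (1 / 2) \<le> prob {\<omega>\<in>space M. X (?t k) \<omega> \<in> {-x - e<..<-x + e}} * prob {\<omega>\<in>space M. X u \<omega> \<in> {- (e/2)..e/2}}"
          using half by (intro mult_mono) auto
        also have "\<dots> = prob {\<omega>\<in>space M. X (?t k) \<omega> \<in> {-x - e<..<-x + e} \<and> X (?t k + u) \<omega> - X (?t k) \<omega> \<in> {- (e/2)..e/2}}"
          by (rule prob_increment_indep[symmetric, OF t0 u(1)]) auto
        also have "\<dots> \<le> ?P s"
        proof (rule finite_measure_mono)
          show "{\<omega>\<in>space M. X (?t k) \<omega> \<in> {-x - e<..<-x + e} \<and> X (?t k + u) \<omega> - X (?t k) \<omega> \<in> {- (e/2)..e/2}}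
            \<subseteq> {\<omega>\<in>space M. \<bar>x + X (max s 0) \<omega>\<bar> < 2 * e}"
            using u e by (auto simp: max_absorb1 abs_less_iff)
        next
          have "{\<omega>\<in>space M. \<bar>x + X s \<omega>\<bar> < 2 * e} \<in> sets M" by measurable
          then show "{\<omega>\<in>space M. \<bar>x + X (max s 0) \<omega>\<bar> < 2 * e} \<in> sets M" using u(4) by (simp add: max_absorb1)
        qed
        finally show ?thesis by simp
      qed
      have "prob (jump_near_zero x T e \<delta> n) \<le> (\<Sum>k<Suc n. ?p k * (C * d))"
      proof -
        let ?J = "\<lambda>k. {\<omega>\<in>space M. X (?t k) \<omega> \<in> {-x - e<..<-x + e} \<and> X (?t k + d) \<omega> - X (?t k) \<omega> \<in> - {-\<delta>..\<delta>}}"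
        have Jm: "?J k \<in> sets M" for k
        proof -
          have [measurable]: "X (?t k + d) \<in> borel_measurable M" using t0[of k] d by (intro X_measurable) auto
          show ?thesis by measurable
        qed
        have "jump_near_zero x T e \<delta> n \<subseteq> (\<Union>k\<in>{..<Suc n}. ?J k)"
          unfolding jump_near_zero_def step by (auto simp: abs_less_iff)
        then have "prob (jump_near_zero x T e \<delta> n) \<le> prob (\<Union>k\<in>{..<Suc n}. ?J k)"
          by (rule finite_measure_mono) (intro sets.finite_UN finite_lessThan Jm)
        also have "\<dots> \<le> (\<Sum>k<Suc n. prob (?J k))"
          by (rule finite_measure_subadditive_finite) (use Jm in blast)+
        also have "\<dots> \<le> (\<Sum>k<Suc n. ?p k * (C * d))"
        proof (intro sum_mono)
          fix k
          have "prob (?J k) = prob {\<omega>\<in>space M. X (?t k) \<omega> \<in> {-x - e<..<-x + e}} * prob {\<omega>\<in>space M. X d \<omega> \<in> - {-\<delta>..\<delta>}}"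
            using d by (intro prob_increment_indep t0) auto
          also have "{\<omega>\<in>space M. X d \<omega> \<in> - {-\<delta>..\<delta>}} = {\<omega>\<in>space M. \<delta> < \<bar>X d \<omega>\<bar>}"
            by auto
          also have "{\<omega>\<in>space M. X (?t k) \<omega> \<in> {-x - e<..<-x + e}} = {\<omega>\<in>space M. \<bar>x + X (?t k) \<omega>\<bar> < e}"
            by (auto simp: abs_less_iff)
          also have "?p k * prob {\<omega>\<in>space M. \<delta> < \<bar>X d \<omega>\<bar>} \<le> ?p k * (C * d)"
            using d C(2)[of d] by (intro mult_left_mono) auto
          finally show "prob (?J k) \<le> ?p k * (C * d)" .
        qed
        finally show ?thesis .
      qed
      also have "\<dots> = C * (\<Sum>k<Suc n. ?p k * d)"
        by (simp add: sum_distrib_left mult_ac del: sum.lessThan_Suc)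
      finally have le: "prob (jump_near_zero x T e \<delta> n) \<le> C * (\<Sum>k<Suc n. ?p k * d)" .
      have sum: "(\<Sum>k<Suc n. ?p k * d) \<le> 2 * exp T * 4 * pot_bound 1 * e"
      proof -
        have [measurable]: "(\<lambda>z. X (max (fst z) 0) (snd z)) \<in> borel_measurable (lborel \<Otimes>\<^sub>M M)"
          by (intro measurable_X_compose) auto
        have Pm[measurable]: "?P \<in> borel_measurable lborel"
        proof -
          have "(\<lambda>s. enn2real (\<integral>\<^sup>+\<omega>. indicator {-(2*e)<..<2*e} (x + X (max s 0) \<omega>) \<partial>M)) \<in> borel_measurable lborel"
            by (intro borel_measurable_enn2real borel_measurable_nn_integral) (simp add: split_beta', measurable)
          also have "(\<lambda>s. enn2real (\<integral>\<^sup>+\<omega>. indicator {-(2*e)<..<2*e} (x + X (max s 0) \<omega>) \<partial>M)) = ?P"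
          proof
            fix s
            have [measurable]: "X (max s 0) \<in> borel_measurable M" by (intro X_measurable) auto
            have "(\<integral>\<^sup>+\<omega>. indicator {-(2*e)<..<2*e} (x + X (max s 0) \<omega>) \<partial>M) =
               (\<integral>\<^sup>+\<omega>. indicator {\<omega>\<in>space M. \<bar>x + X (max s 0) \<omega>\<bar> < 2 * e} \<omega> \<partial>M)"
              by (intro nn_integral_cong) (auto simp: indicator_def)
            also have "\<dots> = ennreal (?P s)" unfolding emeasure_eq_measure[symmetric]
              by (rule nn_integral_indicator) measurable
            finally show "enn2real (\<integral>\<^sup>+\<omega>. indicator {-(2*e)<..<2*e} (x + X (max s 0) \<omega>) \<partial>M) = ?P s" by simp
          qed
          finally show ?thesis .
        qed
        have "ennreal (\<Sum>k<Suc n. ?p k * d) = (\<Sum>k<Suc n. ennreal (?p k) * ennreal d)"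
          using d by (subst sum_ennreal[symmetric]) (auto simp: ennreal_mult' simp del: sum.lessThan_Suc)
        also have "\<dots> = (\<Sum>k<Suc n. \<integral>\<^sup>+s. ennreal (?p k) * indicator {?t k..<?t (Suc k)} s \<partial>lborel)"
          using d by (intro sum.cong refl) (simp add: nn_integral_cmult_indicator step)
        also have "\<dots> \<le> (\<Sum>k<Suc n. \<integral>\<^sup>+s. indicator {?t k..<?t (Suc k)} s * ennreal (2 * ?P s) \<partial>lborel)"
        proof (intro sum_mono nn_integral_mono)
          fix k s
          show "ennreal (?p k) * indicator {?t k..<?t (Suc k)} s \<le> indicator {?t k..<?t (Suc k)} s * ennreal (2 * ?P s)"
            using cell[of s k] by (auto simp: indicator_def ennreal_leI simp del: ennreal_mult'')
        qed
        also have "\<dots> = (\<integral>\<^sup>+s. (\<Sum>k<Suc n. indicator {?t k..<?t (Suc k)} s * ennreal (2 * ?P s)) \<partial>lborel)"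
          by (rule nn_integral_sum[symmetric]) measurable
        also have "\<dots> = (\<integral>\<^sup>+s. ennreal 2 * (indicator {0..<T} s * ennreal (?P s)) \<partial>lborel)"
        proof (intro nn_integral_cong)
          fix s
          have "(\<Sum>k<Suc n. indicator {?t k..<?t (Suc k)} s * ennreal (2 * ?P s)) = (\<Sum>k<Suc n. indicator {?t k..<?t (Suc k)} s) * ennreal (2 * ?P s)"
            by (rule sum_distrib_right[symmetric])
          also have "(\<Sum>k<Suc n. indicator {?t k..<?t (Suc k)} s :: ennreal) = indicator {?t 0..<?t (Suc n)} s"
            using T by (intro sum_indicator_consecutive grid_time_mono) auto
          finally show "(\<Sum>k<Suc n. indicator {?t k..<?t (Suc k)} s * ennreal (2 * ?P s)) = ennreal 2 * (indicator {0..<T} s * ennreal (?P s))"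
            by (simp add: ennreal_mult' mult_ac grid_time_def[of T n 0])
        qed
        also have "\<dots> = ennreal 2 * (\<integral>\<^sup>+s. indicator {0..<T} s * ennreal (?P s) \<partial>lborel)"
          by (rule nn_integral_cmult) measurable
        also have "\<dots> \<le> ennreal 2 * ennreal (exp T * (2 * (2 * e) * pot_bound 1))"
          using e by (intro mult_left_mono occupation_time_bound) auto
        also have "\<dots> = ennreal (2 * exp T * 4 * pot_bound 1 * e)"
          using e pb by (subst ennreal_mult[symmetric]) (auto simp: mult_ac)
        finally show ?thesis
          using e pb by (subst (asm) ennreal_le_iff) auto
      qed
      from order_trans[OF le mult_left_mono[OF sum C(1)]]
      show ?case by (simp only: mult_ac)
    qed
  qed
  show ?thesis
    using main C(1) pb by (intro exI[of _ "C * 2 * exp T * 4 * pot_bound 1"]) auto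
qed

end

section \<open>Hitting times of zero\<close>

lemma hit_zero_le:
  assumes "0 < s" "s \<le> t" "w s = 0"
  shows "hit_zero w \<le> ereal t"
proof -
  have "hit_zero w \<le> ereal s" unfolding hit_zero_def using assms by (intro Inf_lower) auto
  also have "ereal s \<le> ereal t" using assms(2) by simp
  finally show ?thesis .
qed

context levy_symbol
begin

text \<open>The cell that contains \<open>s\<close> in its right-closed version is the witness: its
  left end is close to the left limit 0, its right end is close to \<open>X s\<close>.\<close>

lemma eventually_jump_near_zero:
  assumes \<omega>: "\<omega> \<in> space M" and s: "0 < s" "s < T" and e: "e > 0"
    and left: "((\<lambda>u. x + X u \<omega>) \<longlongrightarrow> 0) (at_left s)" and jump: "\<delta> < \<bar>x + X s \<omega>\<bar>"
  shows "\<forall>\<^sub>F n in sequentially. \<omega> \<in> jump_near_zero x T e \<delta> n"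
proof -
  \<comment> \<open>A third of the excess over \<open>\<delta>\<close>: an error
    \<open>\<rho>\<close> at each end of the cell still leaves a displacement above
    \<open>\<delta>\<close>.\<close>
  define \<rho> where "\<rho> = (\<bar>x + X s \<omega>\<bar> - \<delta>) / 3"
  have \<rho>: "\<rho> > 0" "\<bar>x + X s \<omega>\<bar> = \<delta> + 3 * \<rho>" using jump by (simp_all add: \<rho>_def field_simps)
  have "\<forall>\<^sub>F u in at_left s. dist (x + X u \<omega>) 0 < min e \<rho>"
    using left e \<rho> by (intro tendstoD) auto
  then obtain b where b: "b < s" "\<And>u. b < u \<Longrightarrow> u < s \<Longrightarrow> \<bar>x + X u \<omega>\<bar> < min e \<rho>"
    unfolding eventually_at_left_field by auto
  have "\<forall>\<^sub>F u in at_right s. dist (X u \<omega>) (X s \<omega>) < \<rho>"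
    using X_right_continuous[of s \<omega>] s \<rho> by (intro tendstoD) auto
  then obtain b' where b': "s < b'" "\<And>u. s < u \<Longrightarrow> u < b' \<Longrightarrow> \<bar>X u \<omega> - X s \<omega>\<bar> < \<rho>"
    unfolding eventually_at_right_field dist_real_def by auto
  \<comment> \<open>A nonnegative point strictly between \<open>b\<close> and \<open>s\<close>. A
    grid point in \<open>[a, s)\<close> forces the last grid point before \<open>s\<close> beyond
    \<open>b\<close>, and shows that the first one at or after \<open>s\<close> is not index
    0.\<close>
  define a where "a = (max b 0 + s) / 2"
  have a: "0 \<le> a" "b < a" "a < s" using b s by (auto simp: a_def max_def)
  have T: "0 < T" using s by simp
  from eventually_grid_point[OF a(1,3) T] eventually_grid_point[OF less_imp_le[OF s(1)] b'(1) T]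
  show ?thesis
  proof eventually_elim
    case (elim n)
    let ?t = "grid_time T n"
    obtain i where i: "a \<le> ?t i" "?t i < s" using elim(1) by (auto simp: grid_time_def)
    obtain j0 where j0: "s \<le> ?t j0" "?t j0 < b'" using elim(2) by (auto simp: grid_time_def)
    define j where "j = (LEAST j. s \<le> ?t j)"
    have j: "s \<le> ?t j" unfolding j_def by (rule LeastI[of "\<lambda>j. s \<le> ?t j", OF j0(1)])
    have "j \<le> j0" unfolding j_def by (rule Least_le[of "\<lambda>j. s \<le> ?t j", OF j0(1)])
    then have jb: "?t j < b'" using grid_time_mono[of T j j0 n] j0 T by simp
    have "i < j" using i j grid_time_mono[of T j i n] T by (meson le_less_trans less_imp_le linorder_not_less)
    then obtain k where k: "j = Suc k" by (cases j) auto
    have tk: "?t k < s" using not_less_Least[of k "\<lambda>j. s \<le> ?t j"] k by (simp add: j_def)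
    have "?t i \<le> ?t k" using \<open>i < j\<close> k T by (intro grid_time_mono) auto
    then have "b < ?t k" using a i by simp
    then have near: "\<bar>x + X (?t k) \<omega>\<bar> < min e \<rho>" using b(2) tk by blast
    have close: "\<bar>X (?t j) \<omega> - X s \<omega>\<bar> < \<rho>"
      using b'(2)[of "?t j"] j jb \<rho> by (cases "?t j = s") auto
    have "\<delta> < \<bar>X (?t j) \<omega> - X (?t k) \<omega>\<bar>" using near close \<rho> by linarith
    moreover have "k < Suc n" using grid_time_less_imp[of T n k "Suc n"] tk s T by simp
    ultimately show ?case
      unfolding jump_near_zero_def using near \<omega> k by auto
  qed
qed

text \<open>A forbidden jump is seen by all sufficiently fine grids at every radius, so it puts
  \<open>\<omega>\<close> into the limit inferior of the grid events for each \<open>i\<close>. That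
  limit inferior has probability at most \<open>K / Suc i\<close>, and \<open>i\<close> is
  arbitrary.\<close>

lemma AE_small_jump_from_zero:
  assumes T: "T > 0" and \<delta>: "\<delta> > 0"
  shows "AE \<omega> in M. \<forall>s. 0 < s \<longrightarrow> s < T \<longrightarrow> ((\<lambda>u. x + X u \<omega>) \<longlongrightarrow> 0) (at_left s) \<longrightarrow> \<bar>x + X s \<omega>\<bar> \<le> \<delta>"
proof -
  obtain K where K: "K \<ge> 0" "\<And>e. e > 0 \<Longrightarrow> \<forall>\<^sub>F n in sequentially. prob (jump_near_zero x T e \<delta> n) \<le> K * e"
    using prob_jump_near_zero[OF T \<delta>, of x] by blast
  define J where "J i = jump_near_zero x T (1 / real (Suc i)) \<delta>" for i
  have Jm: "J i n \<in> sets M" for i n unfolding J_def using T by (intro jump_near_zero_sets) simp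
  define B where "B i m = (\<Inter>n\<in>{m..}. J i n)" for i m
  have Bm: "B i m \<in> sets M" for i m unfolding B_def using Jm by (intro sets.countable_INT') auto
  define N where "N = (\<Inter>i. \<Union>m. B i m)"
  have Um: "(\<Union>m. B i m) \<in> sets M" for i using Bm by (intro sets.countable_UN) auto
  have Nm: "N \<in> sets M" unfolding N_def using Um by (intro sets.countable_INT) auto
  have "prob N \<le> K * (1 / real (Suc i))" for i
  proof -
    have "incseq (B i)" by (auto simp: incseq_def B_def)
    then have lim: "(\<lambda>m. prob (B i m)) \<longlonglongrightarrow> prob (\<Union>m. B i m)"
      using Bm by (intro finite_Lim_measure_incseq) auto
    have "prob (B i m) \<le> K * (1 / real (Suc i))" for m
    proof -
      obtain n0 where n0: "\<And>n. n \<ge> n0 \<Longrightarrow> prob (J i n) \<le> K * (1 / real (Suc i))"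
        using K(2)[of "1 / real (Suc i)"] by (auto simp: J_def eventually_sequentially)
      have "prob (B i m) \<le> prob (J i (max m n0))"
        by (rule finite_measure_mono[OF _ Jm]) (auto simp: B_def)
      also have "\<dots> \<le> K * (1 / real (Suc i))" by (rule n0) simp
      finally show ?thesis .
    qed
    then have "prob (\<Union>m. B i m) \<le> K * (1 / real (Suc i))"
      by (intro LIMSEQ_le_const2[OF lim]) auto
    moreover have "prob N \<le> prob (\<Union>m. B i m)"
      by (rule finite_measure_mono[OF _ Um]) (auto simp: N_def)
    ultimately show ?thesis by simp
  qed
  then have "\<exists>i0. \<forall>i\<ge>i0. prob N \<le> K * (1 / real (Suc i))" by blast
  moreover have "(\<lambda>i. K * (1 / real (Suc i))) \<longlonglongrightarrow> K * 0"
    by (intro tendsto_intros LIMSEQ_Suc[OF lim_1_over_n])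
  ultimately have "prob N \<le> K * 0" by (rule LIMSEQ_le_const[rotated])
  then have "N \<in> null_sets M" using Nm by (auto simp: null_sets_def emeasure_eq_measure antisym)
  then show ?thesis
  proof (rule AE_I')
    show "{\<omega> \<in> space M. \<not> (\<forall>s. 0 < s \<longrightarrow> s < T \<longrightarrow> ((\<lambda>u. x + X u \<omega>) \<longlongrightarrow> 0) (at_left s) \<longrightarrow> \<bar>x + X s \<omega>\<bar> \<le> \<delta>)} \<subseteq> N"
    proof
      fix \<omega> assume "\<omega> \<in> {\<omega> \<in> space M. \<not> (\<forall>s. 0 < s \<longrightarrow> s < T \<longrightarrow> ((\<lambda>u. x + X u \<omega>) \<longlongrightarrow> 0) (at_left s) \<longrightarrow> \<bar>x + X s \<omega>\<bar> \<le> \<delta>)}"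
      then obtain s where s: "\<omega> \<in> space M" "0 < s" "s < T" "((\<lambda>u. x + X u \<omega>) \<longlongrightarrow> 0) (at_left s)" "\<delta> < \<bar>x + X s \<omega>\<bar>"
        by (auto simp: not_le)
      have "\<exists>m. \<forall>n\<ge>m. \<omega> \<in> J i n" for i
        using eventually_jump_near_zero[OF s(1,2,3) _ s(4,5), of "1 / real (Suc i)"]
        by (simp add: J_def eventually_sequentially)
      then have "\<exists>m. \<omega> \<in> B i m" for i
        unfolding B_def by (simp only: INT_iff atLeast_iff) blast
      then show "\<omega> \<in> N" by (simp add: N_def)
    qed
  qed
qed

lemma AE_no_jump_from_zero:
  "AE \<omega> in M. \<forall>s>0. ((\<lambda>u. x + X u \<omega>) \<longlongrightarrow> 0) (at_left s) \<longrightarrow> x + X s \<omega> = 0"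
proof -
  have "AE \<omega> in M. \<forall>i m :: nat. \<forall>s. 0 < s \<longrightarrow> s < real (Suc i) \<longrightarrow> ((\<lambda>u. x + X u \<omega>) \<longlongrightarrow> 0) (at_left s) \<longrightarrow> \<bar>x + X s \<omega>\<bar> \<le> 1 / real (Suc m)"
    unfolding AE_all_countable by (intro allI AE_small_jump_from_zero) auto
  then show ?thesis
  proof eventually_elim
    case (elim \<omega>)
    show ?case
    proof (intro allI impI)
      fix s :: real assume s: "0 < s" and left: "((\<lambda>u. x + X u \<omega>) \<longlongrightarrow> 0) (at_left s)"
      obtain i :: nat where "s < real i" using reals_Archimedean2 by blast
      then have "s < real (Suc i)" by simp
      with elim s left have "\<exists>m0. \<forall>m\<ge>m0. \<bar>x + X s \<omega>\<bar> \<le> 1 / real (Suc m)" by blast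
      moreover have "(\<lambda>m. 1 / real (Suc m)) \<longlonglongrightarrow> 0" by (rule LIMSEQ_Suc[OF lim_1_over_n])
      ultimately have "\<bar>x + X s \<omega>\<bar> \<le> 0" by (rule LIMSEQ_le_const[rotated])
      then show "x + X s \<omega> = 0" by simp
    qed
  qed
qed

text \<open>Times at which the path is ever closer to zero accumulate at some \<open>s\<close>. If
  the value at \<open>s\<close> were nonzero, right continuity would push these times to the left of
  \<open>s\<close>, so the left limit at \<open>r + s\<close> would be zero and the hypothesis on
  jumps would give a contradiction.\<close>

lemma path_hits_zero:
  assumes r: "0 \<le> r" and \<omega>: "\<omega> \<in> space M" "\<omega> \<notin> avoid_zero x r t"
    and nj: "\<And>s. s > 0 \<Longrightarrow> ((\<lambda>u. x + X u \<omega>) \<longlongrightarrow> 0) (at_left s) \<Longrightarrow> x + X s \<omega> = 0"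
  shows "\<exists>s\<in>{0..t}. x + X (r + s) \<omega> = 0"
proof -
  have "\<forall>m. \<exists>s\<in>{0..t}. \<bar>x + X (r + s) \<omega>\<bar> < 1 / real (Suc m)"
    using \<omega> by (auto simp: avoid_zero_def avoid_def not_le)
  then obtain f where f: "\<And>m. f m \<in> {0..t}" "\<And>m. \<bar>x + X (r + f m) \<omega>\<bar> < 1 / real (Suc m)"
    by metis
  obtain s k where s: "s \<in> {0..t}" and k: "strict_mono k" "(f \<circ> k) \<longlonglongrightarrow> s"
    using compact_Icc[of 0 t] f(1) unfolding compact_def by metis
  have "(\<lambda>m. x + X (r + f m) \<omega>) \<longlonglongrightarrow> 0"
    by (rule Lim_null_comparison[OF always_eventually LIMSEQ_Suc[OF lim_1_over_n]])
       (use f(2) in \<open>simp add: less_imp_le del: of_nat_Suc\<close>)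
  then have zero: "(\<lambda>m. x + X (r + f (k m)) \<omega>) \<longlonglongrightarrow> 0"
    using LIMSEQ_subseq_LIMSEQ[OF _ k(1)] by (auto simp: comp_def)
  have "x + X (r + s) \<omega> = 0"
  proof (rule ccontr)
    assume nz: "x + X (r + s) \<omega> \<noteq> 0"
    define \<rho> where "\<rho> = \<bar>x + X (r + s) \<omega>\<bar> / 2"
    have \<rho>: "\<rho> > 0" "\<rho> < \<bar>x + X (r + s) \<omega>\<bar>" using nz by (auto simp: \<rho>_def)
    have "((\<lambda>u. \<bar>x + X u \<omega>\<bar>) \<longlongrightarrow> \<bar>x + X (r + s) \<omega>\<bar>) (at_right (r + s))"
      using r s by (intro tendsto_intros X_right_continuous) auto
    then have "\<forall>\<^sub>F u in at_right (r + s). \<rho> < \<bar>x + X u \<omega>\<bar>" using \<rho>(2) by (rule order_tendstoD(1))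
    then obtain b where b: "r + s < b" "\<And>u. r + s < u \<Longrightarrow> u < b \<Longrightarrow> \<rho> < \<bar>x + X u \<omega>\<bar>"
      unfolding eventually_at_right_field by blast
    have e1: "\<forall>\<^sub>F m in sequentially. f (k m) < b - r"
      using k(2) b(1) by (intro order_tendstoD(2)[where y=s]) (auto simp: comp_def)
    have "\<forall>\<^sub>F m in sequentially. dist (x + X (r + f (k m)) \<omega>) 0 < \<rho>"
      using zero \<rho>(1) by (rule tendstoD)
    with e1 have left: "\<forall>\<^sub>F m in sequentially. f (k m) < s"
    proof eventually_elim
      case (elim m)
      show ?case
      proof (rule ccontr)
        assume "\<not> f (k m) < s"
        then consider "f (k m) = s" | "s < f (k m)" by linarith
        then show False
          using elim b(2)[of "r + f (k m)"] \<rho>(2) by cases (auto simp: dist_real_def)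
      qed
    qed
    have "0 < s"
    proof -
      obtain m where "f (k m) < s" using left by (auto simp: eventually_sequentially)
      then show ?thesis using f(1)[of "k m"] by simp
    qed
    then have rs: "0 < r + s" using r by simp
    then obtain l where l: "((\<lambda>u. X u \<omega>) \<longlongrightarrow> l) (at_left (r + s))"
      using X_cadlag[of \<omega>] unfolding cadlag_def by blast
    have "filterlim (\<lambda>m. r + f (k m)) (at_left (r + s)) sequentially"
      unfolding filterlim_at
      using left tendsto_add[OF tendsto_const[of r] k(2)] by (auto simp: comp_def elim: eventually_mono)
    then have "(\<lambda>m. x + X (r + f (k m)) \<omega>) \<longlonglongrightarrow> x + l"
      by (intro tendsto_add tendsto_const filterlim_compose[OF l])
    then have "x + l = 0" using zero by (rule LIMSEQ_unique)
    moreover have "((\<lambda>u. x + X u \<omega>) \<longlongrightarrow> x + l) (at_left (r + s))" by (intro tendsto_intros l)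
    ultimately have "x + X (r + s) \<omega> = 0" using nj[OF rs] by simp
    then show False using nz by simp
  qed
  then show ?thesis using s by blast
qed

text \<open>The infimum must exceed \<open>t\<close> strictly. Nonvanishing at \<open>t\<close>
  extends by right continuity to some interval \<open>(t, b)\<close>, so no zero occurs before
  \<open>b\<close>.\<close>

lemma avoid_zero_imp_less_hit_zero:
  assumes t: "0 \<le> t" and \<omega>: "\<omega> \<in> avoid_zero x 0 t"
  shows "ereal t < hit_zero (\<lambda>s. x + X s \<omega>)"
proof -
  obtain m where "\<omega> \<in> avoid x 0 t (1 / real (Suc m))"
    using \<omega> unfolding avoid_zero_def by blast
  then have m: "1 / real (Suc m) \<le> \<bar>x + X s \<omega>\<bar>" if "s \<in> {0..t}" for s
    using that by (simp add: avoid_def)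
  have pos: "0 < 1 / real (Suc m)" by simp
  have nz: "0 < \<bar>x + X s \<omega>\<bar>" if "s \<in> {0..t}" for s using less_le_trans[OF pos m[OF that]] .
  have "((\<lambda>u. \<bar>x + X u \<omega>\<bar>) \<longlongrightarrow> \<bar>x + X t \<omega>\<bar>) (at_right t)"
    using t by (intro tendsto_intros X_right_continuous)
  then have "\<forall>\<^sub>F u in at_right t. 0 < \<bar>x + X u \<omega>\<bar>" using nz[of t] t by (intro order_tendstoD(1)) auto
  then obtain b where b: "t < b" "\<And>u. t < u \<Longrightarrow> u < b \<Longrightarrow> 0 < \<bar>x + X u \<omega>\<bar>"
    unfolding eventually_at_right_field by blast
  have "ereal b \<le> hit_zero (\<lambda>s. x + X s \<omega>)"
    unfolding hit_zero_def
  proof (rule Inf_greatest)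
    fix y assume "y \<in> {ereal s |s. 0 < s \<and> x + X s \<omega> = 0}"
    then obtain s where s: "y = ereal s" "0 < s" "x + X s \<omega> = 0" by blast
    have "\<not> s < b" using nz[of s] b(2)[of s] s t by (cases "s \<le> t") auto
    then show "ereal b \<le> y" using s by simp
  qed
  moreover have "ereal t < ereal b" using b(1) by simp
  ultimately show ?thesis by (rule less_le_trans[rotated])
qed

text \<open>Regularity of zero for itself. Starting the search at \<open>r n > 0\<close> makes the
  zero found strictly positive; \<open>r n\<close> and the search length are each at most
  \<open>t / 2\<close>, so it comes no later than \<open>t\<close>.\<close>

lemma AE_hits_zero_immediately:
  assumes t: "0 < t"
  shows "AE \<omega> in M. \<exists>s. 0 < s \<and> s \<le> t \<and> 0 + X s \<omega> = 0"
proof -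
  define r where "r n = t / 2 * (1 / real (Suc n))" for n
  have r: "0 < r n" "r n \<le> t / 2" for n
    using t mult_left_mono[of "1 / real (Suc n)" 1 "t / 2"] by (auto simp: r_def)
  have rlim: "r \<longlonglongrightarrow> 0"
    using tendsto_mult[OF tendsto_const[of "t/2"] LIMSEQ_Suc[OF lim_1_over_n]] by (simp add: r_def[abs_def])
  let ?A = "\<lambda>n. avoid_zero 0 (r n) (t / 2)"
  have Am: "?A n \<in> sets M" for n using r[of n] t by (intro avoid_zero_sets) auto
  have Im: "(\<Inter>n. ?A n) \<in> sets M" using Am by (intro sets.countable_INT) auto
  have "(\<lambda>n. prob (?A n)) \<longlonglongrightarrow> 0"
    using t r(1) rlim by (intro avoid_zero_prob_tendsto_0) (auto intro: less_imp_le)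
  moreover have "prob (\<Inter>n. ?A n) \<le> prob (?A n)" for n
    by (rule finite_measure_mono[OF _ Am]) blast
  then have "\<exists>n0. \<forall>n\<ge>n0. prob (\<Inter>n. ?A n) \<le> prob (?A n)" by blast
  ultimately have "prob (\<Inter>n. ?A n) \<le> 0" by (rule LIMSEQ_le_const)
  then have "(\<Inter>n. ?A n) \<in> null_sets M" using Im by (auto simp: null_sets_def emeasure_eq_measure antisym)
  then have "AE \<omega> in M. \<omega> \<notin> (\<Inter>n. ?A n)" by (rule AE_not_in)
  with AE_no_jump_from_zero[of 0] AE_space show ?thesis
  proof eventually_elim
    case (elim \<omega>)
    then obtain n where n: "\<omega> \<notin> ?A n" by blast
    obtain s where s: "s \<in> {0..t / 2}" "0 + X (r n + s) \<omega> = 0"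
      using path_hits_zero[OF less_imp_le[OF r(1)] elim(2) n] elim(1) by blast
    then show ?case using r[of n] by (intro exI[of _ "r n + s"]) auto
  qed
qed

text \<open>\<open>avoid_zero\<close> inspects time 0 whereas the hitting time does not, so the two
  events can disagree only for \<open>x = 0\<close>. Then at \<open>t = 0\<close> both sides vanish
  because \<open>f 0 = 0\<close>, and for \<open>t > 0\<close> because the path has returned to zero
  by then.\<close>

lemma AE_killed_eval:
  assumes t: "0 \<le> t" and f0: "f 0 = 0"
  shows "AE \<omega> in M. killed_eval X x f t \<omega> = indicator (avoid_zero x 0 t) \<omega> * f (x + X t \<omega>)"
proof -
  consider "x \<noteq> 0" | "x = 0" "t = 0" | "x = 0" "t > 0" using t by fastforce
  then show ?thesis
  proof cases
    case 1
    from AE_no_jump_from_zero[of x] AE_space show ?thesis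
    proof eventually_elim
      case (elim \<omega>)
      show ?case
      proof (cases "\<omega> \<in> avoid_zero x 0 t")
        case True
        then show ?thesis using avoid_zero_imp_less_hit_zero[OF t True] by (simp add: killed_eval_def)
      next
        case False
        obtain s where s: "s \<in> {0..t}" "x + X (0 + s) \<omega> = 0"
          using path_hits_zero[OF order_refl elim(2) False] elim(1) by blast
        then have "s \<noteq> 0" using 1 X_zero[of \<omega>] by auto
        then have "hit_zero (\<lambda>s. x + X s \<omega>) \<le> ereal t" using s by (intro hit_zero_le[of s]) auto
        then show ?thesis using False by (simp add: killed_eval_def not_less[symmetric])
      qed
    qed
  next
    case 2
    then show ?thesis by (simp add: killed_eval_def X_zero f0)
  next
    case 3
    from AE_hits_zero_immediately[OF 3(2)] show ?thesis
    proof eventually_elim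
      case (elim \<omega>)
      then have "hit_zero (\<lambda>s. 0 + X s \<omega>) \<le> ereal t" by (auto intro: hit_zero_le)
      moreover have "\<omega> \<notin> avoid_zero 0 0 t"
        using t X_zero[of \<omega>] by (auto simp: avoid_zero_def avoid_def intro!: bexI[of _ 0])
      ultimately show ?case using 3(1) by (simp add: killed_eval_def not_less[symmetric])
    qed
  qed
qed

end

section \<open>The limit of vanishing killing rate\<close>

lemma borel_measurable_completion_AE:
  fixes f g :: "'a \<Rightarrow> real"
  assumes ae: "AE x in M. f x = g x" and g: "g \<in> borel_measurable M"
  shows "f \<in> borel_measurable (completion M)"
proof (rule measurableI)
  fix A :: "real set" assume A: "A \<in> sets borel"
  have "f -` A \<inter> space M \<in> sets (completion M)"
  proof (rule completion.in_sets_AE)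
    show "AE x in completion M. x \<in> g -` A \<inter> space M \<longleftrightarrow> x \<in> f -` A \<inter> space M"
      using AE_completion[OF ae] by eventually_elim auto
    show "g -` A \<inter> space M \<in> sets (completion M)"
      using measurable_sets[OF g A] by (rule sets_completionI_sets)
  qed simp
  then show "f -` A \<inter> space (completion M) \<in> sets (completion M)" by simp
qed simp

lemma integral_even:
  fixes F :: "real \<Rightarrow> real"
  assumes F: "integrable lborel F" and even: "\<And>u. F (- u) = F u"
  shows "(LINT u|lborel. F u) = 2 * (LBINT u:{0<..}. F u)"
proof -
  have [measurable]: "F \<in> borel_measurable borel" using F by auto
  have int: "integrable lborel (\<lambda>u. indicator {0<..} u * F u)" "integrable lborel (\<lambda>u. indicator {..<0} u * F u)"
    by (rule Bochner_Integration.integrable_bound[OF F]; auto simp: indicator_def)+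
  have "(LINT u|lborel. F u) = (LINT u|lborel. indicator {0<..} u * F u + indicator {..<0} u * F u)"
  proof (rule integral_cong_AE)
    show "AE u in lborel. F u = indicator {0<..} u * F u + indicator {..<0} u * F u"
      using AE_lborel_singleton[of "0 :: real"] by eventually_elim (auto simp: indicator_def)
  qed measurable
  also have "\<dots> = (LINT u|lborel. indicator {0<..} u * F u) + (LINT u|lborel. indicator {..<0} u * F u)"
    by (rule Bochner_Integration.integral_add[OF int])
  also have "(LINT u|lborel. indicator {..<0} u * F u) = (LINT u|lborel. indicator {..<0} (0 + (-1) * u) * F (0 + (-1) * u))"
    by (subst lborel_integral_real_affine[where c="-1" and t=0]) auto
  also have "\<dots> = (LINT u|lborel. indicator {0<..} u * F u)"
    by (intro Bochner_Integration.integral_cong refl) (auto simp: even indicator_def)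
  finally show ?thesis by (simp add: set_lebesgue_integral_def)
qed

lemma one_minus_cos_le: "1 - cos (u * x) \<le> (2 + x\<^sup>2) * min (u\<^sup>2) 1" for u x :: real
proof (cases "u\<^sup>2 \<le> 1")
  case True
  have "\<bar>Re (iexp (u * x) - (\<Sum>k\<le>1. (\<i> * complex_of_real (u * x)) ^ k / fact k))\<bar> \<le> \<bar>u * x\<bar> ^ 2 / fact 2"
    using order_trans[OF abs_Re_le_cmod iexp_approx1[of "u * x" 1]] by (simp add: eval_nat_numeral)
  then have "1 - cos (u * x) \<le> (u * x)\<^sup>2 / 2" by (simp add: Re_exp abs_le_iff)
  also have "\<dots> \<le> (2 + x\<^sup>2) * u\<^sup>2" by (simp add: power_mult_distrib algebra_simps)
  finally show ?thesis using True by simp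
next
  case False
  have "1 - cos (u * x) \<le> 2" using cos_ge_minus_one[of "u * x"] by linarith
  also have "\<dots> \<le> 2 + x\<^sup>2" by simp
  finally show ?thesis using False by simp
qed

text \<open>\<open>2 * (1 - cos a)\<close> is the squared distance from \<open>iexp a\<close> to 1,
  so this is the triangle inequality squared. It separates the starting point from
  \<open>X t\<close>.\<close>

lemma one_minus_cos_add_le: "1 - cos (a + b) \<le> 2 * (1 - cos a) + 2 * (1 - cos b)" for a b :: real
proof -
  have "2 * (sin a * sin b) \<le> (sin a)\<^sup>2 + (sin b)\<^sup>2"
    using sum_squares_bound[of "sin a" "sin b"] by simp
  also have "\<dots> = 2 - (cos a)\<^sup>2 - (cos b)\<^sup>2" by (simp add: sin_squared_eq)
  finally have 1: "2 * (sin a * sin b) \<le> 2 - (cos a)\<^sup>2 - (cos b)\<^sup>2" .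
  have 2: "0 \<le> (1 - cos a)\<^sup>2 + (1 - cos b)\<^sup>2" by simp
  have 3: "0 \<le> (1 - cos a) * (1 - cos b)" by (intro mult_nonneg_nonneg) auto
  show ?thesis
    using 1 2 3 unfolding cos_add power2_diff by (simp add: algebra_simps)
qed

lemma Re_one_minus_iexp_mult:
  "Re ((1 - iexp (u * x)) * z) = (1 - cos (u * x)) * Re z + sin (u * x) * Im z"
  by (simp add: Re_exp Im_exp)

context levy_symbol
begin

lemma pot_diff_eq:
  assumes q: "q > 0"
  shows "integrable lborel (\<lambda>u. Re ((1 - iexp (u * x)) * resolvent q u))"
    "pot_diff q x = 1 / (2 * pi) * (LINT u|lborel. Re ((1 - iexp (u * x)) * resolvent q u))"
proof -
  note int = integrable_Re[OF pot_integrands(1)[OF q]]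
  have eq: "Re ((1 - iexp (u * x)) * resolvent q u) = Re (iexp (u * 0) * resolvent q u) - Re (iexp (u * x) * resolvent q u)" for u
    by (simp add: left_diff_distrib)
  show "integrable lborel (\<lambda>u. Re ((1 - iexp (u * x)) * resolvent q u))"
    unfolding eq by (intro Bochner_Integration.integrable_diff int)
  show "pot_diff q x = 1 / (2 * pi) * (LINT u|lborel. Re ((1 - iexp (u * x)) * resolvent q u))"
    unfolding eq Bochner_Integration.integral_diff[OF int int] pot_diff_def pot_def by (rule right_diff_distrib[symmetric])
qed

lemma pot_diff_half_line:
  assumes q: "q > 0"
  shows "pot_diff q x = 1 / pi * (LBINT u:{0<..}. Re ((1 - iexp (u * x)) * resolvent q u))"
proof -
  have "Re ((1 - iexp (- u * x)) * resolvent q (- u)) = Re ((1 - iexp (u * x)) * resolvent q u)" for u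
  proof -
    have "(1 - iexp (- u * x)) * resolvent q (- u) = cnj ((1 - iexp (u * x)) * resolvent q u)"
      by (simp add: resolvent_minus exp_cnj)
    then show ?thesis by simp
  qed
  from integral_even[OF pot_diff_eq(1)[OF q] this]
  show ?thesis unfolding pot_diff_eq(2)[OF q] by simp
qed

text \<open>The real number \<open>q\<close> leaves the numerator \<open>Im (\<eta> u)\<close> alone
  and only enlarges the denominator. Thus (B), which concerns \<open>q = 0\<close>, dominates for
  all \<open>q\<close>.\<close>

lemma abs_Im_resolvent_le:
  assumes "q > 0" "u \<noteq> 0"
  shows "\<bar>Im (resolvent q u)\<bar> \<le> \<bar>Im (1 / \<eta> u)\<bar>"
proof -
  have ne: "0 < cmod (\<eta> u)" using symbol_nonzero[OF assms(2)] by simp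
  have le: "cmod (\<eta> u) \<le> cmod (complex_of_real q - \<eta> u)" using assms(1) by (intro cmod_minus_symbol_ge) simp
  have Im: "\<bar>Im (1 / z)\<bar> = \<bar>Im z\<bar> / (cmod z)\<^sup>2" for z
    by (simp add: Im_divide cmod_power2)
  have "\<bar>Im (resolvent q u)\<bar> = \<bar>Im (\<eta> u)\<bar> / (cmod (complex_of_real q - \<eta> u))\<^sup>2"
    unfolding resolvent_def Im by simp
  also have "\<dots> \<le> \<bar>Im (\<eta> u)\<bar> / (cmod (\<eta> u))\<^sup>2"
    using ne le by (intro divide_left_mono power_mono mult_pos_pos) auto
  finally show ?thesis unfolding Im .
qed

lemma cos_resolvent_le:
  assumes "q > 0"
  shows "(1 - cos (u * x)) * \<bar>Re (resolvent q u)\<bar> \<le> (1 - cos (u * x)) / cmod (\<eta> u)"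
proof (cases "u = 0")
  case False
  have "\<bar>Re (resolvent q u)\<bar> \<le> 1 / cmod (\<eta> u)"
    using cmod_resolvent_le[OF assms symbol_nonzero[OF False]] abs_Re_le_cmod[of "resolvent q u"] by linarith
  then have "(1 - cos (u * x)) * \<bar>Re (resolvent q u)\<bar> \<le> (1 - cos (u * x)) * (1 / cmod (\<eta> u))"
    by (intro mult_left_mono) auto
  then show ?thesis by simp
qed simp

lemma one_minus_cos_div_le:
  "(1 - cos (u * x)) / cmod (\<eta> u) \<le> (2 + x\<^sup>2) * (min (u\<^sup>2) 1 / cmod (\<eta> u))"
  using divide_right_mono[OF one_minus_cos_le[of u x], of "cmod (\<eta> u)"] by simp

lemma one_minus_cos_div_integrable: "integrable lborel (\<lambda>u. (1 - cos (u * x)) / cmod (\<eta> u))"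
proof (rule Bochner_Integration.integrable_bound)
  show "integrable lborel (\<lambda>u. (2 + x\<^sup>2) * (min (u\<^sup>2) 1 / cmod (\<eta> u)))"
    by (intro integrable_mult_right inverse_symbol_integrable)
  show "AE u in lborel. norm ((1 - cos (u * x)) / cmod (\<eta> u)) \<le> norm ((2 + x\<^sup>2) * (min (u\<^sup>2) 1 / cmod (\<eta> u)))"
  proof (rule AE_I2)
    fix u
    have "0 \<le> (1 - cos (u * x)) / cmod (\<eta> u)" by (intro divide_nonneg_nonneg) auto
    then show "norm ((1 - cos (u * x)) / cmod (\<eta> u)) \<le> norm ((2 + x\<^sup>2) * (min (u\<^sup>2) 1 / cmod (\<eta> u)))"
      using one_minus_cos_div_le[of u x] by (simp only: real_norm_def)
  qed
qed measurable

text \<open>A majorant for all \<open>q\<close> without a sine term: estimating that term by means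
  of (B) costs a factor \<open>\<bar>y\<bar>\<close>, while \<open>X t\<close> may lack a first
  moment.\<close>

definition pot_diff_bound :: "real \<Rightarrow> real" where
  "pot_diff_bound y = 1 / pi * (LINT u|lborel. (1 - cos (u * y)) / cmod (\<eta> u))"

lemma pot_diff_le_bound:
  assumes q: "q > 0"
  shows "pot_diff q y \<le> pot_diff_bound y"
proof -
  have "pot_diff q y \<le> pot_diff q y + pot_diff q (- y)" using pot_diff_nonneg[OF q] by simp
  also have "\<dots> = 1 / (2 * pi) * ((LINT u|lborel. Re ((1 - iexp (u * y)) * resolvent q u)) + (LINT u|lborel. Re ((1 - iexp (u * (- y))) * resolvent q u)))"
    unfolding pot_diff_eq(2)[OF q] by (rule distrib_left[symmetric])
  also have "\<dots> = 1 / (2 * pi) * (LINT u|lborel. Re ((1 - iexp (u * y)) * resolvent q u) + Re ((1 - iexp (u * (- y))) * resolvent q u))"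
    by (simp only: Bochner_Integration.integral_add[OF pot_diff_eq(1)[OF q] pot_diff_eq(1)[OF q]])
  also have "\<dots> \<le> 1 / (2 * pi) * (LINT u|lborel. 2 * ((1 - cos (u * y)) / cmod (\<eta> u)))"
  proof (intro mult_left_mono integral_mono)
    show "integrable lborel (\<lambda>u. Re ((1 - iexp (u * y)) * resolvent q u) + Re ((1 - iexp (u * (- y))) * resolvent q u))"
      by (intro Bochner_Integration.integrable_add pot_diff_eq(1) q)
    show "integrable lborel (\<lambda>u. 2 * ((1 - cos (u * y)) / cmod (\<eta> u)))"
      by (intro integrable_mult_right one_minus_cos_div_integrable)
    fix u
    have "Re ((1 - iexp (u * y)) * resolvent q u) + Re ((1 - iexp (u * (- y))) * resolvent q u) = 2 * ((1 - cos (u * y)) * Re (resolvent q u))"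
      unfolding Re_one_minus_iexp_mult by simp
    also have "\<dots> \<le> 2 * ((1 - cos (u * y)) * \<bar>Re (resolvent q u)\<bar>)"
      by (intro mult_left_mono) auto
    also have "\<dots> \<le> 2 * ((1 - cos (u * y)) / cmod (\<eta> u))"
      by (intro mult_left_mono cos_resolvent_le q) simp
    finally show "Re ((1 - iexp (u * y)) * resolvent q u) + Re ((1 - iexp (u * (- y))) * resolvent q u) \<le> 2 * ((1 - cos (u * y)) / cmod (\<eta> u))" .
  qed simp
  also have "\<dots> = pot_diff_bound y" unfolding pot_diff_bound_def integral_mult_right_zero by simp
  finally show ?thesis .
qed

lemma pot_diff_bound_integrable:
  assumes t: "0 \<le> t"
  shows "integrable M (\<lambda>\<omega>. pot_diff_bound (x + X t \<omega>))"
proof (rule integrableI_nonneg)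
  have Xt[measurable]: "X t \<in> borel_measurable M" using t by (rule X_measurable)
  have "pot_diff_bound \<in> borel_measurable borel"
    unfolding pot_diff_bound_def[abs_def]
    by (intro borel_measurable_times borel_measurable_const lborel.borel_measurable_lebesgue_integral) (simp add: split_beta')
  then show "(\<lambda>\<omega>. pot_diff_bound (x + X t \<omega>)) \<in> borel_measurable M"
    by (rule measurable_compose[rotated]) measurable
  show "AE \<omega> in M. 0 \<le> pot_diff_bound (x + X t \<omega>)"
    unfolding pot_diff_bound_def by (intro AE_I2 mult_nonneg_nonneg Bochner_Integration.integral_nonneg divide_nonneg_nonneg) auto
  interpret P: pair_sigma_finite lborel M ..
  let ?c = "\<lambda>u \<omega>. (1 - cos (u * (x + X t \<omega>))) / cmod (\<eta> u)"
  let ?d = "\<lambda>u \<omega>. (2 * (1 - cos (u * x)) + 2 * (1 - cos (u * X t \<omega>))) / cmod (\<eta> u)"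
  let ?w = "\<lambda>u. min (u\<^sup>2) 1 / cmod (\<eta> u)"
  \<comment> \<open>The first summand stems from \<open>1 - cos (u * x)\<close>, the second from
    \<open>1 - cos (u * X t)\<close>, whose expectation over \<open>cmod (\<eta> u)\<close> is at
    most \<open>t\<close> on \<open>[-1, 1]\<close> and at most \<open>2 / cmod (\<eta> u)\<close>
    outside; the outer factors 2 come from \<open>one_minus_cos_add_le\<close>.\<close>
  let ?b = "\<lambda>u. 2 * ((2 + x\<^sup>2) * ?w u) + 2 * (t * indicator {-1..1} u + 2 * ?w u)"
  have bint: "integrable lborel ?b"
    by (intro Bochner_Integration.integrable_add integrable_mult_right inverse_symbol_integrable integrable_real_indicator)
       (auto simp: emeasure_lborel_Icc_eq)
  have b0: "0 \<le> ?b u" for u using t by (intro add_nonneg_nonneg mult_nonneg_nonneg divide_nonneg_nonneg) auto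
  have "(\<integral>\<^sup>+\<omega>. ennreal (pot_diff_bound (x + X t \<omega>)) \<partial>M) = (\<integral>\<^sup>+\<omega>. ennreal (1 / pi) * (\<integral>\<^sup>+u. ennreal (?c u \<omega>) \<partial>lborel) \<partial>M)"
  proof (intro nn_integral_cong)
    fix \<omega>
    have eq: "(\<integral>\<^sup>+u. ennreal (?c u \<omega>) \<partial>lborel) = ennreal (LINT u|lborel. ?c u \<omega>)"
      by (intro nn_integral_eq_integral one_minus_cos_div_integrable AE_I2 divide_nonneg_nonneg) auto
    show "ennreal (pot_diff_bound (x + X t \<omega>)) = ennreal (1 / pi) * (\<integral>\<^sup>+u. ennreal (?c u \<omega>) \<partial>lborel)"
      unfolding eq pot_diff_bound_def by (rule ennreal_mult') simp
  qed
  also have "\<dots> = ennreal (1 / pi) * (\<integral>\<^sup>+\<omega>. \<integral>\<^sup>+u. ennreal (?c u \<omega>) \<partial>lborel \<partial>M)"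
    by (rule nn_integral_cmult) (intro lborel.borel_measurable_nn_integral, simp add: split_beta')
  finally have eq: "(\<integral>\<^sup>+\<omega>. ennreal (pot_diff_bound (x + X t \<omega>)) \<partial>M) =
    ennreal (1 / pi) * (\<integral>\<^sup>+\<omega>. \<integral>\<^sup>+u. ennreal (?c u \<omega>) \<partial>lborel \<partial>M)" .
  have "(\<integral>\<^sup>+\<omega>. \<integral>\<^sup>+u. ennreal (?c u \<omega>) \<partial>lborel \<partial>M)
    = (\<integral>\<^sup>+u. \<integral>\<^sup>+\<omega>. ennreal (?c u \<omega>) \<partial>M \<partial>lborel)"
    by (rule P.Fubini') (simp add: split_beta')
  also have "\<dots> \<le> (\<integral>\<^sup>+u. ennreal (?b u) \<partial>lborel)"
  proof (intro nn_integral_mono)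
    fix u :: real
    let ?R = "Re (exp (complex_of_real t * \<eta> u))"
    have int: "integrable M (\<lambda>\<omega>. ?d u \<omega>)"
      using expectation_cos(1)[OF t, of u] by simp
    have "(\<integral>\<^sup>+\<omega>. ennreal (?c u \<omega>) \<partial>M)
      \<le> (\<integral>\<^sup>+\<omega>. ennreal (?d u \<omega>) \<partial>M)"
      using one_minus_cos_add_le[of "u * x"] by (intro nn_integral_mono ennreal_leI divide_right_mono) (auto simp: distrib_left)
    also have "\<dots> = ennreal (LINT \<omega>|M. ?d u \<omega>)"
      by (intro nn_integral_eq_integral int AE_I2 divide_nonneg_nonneg add_nonneg_nonneg) auto
    also have "(LINT \<omega>|M. ?d u \<omega>) =
      2 * ((1 - cos (u * x)) / cmod (\<eta> u)) + 2 * ((1 - ?R) / cmod (\<eta> u))"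
      using expectation_cos[OF t, of u] by (simp add: prob_space add_divide_distrib diff_divide_distrib)
    also have "\<dots> \<le> ?b u"
    proof (intro add_mono mult_left_mono one_minus_cos_div_le)
      show "(1 - ?R) / cmod (\<eta> u) \<le> t * indicator {-1..1} u + 2 * ?w u"
      proof (cases "u \<in> {-1..1}")
        case True
        \<comment> \<open>Where the symbol vanishes the quotient is 0 by the convention on division;
          elsewhere the numerator is at most \<open>t * cmod (\<eta> u)\<close>.\<close>
        have "(1 - ?R) / cmod (\<eta> u) \<le> t"
          using one_minus_Re_exp_le[OF t, of u] t by (cases "\<eta> u = 0") (auto simp: pos_divide_le_eq)
        moreover have "0 \<le> ?w u" by (intro divide_nonneg_nonneg) auto
        moreover have ind: "indicator {-1..1} u = (1 :: real)" using True by simp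
        ultimately show ?thesis unfolding ind by linarith
      next
        case False
        then have "1 \<le> u\<^sup>2" using abs_square_le_1[of u] by (auto simp: abs_le_iff)
        moreover have "1 - ?R \<le> 2"
        proof -
          have "- ?R \<le> cmod (exp (complex_of_real t * \<eta> u))" using abs_Re_le_cmod[of "exp (complex_of_real t * \<eta> u)"] by linarith
          also have "\<dots> \<le> 1" using t Re_symbol_le_0[of u] by (simp add: mult_nonneg_nonpos)
          finally show ?thesis by simp
        qed
        then have "(1 - ?R) / cmod (\<eta> u) \<le> 2 / cmod (\<eta> u)" by (intro divide_right_mono) auto
        ultimately show ?thesis using False by (simp add: min_absorb2)
      qed
    qed auto
    finally show "(\<integral>\<^sup>+\<omega>. ennreal (?c u \<omega>) \<partial>M) \<le> ennreal (?b u)"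
      by (simp add: ennreal_leI)
  qed
  also have "(\<integral>\<^sup>+u. ennreal (?b u) \<partial>lborel) = ennreal (LINT u|lborel. ?b u)"
    by (intro nn_integral_eq_integral bint AE_I2 b0)
  finally have "(\<integral>\<^sup>+\<omega>. ennreal (pot_diff_bound (x + X t \<omega>)) \<partial>M) \<le> ennreal (1 / pi) * ennreal (LINT u|lborel. ?b u)"
    unfolding eq by (rule mult_left_mono) simp
  also have "\<dots> < \<infinity>" by (simp add: ennreal_mult_less_top)
  finally show "(\<integral>\<^sup>+\<omega>. ennreal (pot_diff_bound (x + X t \<omega>)) \<partial>M) < \<infinity>" .
qed

lemma resolvent_tendsto:
  assumes "u \<noteq> 0"
  shows "(\<lambda>n. resolvent (1 / real (Suc n)) u) \<longlonglongrightarrow> - 1 / \<eta> u"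
proof -
  have "(\<lambda>n. complex_of_real (1 / real (Suc n)) - \<eta> u) \<longlonglongrightarrow> complex_of_real 0 - \<eta> u"
    by (intro tendsto_diff tendsto_of_real tendsto_const LIMSEQ_Suc[OF lim_1_over_n])
  from tendsto_divide[OF tendsto_const[of "1 :: complex"] this]
  show ?thesis using symbol_nonzero[OF assms] by (simp add: resolvent_def)
qed

text \<open>Dominated convergence on the half-line. The cosine part is dominated unconditionally;
  the sine part near 0 is first order in \<open>u\<close> only, and (B) is the assumption that makes
  it integrable there.\<close>

lemma pot_diff_tendsto_levy_h:
  assumes B: "set_integrable lborel {0..1} (\<lambda>u. \<bar>Im (complex_of_real u / \<eta> u)\<bar>)"
  shows "(\<lambda>n. pot_diff (1 / real (Suc n)) x) \<longlonglongrightarrow> levy_h \<eta> x"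
proof -
  let ?q = "\<lambda>n. 1 / real (Suc n)"
  let ?r = "\<lambda>n u. Re ((1 - iexp (u * x)) * resolvent (?q n) u)"
  let ?l = "\<lambda>u. Re ((iexp (u * x) - 1) / \<eta> u)"
  let ?w = "\<lambda>u. min (u\<^sup>2) 1 / cmod (\<eta> u)"
  \<comment> \<open>First the cosine term; then the sine term, for \<open>u > 1\<close> through
    \<open>1 / cmod (\<eta> u)\<close>, and for \<open>u <= 1\<close> through
    \<open>\<bar>sin (u * x)\<bar> <= \<bar>u * x\<bar>\<close>, whose factor \<open>u\<close> is
    absorbed into the integrand of (B).\<close>
  let ?W = "\<lambda>u. (2 + x\<^sup>2) * ?w u + (?w u + \<bar>x\<bar> * (indicator {0..1} u * \<bar>Im (complex_of_real u / \<eta> u)\<bar>))"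
  have "(\<lambda>n. LINT u|lborel. indicator {0<..} u *\<^sub>R ?r n u) \<longlonglongrightarrow>
    (LINT u|lborel. indicator {0<..} u *\<^sub>R ?l u)"
  proof (rule integral_dominated_convergence[where w="?W"])
    have "integrable lborel (\<lambda>u. indicator {0..1} u * \<bar>Im (complex_of_real u / \<eta> u)\<bar>)"
      using B by (simp add: set_integrable_def)
    then show "integrable lborel ?W"
      by (intro Bochner_Integration.integrable_add integrable_mult_right inverse_symbol_integrable)
    have rm: "resolvent (?q n) \<in> borel_measurable borel" for n by (rule resolvent_measurable) simp
    note [measurable] = rm
    show "(\<lambda>u. indicator {0<..} u *\<^sub>R ?r n u) \<in> borel_measurable lborel" for n
      by measurable
    show "(\<lambda>u. indicator {0<..} u *\<^sub>R ?l u) \<in> borel_measurable lborel"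
      by measurable
    show "AE u in lborel. (\<lambda>n. indicator {0<..} u *\<^sub>R ?r n u) \<longlonglongrightarrow> indicator {0<..} u *\<^sub>R ?l u"
    proof (rule AE_I2)
      fix u :: real
      show "(\<lambda>n. indicator {0<..} u *\<^sub>R ?r n u) \<longlonglongrightarrow> indicator {0<..} u *\<^sub>R ?l u"
      proof (cases "u > 0")
        case True
        have lim: "(\<lambda>n. ?r n u) \<longlonglongrightarrow> Re ((1 - iexp (u * x)) * (- 1 / \<eta> u))"
          using True by (intro tendsto_Re tendsto_mult tendsto_const resolvent_tendsto) auto
        have eq: "(1 - iexp (u * x)) * (- 1 / \<eta> u) = (iexp (u * x) - 1) / \<eta> u"
          by (simp add: diff_divide_distrib left_diff_distrib)
        have ind: "indicator {0<..} u = (1 :: real)" using True by simp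
        show ?thesis using lim unfolding ind scaleR_one eq .
      qed simp
    qed
    fix n
    show "AE u in lborel. norm (indicator {0<..} u *\<^sub>R ?r n u) \<le> ?W u"
    proof (rule AE_I2)
      fix u :: real
      have w0: "0 \<le> ?w u" by (intro divide_nonneg_nonneg) auto
      have W0: "0 \<le> ?W u" using w0 by (intro add_nonneg_nonneg mult_nonneg_nonneg) auto
      show "norm (indicator {0<..} u *\<^sub>R ?r n u) \<le> ?W u"
      proof (cases "u > 0")
        case True
        have q: "?q n > 0" by simp
        have 1: "\<bar>(1 - cos (u * x)) * Re (resolvent (?q n) u)\<bar> \<le> (2 + x\<^sup>2) * ?w u"
        proof -
          have "\<bar>(1 - cos (u * x)) * Re (resolvent (?q n) u)\<bar> = (1 - cos (u * x)) * \<bar>Re (resolvent (?q n) u)\<bar>"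
            by (simp add: abs_mult)
          then show ?thesis using order_trans[OF cos_resolvent_le[OF q, of u x] one_minus_cos_div_le[of u x]] by simp
        qed
        have 2: "\<bar>sin (u * x) * Im (resolvent (?q n) u)\<bar> \<le> ?w u + \<bar>x\<bar> * (indicator {0..1} u * \<bar>Im (complex_of_real u / \<eta> u)\<bar>)"
        proof (cases "u \<le> 1")
          case u1: True
          have "\<bar>sin (u * x) * Im (resolvent (?q n) u)\<bar> \<le> \<bar>u * x\<bar> * \<bar>Im (1 / \<eta> u)\<bar>"
            unfolding abs_mult[of "sin _"] using True q
            by (intro mult_mono abs_sin_x_le_abs_x abs_Im_resolvent_le) auto
          also have "\<dots> = \<bar>x\<bar> * \<bar>Im (complex_of_real u / \<eta> u)\<bar>"
          proof -
            have "Im (complex_of_real u / \<eta> u) = u * Im (1 / \<eta> u)" by (simp add: Im_divide)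
            then show ?thesis by (simp add: abs_mult)
          qed
          finally have le: "\<bar>sin (u * x) * Im (resolvent (?q n) u)\<bar> \<le> \<bar>x\<bar> * \<bar>Im (complex_of_real u / \<eta> u)\<bar>" .
          have ind: "indicator {0..1} u = (1 :: real)" using True u1 by simp
          show ?thesis using le w0 unfolding ind mult_1_left by linarith
        next
          case False
          then have "1 \<le> u\<^sup>2" using True one_le_power[of u 2] by simp
          have "\<bar>sin (u * x) * Im (resolvent (?q n) u)\<bar> \<le> 1 * cmod (resolvent (?q n) u)"
            unfolding abs_mult by (intro mult_mono abs_Im_le_cmod) auto
          also have "\<dots> \<le> 1 / cmod (\<eta> u)"
            using cmod_resolvent_le[OF q symbol_nonzero[of u]] True by simp
          also have "\<dots> = ?w u" using \<open>1 \<le> u\<^sup>2\<close> by (simp add: min_absorb2)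
          finally show ?thesis by (simp add: add_increasing2)
        qed
        have "\<bar>?r n u\<bar> \<le> ?W u"
          unfolding Re_one_minus_iexp_mult by (rule order_trans[OF abs_triangle_ineq add_mono[OF 1 2]])
        then show ?thesis using True by simp
      next
        case False then show ?thesis using W0 by simp
      qed
    qed
  qed
  then have "(\<lambda>n. 1 / pi * (LBINT u:{0<..}. ?r n u)) \<longlonglongrightarrow> levy_h \<eta> x"
    unfolding levy_h_def set_lebesgue_integral_def by (intro tendsto_mult tendsto_const)
  moreover have "pot_diff (?q n) x = 1 / pi * (LBINT u:{0<..}. ?r n u)" for n
    by (rule pot_diff_half_line) simp
  ultimately show ?thesis by simp
qed

text \<open>The first factor is at most \<open>q * t * exp t\<close>, and \<open>pot q 0\<close> is
  at most the integral defining \<open>pot_bound q\<close>. It remains that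
  \<open>q * cmod (resolvent q u)\<close> tends to 0 off the origin, under a domination by
  \<open>resolvent 1\<close>.\<close>

lemma q_mult_pot_0_tendsto_0:
  assumes t: "0 \<le> t"
  shows "(\<lambda>n. (exp (1 / real (Suc n) * t) - 1) * pot (1 / real (Suc n)) 0) \<longlonglongrightarrow> 0"
proof -
  let ?q = "\<lambda>n. 1 / real (Suc n)"
  have q: "0 < ?q n" "?q n \<le> 1" for n by auto
  have "(\<lambda>n. LINT u|lborel. ?q n * cmod (resolvent (?q n) u)) \<longlonglongrightarrow> (LINT u :: real|lborel. (0 :: real))"
  proof (rule integral_dominated_convergence[where w="\<lambda>u. 2 * cmod (resolvent 1 u)"])
    show "integrable lborel (\<lambda>u. 2 * cmod (resolvent 1 u))" using resolvent_integrable[of 1] by simp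
    have rm: "resolvent (?q n) \<in> borel_measurable borel" for n by (rule resolvent_measurable) simp
    note [measurable] = rm
    show "(\<lambda>u. ?q n * cmod (resolvent (?q n) u)) \<in> borel_measurable lborel" for n by measurable
    show "AE u in lborel. (\<lambda>n. ?q n * cmod (resolvent (?q n) u)) \<longlonglongrightarrow> 0"
      using AE_lborel_singleton[of "0 :: real"]
    proof eventually_elim
      case (elim u)
      have "(\<lambda>n. ?q n * cmod (resolvent (?q n) u)) \<longlonglongrightarrow> 0 * cmod (- 1 / \<eta> u)"
        by (intro tendsto_mult tendsto_norm resolvent_tendsto elim LIMSEQ_Suc[OF lim_1_over_n])
      then show ?case by simp
    qed
    fix n
    show "AE u in lborel. norm (?q n * cmod (resolvent (?q n) u)) \<le> 2 * cmod (resolvent 1 u)"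
    proof (rule AE_I2)
      fix u
      let ?a = "cmod (complex_of_real (?q n) - \<eta> u)" and ?b = "cmod (1 - \<eta> u)"
      have a: "?q n \<le> ?a" "0 < ?a" using cmod_minus_symbol_ge(1)[of "?q n" u] q[of n] by auto
      have b: "0 < ?b" using symbol_ne[of 1 u] by simp
      \<comment> \<open>As \<open>q <= 1\<close>, this gives
        \<open>q * ?b <= q * ?a + q * (1 - q)\<close>; both summands are at most \<open>?a\<close>
        because \<open>q <= ?a\<close>.\<close>
      have "?b \<le> ?a + cmod (complex_of_real (1 - ?q n))"
        using norm_triangle_ineq[of "complex_of_real (?q n) - \<eta> u" "complex_of_real (1 - ?q n)"] by simp
      also have "cmod (complex_of_real (1 - ?q n)) = 1 - ?q n" using q[of n] by (simp only: norm_of_real)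
      finally have "?q n * ?b \<le> ?q n * (?a + (1 - ?q n))" using q(1)[of n] by (intro mult_left_mono) auto
      also have "\<dots> = ?q n * ?a + ?q n * (1 - ?q n)" by (rule distrib_left)
      also have "\<dots> \<le> 1 * ?a + ?a * 1"
        using q[of n] a by (intro add_mono mult_mono) auto
      finally have "?q n * ?b \<le> 2 * ?a" by simp
      then have "?q n \<le> 2 * ?a / ?b" by (rule mult_imp_le_div_pos[OF b])
      then have "?q n / ?a \<le> 2 / ?b" by (intro mult_imp_div_pos_le[OF a(2)]) (simp only: times_divide_eq_left)
      then show "norm (?q n * cmod (resolvent (?q n) u)) \<le> 2 * cmod (resolvent 1 u)"
        by (simp add: resolvent_def norm_divide)
    qed
  qed simp
  then have "(\<lambda>n. t * exp t * (1 / (2 * pi) * (LINT u|lborel. ?q n * cmod (resolvent (?q n) u)))) \<longlonglongrightarrow> t * exp t * (1 / (2 * pi) * 0)"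
    by (intro tendsto_mult tendsto_const) simp
  moreover have "(LINT u|lborel. ?q n * cmod (resolvent (?q n) u)) = ?q n * (LINT u|lborel. cmod (resolvent (?q n) u))" for n
    by (rule integral_mult_right_zero)
  ultimately have lim: "(\<lambda>n. t * exp t * (?q n * pot_bound (?q n))) \<longlonglongrightarrow> 0"
    by (simp add: pot_bound_def mult_ac)
  have le: "(exp (?q n * t) - 1) * pot (?q n) 0 \<le> t * exp t * (?q n * pot_bound (?q n))" for n
  proof -
    have pb: "0 \<le> pot_bound (?q n)" using pot_bounds(1)[OF q(1), of n 0] by simp
    have qt: "?q n * t \<le> t" using q[of n] t by (intro mult_left_le_one_le) auto
    \<comment> \<open>With \<open>z = q * t\<close>, the inequality
      \<open>1 - z <= exp (- z)\<close> rearranges to \<open>exp z - 1 <= z * exp z\<close>.\<close>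
    have "1 - ?q n * t \<le> exp (- (?q n * t))" using exp_ge_add_one_self[of "- (?q n * t)"] by simp
    then have "exp (?q n * t) * (1 - ?q n * t) \<le> exp (?q n * t) * exp (- (?q n * t))" by (intro mult_left_mono) auto
    then have "exp (?q n * t) - 1 \<le> ?q n * t * exp (?q n * t)"
      by (simp add: exp_add[symmetric] algebra_simps)
    also have "\<dots> \<le> ?q n * t * exp t" using q[of n] t qt by (intro mult_left_mono) auto
    finally have e: "exp (?q n * t) - 1 \<le> ?q n * t * exp t" .
    have "(exp (?q n * t) - 1) * pot (?q n) 0 \<le> (?q n * t * exp t) * pot_bound (?q n)"
      using e q[of n] t pb pot_bounds(1)[OF q(1), of n 0] pot_nonneg[OF q(1), of n 0]
      by (intro mult_mono) auto
    then show ?thesis by (simp only: mult_ac)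
  qed
  have ge: "0 \<le> (exp (?q n * t) - 1) * pot (?q n) 0" for n
    using q[of n] t pot_nonneg[OF q(1), of n 0] by (intro mult_nonneg_nonneg) auto
  show ?thesis
    by (rule tendsto_sandwich[OF _ _ tendsto_const lim]) (use le ge in \<open>auto intro!: always_eventually simp del: of_nat_Suc\<close>)
qed

text \<open>The two inequalities of \<open>pot_diff_expectation\<close> squeeze the expectations,
  since their gap vanishes, and dominated convergence identifies the limit in the middle.
  Integrability is claimed separately because the Bochner integral of a nonintegrable function is
  0.\<close>

lemma levy_h_invariant:
  assumes B: "set_integrable lborel {0..1} (\<lambda>u. \<bar>Im (complex_of_real u / \<eta> u)\<bar>)" and t: "0 \<le> t"
  shows "integrable M (\<lambda>\<omega>. indicator (avoid_zero x 0 t) \<omega> * levy_h \<eta> (x + X t \<omega>))"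
    "(LINT \<omega>|M. indicator (avoid_zero x 0 t) \<omega> * levy_h \<eta> (x + X t \<omega>)) = levy_h \<eta> x"
proof -
  let ?q = "\<lambda>n. 1 / real (Suc n)"
  let ?G = "avoid_zero x 0 t"
  have q: "0 < ?q n" for n by simp
  have G[measurable]: "?G \<in> sets M" using t by (intro avoid_zero_sets) auto
  have fm: "(\<lambda>\<omega>. indicator ?G \<omega> * pot_diff (?q n) (x + X t \<omega>)) \<in> borel_measurable M" for n
  proof -
    have [measurable]: "(\<lambda>\<omega>. pot (?q n) (x + X t \<omega>)) \<in> borel_measurable M" using q t by (rule pot_X_measurable)
    show ?thesis unfolding pot_diff_def by measurable
  qed
  have lim: "(\<lambda>n. indicator ?G \<omega> * pot_diff (?q n) (x + X t \<omega>)) \<longlonglongrightarrow> indicator ?G \<omega> * levy_h \<eta> (x + X t \<omega>)" for \<omega>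
    by (intro tendsto_mult tendsto_const pot_diff_tendsto_levy_h B)
  have hm: "(\<lambda>\<omega>. indicator ?G \<omega> * levy_h \<eta> (x + X t \<omega>)) \<in> borel_measurable M"
    by (rule borel_measurable_LIMSEQ_real[OF lim fm])
  have bound: "norm (indicator ?G \<omega> * pot_diff (?q n) (x + X t \<omega>)) \<le> pot_diff_bound (x + X t \<omega>)" for n \<omega>
  proof -
    have "0 \<le> pot_diff (?q n) (x + X t \<omega>)" "pot_diff (?q n) (x + X t \<omega>) \<le> pot_diff_bound (x + X t \<omega>)"
      by (rule pot_diff_nonneg[OF q], rule pot_diff_le_bound[OF q])
    then show ?thesis by (cases "\<omega> \<in> ?G") auto
  qed
  note dom = pot_diff_bound_integrable[OF t, of x]
  show "integrable M (\<lambda>\<omega>. indicator ?G \<omega> * levy_h \<eta> (x + X t \<omega>))"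
    by (rule integrable_dominated_convergence[where s="\<lambda>n \<omega>. indicator ?G \<omega> * pot_diff (?q n) (x + X t \<omega>)", OF hm fm dom])
       (intro AE_I2 lim bound)+
  have lim1: "(\<lambda>n. LINT \<omega>|M. indicator ?G \<omega> * pot_diff (?q n) (x + X t \<omega>)) \<longlonglongrightarrow> (LINT \<omega>|M. indicator ?G \<omega> * levy_h \<eta> (x + X t \<omega>))"
    by (rule integral_dominated_convergence[OF hm fm dom]) (intro AE_I2 lim bound)+
  have lim2: "(\<lambda>n. pot_diff (?q n) x - (exp (?q n * t) - 1) * pot (?q n) 0) \<longlonglongrightarrow> levy_h \<eta> x - 0"
    by (intro tendsto_diff pot_diff_tendsto_levy_h B q_mult_pot_0_tendsto_0 t)
  have "(\<lambda>n. LINT \<omega>|M. indicator ?G \<omega> * pot_diff (?q n) (x + X t \<omega>)) \<longlonglongrightarrow> levy_h \<eta> x"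
  proof (rule tendsto_sandwich[OF _ _ _ pot_diff_tendsto_levy_h[OF B]])
    show "(\<lambda>n. pot_diff (?q n) x - (exp (?q n * t) - 1) * pot (?q n) 0) \<longlonglongrightarrow> levy_h \<eta> x" using lim2 by simp
    show "\<forall>\<^sub>F n in sequentially. pot_diff (?q n) x - (exp (?q n * t) - 1) * pot (?q n) 0 \<le> (LINT \<omega>|M. indicator ?G \<omega> * pot_diff (?q n) (x + X t \<omega>))"
      by (intro always_eventually allI pot_diff_expectation(2) q t)
    show "\<forall>\<^sub>F n in sequentially. (LINT \<omega>|M. indicator ?G \<omega> * pot_diff (?q n) (x + X t \<omega>)) \<le> pot_diff (?q n) x"
      by (intro always_eventually allI pot_diff_expectation(1) q t)
  qed
  with lim1 show "(LINT \<omega>|M. indicator ?G \<omega> * levy_h \<eta> (x + X t \<omega>)) = levy_h \<eta> x"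
    by (rule LIMSEQ_unique)
qed

end

lemma levy_h_0: "levy_h \<eta> 0 = 0"
  by (simp add: levy_h_def set_lebesgue_integral_def)

theorem mainTheorem3:
  fixes M :: "'a measure" and X :: "real \<Rightarrow> 'a \<Rightarrow> real"
    and \<eta> :: "real \<Rightarrow> complex" and b a :: real and \<nu> :: "real measure"
  assumes "levy_process M X"
    and "is_levy_symbol M X \<eta>"
    and "a \<ge> 0" and "levy_measure \<nu>" and "\<And>u. \<eta> u = levy_khintchine b a \<nu> u"
    and A: "\<And>q::real. q > 0 \<Longrightarrow> integrable lborel (\<lambda>u. 1 / (complex_of_real q - \<eta> u))"
    and B: "set_integrable lborel {0..1} (\<lambda>u. \<bar>Im (complex_of_real u / \<eta> u)\<bar>)"
  shows "\<forall>t\<ge>0. \<forall>x.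
    integrable (completion M) (killed_eval X x (levy_h \<eta>) t) \<and>
    killed_expectation M X x (levy_h \<eta>) t = levy_h \<eta> x"
proof -
  have \<eta>: "\<eta> = levy_khintchine b a \<nu>" using assms(5) by auto
  obtain Y N where Y: "cadlag_levy M Y" and N: "N \<in> null_sets M"
    and YX: "\<And>t \<omega>. \<omega> \<in> space M - N \<Longrightarrow> Y t \<omega> = X t \<omega>"
    using levy_process_cadlag_version[OF assms(1)] by blast
  interpret Y: cadlag_levy M Y by (rule Y)
  have Xm: "X t \<in> borel_measurable M" if "t \<ge> 0" for t
    using assms(1) that by (simp add: levy_process_def)
  \<comment> \<open>Condition (A) at \<open>q = 1\<close> is what excludes the pure drift
    here.\<close>
  have lower: "\<exists>c>0. \<exists>r>0. \<forall>u. \<bar>u\<bar> \<le> r \<longrightarrow> c * u\<^sup>2 \<le> - Re (\<eta> u)"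
    using levy_khintchine_quadratic_lower_bound[OF assms(4,3), of b] A[of 1] by (simp add: \<eta>)
  interpret Y: levy_symbol M Y \<eta>
  proof
    fix t u :: real assume t: "0 \<le> t"
    have "(CLINT \<omega>|M. iexp (u * Y t \<omega>)) = (CLINT \<omega>|M. iexp (u * X t \<omega>))"
    proof (rule integral_cong_AE)
      show "AE \<omega> in M. iexp (u * Y t \<omega>) = iexp (u * X t \<omega>)"
        using AE_not_in[OF N] AE_space by eventually_elim (simp add: YX)
    qed (use Xm[OF t] Y.X_measurable[OF t] in measurable)
    then show "(CLINT \<omega>|M. iexp (u * Y t \<omega>)) = exp (complex_of_real t * \<eta> u)"
      using assms(2) t by (simp add: is_levy_symbol_def)
  next
    show "\<eta> 0 = 0" by (simp add: \<eta> levy_khintchine_0)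
    show "\<eta> (- u) = cnj (\<eta> u)" for u by (simp add: \<eta> levy_khintchine_minus)
  qed (fact lower A)+
  show ?thesis
  proof (intro allI impI)
    fix t x :: real assume t: "0 \<le> t"
    \<comment> \<open>Built from the everywhere cadlag version and measurable for \<open>M\<close>
      itself; the killed evaluation of \<open>X\<close> agrees with it almost surely and so becomes
      measurable for the completion.\<close>
    let ?g = "\<lambda>\<omega>. indicator (Y.avoid_zero x 0 t) \<omega> * levy_h \<eta> (x + Y t \<omega>)"
    note g = Y.levy_h_invariant[OF B t, of x]
    have gm: "?g \<in> borel_measurable M" using g(1) by (rule borel_measurable_integrable)
    have "AE \<omega> in M. killed_eval X x (levy_h \<eta>) t \<omega> = killed_eval Y x (levy_h \<eta>) t \<omega>"
      using AE_not_in[OF N] AE_space by eventually_elim (simp add: killed_eval_def YX)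
    with Y.AE_killed_eval[where f="levy_h \<eta>" and x=x, OF t levy_h_0]
    have ae: "AE \<omega> in M. killed_eval X x (levy_h \<eta>) t \<omega> = ?g \<omega>"
      by eventually_elim simp
    have km: "killed_eval X x (levy_h \<eta>) t \<in> borel_measurable (completion M)"
      by (rule borel_measurable_completion_AE[OF ae gm])
    have gc: "?g \<in> borel_measurable (completion M)" using gm by (rule measurable_completion)
    have "integrable (completion M) ?g" using g(1) by (simp only: integrable_completion[OF gm])
    then have "integrable (completion M) (killed_eval X x (levy_h \<eta>) t)"
      using integrable_cong_AE[OF km gc AE_completion[OF ae]] by simp
    moreover have "killed_expectation M X x (levy_h \<eta>) t = levy_h \<eta> x"
      unfolding killed_expectation_def
      using integral_cong_AE[OF km gc AE_completion[OF ae]] integral_completion[OF gm] g(2) by simp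
    ultimately show "integrable (completion M) (killed_eval X x (levy_h \<eta>) t) \<and>
      killed_expectation M X x (levy_h \<eta>) t = levy_h \<eta> x" ..
  qed
qed

end
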